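(* Let $E$ be an arbitrary directed graph and $K$ an arbitrary field. All the Chen simple left $L_K(E)$-modules are pairwise non-isomorphic. That is, consider the following modules: (1) $\mathbf N_w$, one for each sink $w$ of $E$; (2) $\mathbf N_v^{B_{H(v)}}$, one for each infinite emitter $v$ with $v\in B_{H(v)}$; (3) $\mathbf N_v^{H(v)}$, one for each infinite emitter $v$ with $r(s^{-1}(v))\subseteq H(v)$; (4) $V_{[p]}$, one for each tail-equivalence class $[p]$ of infinite paths in $E$; (5) $V^f_{[q]}$, one for each pair consisting of an exclusive cycle $c$ (up to rotation), with $q=c^\infty$, and an irreducible polynomial $f(x)=1+a_1x+\cdots+a_nx^n$ ($n\ge1$) in $K[x,x^{-1}]$ with $f\ne1-x$. Then two modules of different types in this list, or of the same type but with different parameters, are not isomorphic as left $L_K(E)$-modules.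
   Context: Graphs. A directed graph $E=(E^0,E^1,r,s)$ consists of sets $E^0$ (vertices), $E^1$ (edges), of any cardinality, and maps $r,s:E^1\to E^0$. A vertex $v$ is a sink if $s^{-1}(v)=\emptyset$, regular if $s^{-1}(v)$ is finite and non-empty, an infinite emitter if $s^{-1}(v)$ is infinite. A path of length $n\ge1$ is $e_1\cdots e_n$ with $r(e_i)=s(e_{i+1})$; vertices are paths of length $0$. Write $u\ge v$ if there is a path from $u$ to $v$. A non-trivial path $e_1\cdots e_n$ is closed if $r(e_n)=s(e_1)$; a cycle based at $s(e_1)$ is a closed path with $s(e_i)\ne s(e_j)$ for $i\neq j$; cycles are considered up to rotation. A cycle $c$ is exclusive if no vertex on $c$ is the base of a cycle other than the rotate of $c$ based at that vertex. Leavitt path algebra. $L_K(E)$ is the $K$-algebra generated by pairwise orthogonal idempotents $v\in E^0$ and elements $e,e^*$ ($e\in E^1$) with relations: $s(e)e=e=er(e)$; $r(e)e^*=e^*=e^*s(e)$; $e^*e=r(e)$ and $e^*f=0$ for $e\ne f$; $v=\sum_{s(e)=v}ee^*$ for every regular vertex $v$. Quotient graphs. $H\subseteq E^0$ is hereditary if $v\in H$, $v\ge w$ imply $w\in H$, and a hereditary $H$ is saturated if $v\in H$ for every regular $v$ with $r(s^{-1}(v))\subseteq H$. For $H$ hereditary saturated, $B_H$ is the set of infinite emitters $w\in E^0\setminus H$ with $1\le|s^{-1}(w)\cap r^{-1}(E^0\setminus H)|<\infty$; for $v\in B_H$, $v^H=v-\sum_{s(e)=v,\,r(e)\notin H}ee^*$.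 For $S\subseteq B_H$, $I(H,S)$ is the ideal of $L_K(E)$ generated by $H\cup\{v^H:v\in S\}$. The quotient graph $E\backslash(H,S)$ has vertices $(E^0\setminus H)\cup\{v':v\in B_H\setminus S\}$ and edges $\{e\in E^1:r(e)\notin H\}\cup\{e':e\in E^1,r(e)\in B_H\setminus S\}$, with $s(e')=s(e)$, $r(e')=r(e)'$. There is a surjection $L_K(E)\to L_K(E\backslash(H,S))$ with kernel $I(H,S)$, given by: vertices $u\in H$ and edges $e$ (and $e^*$) with $r(e)\in H$ go to $0$; $u\mapsto u+u'$ if $u\in B_H\setminus S$ and $u\mapsto u$ for other $u\notin H$; $e\mapsto e+e'$, $e^*\mapsto e^*+(e')^*$ if $r(e)\in B_H\setminus S$, and $e\mapsto e$, $e^*\mapsto e^*$ for other $e$ with $r(e)\notin H$. For $v\in E^0$ let $M(v)=\{w\in E^0:w\ge v\}$ and $H(v)=E^0\setminus M(v)$ (hereditary saturated if $v$ is a sink or infinite emitter). Infinite paths. For an infinite path $p=e_1e_2\cdots$ put $\tau_{>n}(p)=e_{n+1}e_{n+2}\cdots$. Infinite paths $p,q$ are tail-equivalent if $\tau_{>m}(p)=\tau_{>n}(q)$ for some positive integers $m,n$; $[p]$ is the class of $p$. $g^\infty=ggg\cdots$ for a closed path $g$. The modules (all simple). (1) $\mathbf N_w$, $w$ a sink: the $K$-space with basis all finite paths in $E$ ending in $w$, with action on a basis path $q$: $v\cdot q=q$ if $v=s(q)$, else $0$; $e\cdot q=eq$ if $r(e)=s(q)$, else $0$; $e^*\cdot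 q=q'$ if $q=eq'$, else $0$ (so $e^*\cdot w=0$). (2) $\mathbf N_v^{B_{H(v)}}$: with $F=E\backslash(H(v),B_{H(v)}\setminus\{v\})$, the vertex $v'$ is a sink in $F$, and $\mathbf N_v^{B_{H(v)}}$ is the $L_K(F)$-module $\mathbf N_{v'}$ viewed as an $L_K(E)$-module via $L_K(E)\to L_K(F)$. (3) $\mathbf N_v^{H(v)}$: $v$ is a sink of $G=E\backslash(H(v),B_{H(v)})$, and $\mathbf N_v^{H(v)}$ is the $L_K(G)$-module $\mathbf N_v$ viewed as an $L_K(E)$-module via $L_K(E)\to L_K(G)$. (4) $V_{[p]}$: the $K$-space with basis $[p]$ and action given by the same formulas as in (1). (5) $V^f_{[q]}$, $q=c^\infty$, $c=e_1\cdots e_m$ (a chosen representative of the cycle): let $K'=K[x,x^{-1}]/(f(x))$, a field, $\overline x$ the class of $x$, and $\sigma$ the $K'$-algebra automorphism of $L_{K'}(E)$ fixing all vertices and all $e,e^*$ with $e\in E^1$, $e\ne e_1$, with $\sigma(e_1)=\overline xe_1$, $\sigma(e_1^* )=\overline x^{-1}e_1^*$. $V^f_{[q]}$ is the $L_{K'}(E)$-module $V_{[q]}$ (with $K'$-basis $[q]$) twisted by $\sigma$, i.e. $a*m=\sigma(a)m$, with scalars restricted to $L_K(E)$. *)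

theory Defs
  imports "Graph_Theory.Arc_Walk" "HOL-Library.Stream" "HOL-Algebra.Algebra"
begin

section \<open>Graphs\<close>

text \<open>
  A directed graph is a well-formed \<^typ>\<open>('v, 'e) pre_digraph\<close>, with source map \<^const>\<open>tail\<close>
  and range map \<^const>\<open>head\<close>; neither vertices nor arcs need be finite.
  A cycle is a \<^const>\<open>pre_digraph.cycle\<close>: a non-empty closed list of arcs visiting no vertex twice.
\<close>

definition sinks :: "('v, 'e) pre_digraph \<Rightarrow> 'v set" where
  "sinks E = {v \<in> verts E. out_arcs E v = {}}"

definition regular_verts :: "('v, 'e) pre_digraph \<Rightarrow> 'v set" where
  "regular_verts E = {v \<in> verts E. finite (out_arcs E v) \<and> out_arcs E v \<noteq> {}}"

definition infinite_emitters :: "('v, 'e) pre_digraph \<Rightarrow> 'v set" where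
  "infinite_emitters E = {v \<in> verts E. infinite (out_arcs E v)}"

text \<open>The sets $M(v)$, $H(v)$ and $B_H$.\<close>

definition ancestors :: "('v, 'e) pre_digraph \<Rightarrow> 'v \<Rightarrow> 'v set" where
  "ancestors E v = {w \<in> verts E. w \<rightarrow>\<^sup>*\<^bsub>E\<^esub> v}"

definition non_ancestors :: "('v, 'e) pre_digraph \<Rightarrow> 'v \<Rightarrow> 'v set" where
  "non_ancestors E v = verts E - ancestors E v"

definition breaking_verts :: "('v, 'e) pre_digraph \<Rightarrow> 'v set \<Rightarrow> 'v set" where
  "breaking_verts E H = {w \<in> infinite_emitters E. w \<notin> H \<and>
     (let A = {e \<in> out_arcs E w. head E e \<in> verts E - H} in A \<noteq> {} \<and> finite A)}"

text \<open>The quotient graph $E\backslash(H,S)$; \<open>Prime\<close> marks the additional vertices and edges.\<close>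

datatype 'a tagged = Orig 'a | Prime 'a

definition quotient_graph ::
  "('v, 'e) pre_digraph \<Rightarrow> 'v set \<Rightarrow> 'v set \<Rightarrow> ('v tagged, 'e tagged) pre_digraph" where
  "quotient_graph E H S =
    \<lparr>verts = Orig ` (verts E - H) \<union> Prime ` (breaking_verts E H - S),
     arcs = Orig ` {e \<in> arcs E. head E e \<notin> H}
          \<union> Prime ` {e \<in> arcs E. head E e \<in> breaking_verts E H - S},
     tail = (\<lambda>x. case x of Orig e \<Rightarrow> Orig (tail E e) | Prime e \<Rightarrow> Orig (tail E e)),
     head = (\<lambda>x. case x of Orig e \<Rightarrow> Orig (head E e) | Prime e \<Rightarrow> Prime (head E e))\<rparr>"

definition infinite_path :: "('v, 'e) pre_digraph \<Rightarrow> 'e stream \<Rightarrow> bool" where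
  "infinite_path E p \<longleftrightarrow>
     sset p \<subseteq> arcs E \<and> (\<forall>i. head E (p !! i) = tail E (p !! Suc i))"

definition tail_equivalent :: "'e stream \<Rightarrow> 'e stream \<Rightarrow> bool" where
  "tail_equivalent p q \<longleftrightarrow> (\<exists>m n. 0 < m \<and> 0 < n \<and> sdrop m p = sdrop n q)"

definition tail_class :: "('v, 'e) pre_digraph \<Rightarrow> 'e stream \<Rightarrow> 'e stream set" where
  "tail_class E p = {q. infinite_path E q \<and> tail_equivalent p q}"

definition tail_classes :: "('v, 'e) pre_digraph \<Rightarrow> 'e stream set set" where
  "tail_classes E = {tail_class E p | p. infinite_path E p}"

definition rotations :: "'a list \<Rightarrow> 'a list set" where
  "rotations c = {rotate k c | k. True}"

definition exclusive_cycle :: "('v, 'e) pre_digraph \<Rightarrow> 'e list \<Rightarrow> bool" where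
  "exclusive_cycle E c \<longleftrightarrow> pre_digraph.cycle E c \<and>
     (\<forall>d. pre_digraph.cycle E d \<and> tail E (hd d) \<in> tail E ` set c \<longrightarrow> d \<in> rotations c)"

definition exclusive_cycles :: "('v, 'e) pre_digraph \<Rightarrow> 'e list set set" where
  "exclusive_cycles E = {rotations c | c. exclusive_cycle E c}"


section \<open>Monoid algebras\<close>

definition fin_supp :: "('k, 'r) ring_scheme \<Rightarrow> 'b set \<Rightarrow> ('b \<Rightarrow> 'k) set" where
  "fin_supp K B = {f. (\<forall>b. f b \<in> carrier K) \<and> (\<forall>b. b \<notin> B \<longrightarrow> f b = \<zero>\<^bsub>K\<^esub>) \<and>
     finite {b. f b \<noteq> \<zero>\<^bsub>K\<^esub>}}"

definition single :: "('k, 'r) ring_scheme \<Rightarrow> 'k \<Rightarrow> 'b \<Rightarrow> 'b \<Rightarrow> 'k" where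
  "single K k b = (\<lambda>x. if x = b then k else \<zero>\<^bsub>K\<^esub>)"

text \<open>
  The bilinear extension of a partial operation on basis elements, where an undefined
  product counts as $0$.
\<close>

definition bilinear_ext :: "('k, 'r) ring_scheme \<Rightarrow> ('a \<Rightarrow> 'b \<Rightarrow> 'c option) \<Rightarrow>
    ('a \<Rightarrow> 'k) \<Rightarrow> ('b \<Rightarrow> 'k) \<Rightarrow> 'c \<Rightarrow> 'k" where
  "bilinear_ext K op f g = (\<lambda>z.
     \<Oplus>\<^bsub>K\<^esub>p \<in> {(x, y). f x \<noteq> \<zero>\<^bsub>K\<^esub> \<and> g y \<noteq> \<zero>\<^bsub>K\<^esub> \<and> op x y = Some z}. f (fst p) \<otimes>\<^bsub>K\<^esub> g (snd p))"

definition monoid_algebra :: "('k, 'r) ring_scheme \<Rightarrow> ('g, 's) monoid_scheme \<Rightarrow> ('g \<Rightarrow> 'k) ring" where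
  "monoid_algebra K G =
    \<lparr>carrier = fin_supp K (carrier G),
     monoid.mult = bilinear_ext K (\<lambda>x y. Some (x \<otimes>\<^bsub>G\<^esub> y)),
     one = single K \<one>\<^bsub>K\<^esub> \<one>\<^bsub>G\<^esub>,
     ring.zero = (\<lambda>_. \<zero>\<^bsub>K\<^esub>),
     add = (\<lambda>f g x. f x \<oplus>\<^bsub>K\<^esub> g x)\<rparr>"

definition free_monoid :: "'a set \<Rightarrow> 'a list monoid" where
  "free_monoid S = \<lparr>carrier = lists S, monoid.mult = (@), one = []\<rparr>"


section \<open>Leavitt path algebras\<close>

datatype ('v, 'e) lpa_gen = Vtx 'v | Edge 'e | Ghost 'e

definition lpa_gens :: "('v, 'e) pre_digraph \<Rightarrow> ('v, 'e) lpa_gen set" where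
  "lpa_gens E = Vtx ` verts E \<union> Edge ` arcs E \<union> Ghost ` arcs E"

definition free_lpa :: "('k, 'r) ring_scheme \<Rightarrow> ('v, 'e) pre_digraph \<Rightarrow>
    (('v, 'e) lpa_gen list \<Rightarrow> 'k) ring" where
  "free_lpa K E = monoid_algebra K (free_monoid (lpa_gens E))"

text \<open>The defining relations, each written as an element that is to vanish.\<close>

definition lpa_rels :: "('k, 'r) ring_scheme \<Rightarrow> ('v, 'e) pre_digraph \<Rightarrow>
    (('v, 'e) lpa_gen list \<Rightarrow> 'k) set" where
  "lpa_rels K E = (let F = free_lpa K E; w = single K \<one>\<^bsub>K\<^esub> in
      {w [Vtx v, Vtx v] \<ominus>\<^bsub>F\<^esub> w [Vtx v] | v. v \<in> verts E}
    \<union> {w [Vtx u, Vtx v] | u v. u \<in> verts E \<and> v \<in> verts E \<and> u \<noteq> v}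
    \<union> {w [Vtx (tail E e), Edge e] \<ominus>\<^bsub>F\<^esub> w [Edge e] | e. e \<in> arcs E}
    \<union> {w [Edge e, Vtx (head E e)] \<ominus>\<^bsub>F\<^esub> w [Edge e] | e. e \<in> arcs E}
    \<union> {w [Vtx (head E e), Ghost e] \<ominus>\<^bsub>F\<^esub> w [Ghost e] | e. e \<in> arcs E}
    \<union> {w [Ghost e, Vtx (tail E e)] \<ominus>\<^bsub>F\<^esub> w [Ghost e] | e. e \<in> arcs E}
    \<union> {w [Ghost e, Edge e] \<ominus>\<^bsub>F\<^esub> w [Vtx (head E e)] | e. e \<in> arcs E}
    \<union> {w [Ghost e, Edge f] | e f. e \<in> arcs E \<and> f \<in> arcs E \<and> e \<noteq> f}
    \<union> {w [Vtx v] \<ominus>\<^bsub>F\<^esub> (\<Oplus>\<^bsub>F\<^esub>e \<in> out_arcs E v. w [Edge e, Ghost e]) | v. v \<in> regular_verts E})"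

definition lpa_ideal :: "('k, 'r) ring_scheme \<Rightarrow> ('v, 'e) pre_digraph \<Rightarrow>
    (('v, 'e) lpa_gen list \<Rightarrow> 'k) set" where
  "lpa_ideal K E = Idl\<^bsub>free_lpa K E\<^esub> (lpa_rels K E)"

text \<open>
  $L_K(E)$ is in general not unital. Its elements are the cosets of those elements of the free
  unital algebra that have no constant term. The operations are those of the unital quotient
  algebra; in particular the \<^const>\<open>one\<close> component belongs to that larger algebra and is
  not an element of $L_K(E)$.
\<close>

definition lpa :: "('k, 'r) ring_scheme \<Rightarrow> ('v, 'e) pre_digraph \<Rightarrow>
    ('k, (('v, 'e) lpa_gen list \<Rightarrow> 'k) set) module" where
  "lpa K E = (let F = free_lpa K E; I = lpa_ideal K E; Q = F Quot I in
    \<lparr>carrier = {I +>\<^bsub>F\<^esub> x | x. x \<in> carrier F \<and> x [] = \<zero>\<^bsub>K\<^esub>},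
     monoid.mult = monoid.mult Q, one = one Q, ring.zero = ring.zero Q, add = add Q,
     smult = (\<lambda>k a. (I +>\<^bsub>F\<^esub> single K k []) \<otimes>\<^bsub>Q\<^esub> a)\<rparr>)"

definition lpa_elt :: "('k, 'r) ring_scheme \<Rightarrow> ('v, 'e) pre_digraph \<Rightarrow> ('v, 'e) lpa_gen \<Rightarrow>
    (('v, 'e) lpa_gen list \<Rightarrow> 'k) set" where
  "lpa_elt K E g = lpa_ideal K E +>\<^bsub>free_lpa K E\<^esub> single K \<one>\<^bsub>K\<^esub> [g]"

text \<open>
  The homomorphism from $L_K(E)$ to a $K$-algebra \<open>A\<close> that sends each generator \<open>g\<close> to \<open>h g\<close>
  (meaningful if \<open>h\<close> respects the defining relations, so that the image of a coset is a singleton).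
\<close>

definition lpa_hom :: "('k, 'r) ring_scheme \<Rightarrow> ('k, 'a, 's) module_scheme \<Rightarrow>
    (('v, 'e) lpa_gen \<Rightarrow> 'a) \<Rightarrow> (('v, 'e) lpa_gen list \<Rightarrow> 'k) set \<Rightarrow> 'a" where
  "lpa_hom K A h a = the_elem ((\<lambda>x. \<Oplus>\<^bsub>A\<^esub>w \<in> {w. x w \<noteq> \<zero>\<^bsub>K\<^esub>}.
     x w \<odot>\<^bsub>A\<^esub> foldr (\<lambda>g y. h g \<otimes>\<^bsub>A\<^esub> y) w \<one>\<^bsub>A\<^esub>) ` a)"

text \<open>The surjection $L_K(E)\to L_K(E\backslash(H,S))$.\<close>

definition quotient_hom :: "('k, 'r) ring_scheme \<Rightarrow> ('v, 'e) pre_digraph \<Rightarrow> 'v set \<Rightarrow> 'v set \<Rightarrow>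
    (('v, 'e) lpa_gen list \<Rightarrow> 'k) set \<Rightarrow> (('v tagged, 'e tagged) lpa_gen list \<Rightarrow> 'k) set" where
  "quotient_hom K E H S =
    (let Q = quotient_graph E H S; A = lpa K Q; g = lpa_elt K Q; B = breaking_verts E H - S in
     lpa_hom K A (\<lambda>x. case x of
         Vtx u \<Rightarrow> if u \<in> H then \<zero>\<^bsub>A\<^esub>
                  else if u \<in> B then g (Vtx (Orig u)) \<oplus>\<^bsub>A\<^esub> g (Vtx (Prime u))
                  else g (Vtx (Orig u))
       | Edge e \<Rightarrow> if head E e \<in> H then \<zero>\<^bsub>A\<^esub>
                  else if head E e \<in> B then g (Edge (Orig e)) \<oplus>\<^bsub>A\<^esub> g (Edge (Prime e))
                  else g (Edge (Orig e))
       | Ghost e \<Rightarrow> if head E e \<in> H then \<zero>\<^bsub>A\<^esub>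
                  else if head E e \<in> B then g (Ghost (Orig e)) \<oplus>\<^bsub>A\<^esub> g (Ghost (Prime e))
                  else g (Ghost (Orig e))))"


section \<open>Left modules\<close>

text \<open>
  Left modules over a possibly non-commutative, non-unital ring are represented by
  the record \<^typ>\<open>('a, 'm) module\<close>, of which the components \<^const>\<open>monoid.mult\<close> and \<^const>\<open>one\<close> are unused.
\<close>

definition left_module_iso :: "('a, 'r) ring_scheme \<Rightarrow> ('a, 'm, 's) module_scheme \<Rightarrow>
    ('a, 'n, 't) module_scheme \<Rightarrow> bool" where
  "left_module_iso A M N \<longleftrightarrow> (\<exists>\<phi>. bij_betw \<phi> (carrier M) (carrier N) \<and>
     (\<forall>x \<in> carrier M. \<forall>y \<in> carrier M. \<phi> (x \<oplus>\<^bsub>M\<^esub> y) = \<phi> x \<oplus>\<^bsub>N\<^esub> \<phi> y) \<and>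
     (\<forall>a \<in> carrier A. \<forall>x \<in> carrier M. \<phi> (a \<odot>\<^bsub>M\<^esub> x) = a \<odot>\<^bsub>N\<^esub> \<phi> x))"

text \<open>Restriction of scalars, for modules and for algebras.\<close>

definition pullback :: "('a, 'm, 's) module_scheme \<Rightarrow> ('b \<Rightarrow> 'a) \<Rightarrow> ('b, 'm) module" where
  "pullback M h = \<lparr>carrier = carrier M, monoid.mult = monoid.mult M, one = one M, ring.zero = ring.zero M, add = add M,
     smult = (\<lambda>b x. h b \<odot>\<^bsub>M\<^esub> x)\<rparr>"

text \<open>
  The $L_K(E)$-module with $K$-basis \<open>B\<close> on which each generator acts as a partial map
  of basis elements, \<^const>\<open>None\<close> standing for $0$.
\<close>

definition basis_module :: "('k, 'r) ring_scheme \<Rightarrow> 'b set \<Rightarrow>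
    (('v, 'e) lpa_gen \<Rightarrow> 'b \<Rightarrow> 'b option) \<Rightarrow>
    ((('v, 'e) lpa_gen list \<Rightarrow> 'k) set, 'b \<Rightarrow> 'k) module" where
  "basis_module K B act =
    \<lparr>carrier = fin_supp K B, monoid.mult = undefined, one = undefined,
     ring.zero = (\<lambda>_. \<zero>\<^bsub>K\<^esub>), add = (\<lambda>f g b. f b \<oplus>\<^bsub>K\<^esub> g b),
     smult = (\<lambda>a m. the_elem ((\<lambda>x. bilinear_ext K
        (\<lambda>w b. foldr (\<lambda>g y. Option.bind y (act g)) w (Some b)) x m) ` a))\<rparr>"


section \<open>Chen modules\<close>

text \<open>
  A finite path is a pair of its source and its list of arcs, so that \<open>(v, [])\<close> is the
  vertex \<open>v\<close>.
\<close>

definition finite_path_act :: "('v, 'e) pre_digraph \<Rightarrow> ('v, 'e) lpa_gen \<Rightarrow>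
    'v \<times> 'e list \<Rightarrow> ('v \<times> 'e list) option" where
  "finite_path_act E g q = (case g of
      Vtx v \<Rightarrow> if v = fst q then Some q else None
    | Edge e \<Rightarrow> if head E e = fst q then Some (tail E e, e # snd q) else None
    | Ghost e \<Rightarrow> (case snd q of [] \<Rightarrow> None
        | e' # es \<Rightarrow> if e' = e then Some (head E e, es) else None))"

definition infinite_path_act :: "('v, 'e) pre_digraph \<Rightarrow> ('v, 'e) lpa_gen \<Rightarrow>
    'e stream \<Rightarrow> 'e stream option" where
  "infinite_path_act E g q = (case g of
      Vtx v \<Rightarrow> if v = tail E (shd q) then Some q else None
    | Edge e \<Rightarrow> if head E e = tail E (shd q) then Some (e ## q) else None
    | Ghost e \<Rightarrow> if shd q = e then Some (stl q) else None)"

text \<open>$\mathbf N_w$\<close>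

definition chen_sink :: "('k, 'r) ring_scheme \<Rightarrow> ('v, 'e) pre_digraph \<Rightarrow> 'v \<Rightarrow>
    ((('v, 'e) lpa_gen list \<Rightarrow> 'k) set, 'v \<times> 'e list \<Rightarrow> 'k) module" where
  "chen_sink K E w = basis_module K {(u, p). pre_digraph.awalk E u p w} (finite_path_act E)"

text \<open>$\mathbf N_v^{B_{H(v)}}$\<close>

definition chen_breaking :: "('k, 'r) ring_scheme \<Rightarrow> ('v, 'e) pre_digraph \<Rightarrow> 'v \<Rightarrow>
    ((('v, 'e) lpa_gen list \<Rightarrow> 'k) set, 'v tagged \<times> 'e tagged list \<Rightarrow> 'k) module" where
  "chen_breaking K E v = (let H = non_ancestors E v; S = breaking_verts E H - {v} in
     pullback (chen_sink K (quotient_graph E H S) (Prime v)) (quotient_hom K E H S))"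

text \<open>$\mathbf N_v^{H(v)}$\<close>

definition chen_emitter :: "('k, 'r) ring_scheme \<Rightarrow> ('v, 'e) pre_digraph \<Rightarrow> 'v \<Rightarrow>
    ((('v, 'e) lpa_gen list \<Rightarrow> 'k) set, 'v tagged \<times> 'e tagged list \<Rightarrow> 'k) module" where
  "chen_emitter K E v = (let H = non_ancestors E v; S = breaking_verts E H in
     pullback (chen_sink K (quotient_graph E H S) (Orig v)) (quotient_hom K E H S))"

text \<open>$V_{[p]}$, with \<open>P\<close> the tail-equivalence class $[p]$\<close>

definition chen_path :: "('k, 'r) ring_scheme \<Rightarrow> ('v, 'e) pre_digraph \<Rightarrow> 'e stream set \<Rightarrow>
    ((('v, 'e) lpa_gen list \<Rightarrow> 'k) set, 'e stream \<Rightarrow> 'k) module" where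
  "chen_path K E P = basis_module K P (infinite_path_act E)"

text \<open>The ring $K[x,x^{-1}]$; \<open>single K \<one>\<^bsub>K\<^esub> n\<close> is $x^n$.\<close>

definition laurent_ring :: "('k, 'r) ring_scheme \<Rightarrow> (int \<Rightarrow> 'k) ring" where
  "laurent_ring K = monoid_algebra K integer_group"

definition chen_polys :: "('k, 'r) ring_scheme \<Rightarrow> (int \<Rightarrow> 'k) set" where
  "chen_polys K = {f \<in> carrier (laurent_ring K).
     f 0 = \<one>\<^bsub>K\<^esub> \<and> (\<exists>n::int. n \<ge> 1 \<and> (\<forall>i. i < 0 \<or> i > n \<longrightarrow> f i = \<zero>\<^bsub>K\<^esub>)) \<and>
     ring_irreducible\<^bsub>laurent_ring K\<^esub> f \<and>
     f \<noteq> \<one>\<^bsub>laurent_ring K\<^esub> \<ominus>\<^bsub>laurent_ring K\<^esub> single K \<one>\<^bsub>K\<^esub> 1}"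

text \<open>The field $K' = K[x,x^{-1}]/(f)$, the map $K\to K'$ and the class of $x$.\<close>

definition ext_field :: "('k, 'r) ring_scheme \<Rightarrow> (int \<Rightarrow> 'k) \<Rightarrow> (int \<Rightarrow> 'k) set ring" where
  "ext_field K f = laurent_ring K Quot (PIdl\<^bsub>laurent_ring K\<^esub> f)"

definition ext_const :: "('k, 'r) ring_scheme \<Rightarrow> (int \<Rightarrow> 'k) \<Rightarrow> 'k \<Rightarrow> (int \<Rightarrow> 'k) set" where
  "ext_const K f k = (PIdl\<^bsub>laurent_ring K\<^esub> f) +>\<^bsub>laurent_ring K\<^esub> single K k 0"

definition ext_x :: "('k, 'r) ring_scheme \<Rightarrow> (int \<Rightarrow> 'k) \<Rightarrow> (int \<Rightarrow> 'k) set" where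
  "ext_x K f = (PIdl\<^bsub>laurent_ring K\<^esub> f) +>\<^bsub>laurent_ring K\<^esub> single K \<one>\<^bsub>K\<^esub> 1"

text \<open>The automorphism of $L_K(E)$ that multiplies \<open>e\<close> by the unit \<open>t\<close> and $e^*$ by its inverse.\<close>

definition twist :: "('k, 'r) ring_scheme \<Rightarrow> ('v, 'e) pre_digraph \<Rightarrow> 'k \<Rightarrow> 'e \<Rightarrow>
    (('v, 'e) lpa_gen list \<Rightarrow> 'k) set \<Rightarrow> (('v, 'e) lpa_gen list \<Rightarrow> 'k) set" where
  "twist K E t e = lpa_hom K (lpa K E) (\<lambda>g.
     if g = Edge e then t \<odot>\<^bsub>lpa K E\<^esub> lpa_elt K E g
     else if g = Ghost e then (inv\<^bsub>K\<^esub> t) \<odot>\<^bsub>lpa K E\<^esub> lpa_elt K E g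
     else lpa_elt K E g)"

text \<open>The canonical map $L_K(E)\to L_{K'}(E)$.\<close>

definition ext_lpa :: "('k, 'r) ring_scheme \<Rightarrow> ('v, 'e) pre_digraph \<Rightarrow> (int \<Rightarrow> 'k) \<Rightarrow>
    (('v, 'e) lpa_gen list \<Rightarrow> 'k) set \<Rightarrow> (('v, 'e) lpa_gen list \<Rightarrow> (int \<Rightarrow> 'k) set) set" where
  "ext_lpa K E f = lpa_hom K (pullback (lpa (ext_field K f) E) (ext_const K f))
     (lpa_elt (ext_field K f) E)"

text \<open>$V^f_{[q]}$ for $q=c^\infty$\<close>

definition chen_twisted :: "('k, 'r) ring_scheme \<Rightarrow> ('v, 'e) pre_digraph \<Rightarrow> 'e list \<Rightarrow> (int \<Rightarrow> 'k) \<Rightarrow>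
    ((('v, 'e) lpa_gen list \<Rightarrow> 'k) set, 'e stream \<Rightarrow> (int \<Rightarrow> 'k) set) module" where
  "chen_twisted K E c f = (let K' = ext_field K f in
     pullback
       (pullback (chen_path K' E (tail_class E (Stream.cycle c)))
          (twist K' E (ext_x K f) (hd c)))
       (ext_lpa K E f))"

definition breaking_emitters :: "('v, 'e) pre_digraph \<Rightarrow> 'v set" where
  "breaking_emitters E =
    {v \<in> infinite_emitters E. v \<in> breaking_verts E (non_ancestors E v)}"

definition terminal_emitters :: "('v, 'e) pre_digraph \<Rightarrow> 'v set" where
  "terminal_emitters E =
    {v \<in> infinite_emitters E. head E ` out_arcs E v \<subseteq> non_ancestors E v}"

end

theory Submission
  imports Defs
begin

text \<open>
  All modules in question have one shape. There is a commutative ring $K'$ over $K$ (either $K$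
  itself or $K[x,x^{-1}]/(f)$) and a set of paths such that the module consists of the finitely
  supported $K'$-valued functions on that set, and every generator of $L_K(E)$ acts by a partial
  injection of paths, multiplied by a unit of $K'$ whose values on $e$ and $e^*$ are inverse to
  each other. The locale \<open>path_module\<close> captures this. For sinks and for infinite paths the
  paths are those of $E$ and the units are $1$. For the twisted modules the first edge of the
  cycle has weight $\overline x$. For the two kinds of modules attached to an infinite emitter
  the paths live in a quotient graph, and a generator of $E$ acts through its one or two copies
  there; at most one of the copies acts on a given path, so the action is again by partial
  injections.

  Elements of $L_K(E)$ are cosets in a free algebra. Before anything can be computed, the defining
  relations have to be shown to act as zero on the paths, and to be respected by the
  homomorphisms along which modules are pulled back (\<open>ext_ideal\<close>, \<open>lpa_hom_scaled_gen\<close>,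
  \<open>leavitt_family_quotient\<close>).

  Two invariants then separate the modules. The first is the set of vertices $v$ for which some
  $m \neq 0$ satisfies $vm = m$ and $e^*m = 0$ for all edges $e$ starting at $v$. Since ghosts act
  injectively up to units, this is the set of sources of those basis paths which no ghost can
  shorten (\<open>ghost_killed_vertex_iff\<close>). It is $\{w\}$ for a sink $w$ and $\{v\}$ for an infinite
  emitter $v$, because the only such path is the trivial one at the end vertex, and it is empty
  for infinite paths. Sinks, breaking emitters and terminal emitters are pairwise disjoint, so
  this settles every pair of modules except two that both live on infinite paths.

  For those, let $p = e_1e_2\cdots$. The operator $e_1\cdots e_n e_n^*\cdots e_1^*$ projects onto
  the paths that share their first $n$ edges with $p$, because the weights cancel. A vector fixed
  for all $n$ is therefore a multiple of $p$ (\<open>path_proj_fixed_iff\<close>), and an isomorphism maps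
  multiples of $p$ onto multiples of $p$. Hence the two tail classes agree (\<open>same_class\<close>), and the
  class of $c^\infty$ determines the cycle $c$ up to rotation. On $q = c^\infty$ the cycle $c$ acts
  as the product of its weights, that is, as $1$ on $V_{[q]}$ and as $\overline x$ on $V^f_{[q]}$.
  A polynomial in $c$ annihilates $q$ in one module precisely if it does so in the other
  (\<open>same_annihilator\<close>). The annihilating polynomials are those vanishing at $1$ in the first case
  and those in the ideal $(f)$ in the second. Comparing degrees of polynomials with constant term
  $1$ shows that $1 - x \in (f)$ forces $f = 1 - x$, and that $(f) = (f')$ forces $f = f'$
  (\<open>multiple_eq\<close>).
\<close>

section \<open>Bilinear extensions and monoid algebras\<close>

context cring
begin

lemma fin_suppI:
  "\<lbrakk>\<And>b. f b \<in> carrier R; \<And>b. b \<notin> B \<Longrightarrow> f b = \<zero>; finite {b. f b \<noteq> \<zero>}\<rbrakk> \<Longrightarrow> f \<in> fin_supp R B"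
  by (simp add: fin_supp_def)

lemma fin_suppD:
  assumes "f \<in> fin_supp R B"
  shows "f b \<in> carrier R" "finite {b. f b \<noteq> \<zero>}" "f b \<noteq> \<zero> \<Longrightarrow> b \<in> B"
  using assms by (auto simp: fin_supp_def)

lemma zero_in_fin_supp: "(\<lambda>_. \<zero>) \<in> fin_supp R B"
  by (simp add: fin_supp_def)

lemma add_in_fin_supp:
  assumes "f \<in> fin_supp R B" "g \<in> fin_supp R B"
  shows "(\<lambda>x. f x \<oplus> g x) \<in> fin_supp R B"
proof (rule fin_suppI)
  have "{b. f b \<oplus> g b \<noteq> \<zero>} \<subseteq> {b. f b \<noteq> \<zero>} \<union> {b. g b \<noteq> \<zero>}"
    by auto
  then show "finite {b. f b \<oplus> g b \<noteq> \<zero>}"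
    using assms by (auto simp: fin_supp_def intro: finite_subset)
qed (use assms in \<open>auto simp: fin_supp_def\<close>)

lemma uminus_in_fin_supp:
  assumes "f \<in> fin_supp R B"
  shows "(\<lambda>x. \<ominus> f x) \<in> fin_supp R B"
proof (rule fin_suppI)
  have "{b. \<ominus> f b \<noteq> \<zero>} \<subseteq> {b. f b \<noteq> \<zero>}"
    by auto
  then show "finite {b. \<ominus> f b \<noteq> \<zero>}"
    using assms by (auto simp: fin_supp_def intro: finite_subset)
qed (use assms in \<open>auto simp: fin_supp_def\<close>)

lemma single_in_fin_supp: "\<lbrakk>k \<in> carrier R; b \<in> B\<rbrakk> \<Longrightarrow> single R k b \<in> fin_supp R B"
  by (rule fin_suppI) (auto simp: single_def intro: finite_subset[of _ "{b}"])

lemma fin_supp_mono: "A \<subseteq> B \<Longrightarrow> f \<in> fin_supp R A \<Longrightarrow> f \<in> fin_supp R B"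
  by (auto simp: fin_supp_def)

lemma single_zero: "single R \<zero> b = (\<lambda>_. \<zero>)"
  by (auto simp: single_def)

lemma single_add:
  "\<lbrakk>k \<in> carrier R; l \<in> carrier R\<rbrakk> \<Longrightarrow> single R (k \<oplus> l) b = (\<lambda>x. single R k b x \<oplus> single R l b x)"
  by (auto simp: single_def)

text \<open>
  Every finitely supported function is a sum of point masses, so additive identities need
  only be checked on point masses.
\<close>

lemma fin_supp_induct [consumes 1, case_names zero add]:
  assumes f: "f \<in> fin_supp R B"
    and zero: "P (\<lambda>_. \<zero>)"
    and add: "\<And>k b f. \<lbrakk>k \<in> carrier R; b \<in> B; f \<in> fin_supp R B; P f\<rbrakk>
      \<Longrightarrow> P (\<lambda>x. single R k b x \<oplus> f x)"
  shows "P f"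
proof -
  have "\<forall>f \<in> fin_supp R B. {b. f b \<noteq> \<zero>} \<subseteq> A \<longrightarrow> P f" if "finite A" for A
    using that
  proof induction
    case empty
    have "f = (\<lambda>_. \<zero>)" if "{b. f b \<noteq> \<zero>} \<subseteq> {}" for f :: "'c \<Rightarrow> 'a"
      using that by auto
    then show ?case using zero by metis
  next
    case (insert a A)
    show ?case
    proof (intro ballI impI)
      fix f assume f: "f \<in> fin_supp R B" and sub: "{b. f b \<noteq> \<zero>} \<subseteq> insert a A"
      show "P f"
      proof (cases "f a = \<zero>")
        case True
        then have "{b. f b \<noteq> \<zero>} \<subseteq> A" using sub by auto
        then show ?thesis using insert f by blast
      next
        case False
        define g where "g = (\<lambda>x. if x = a then \<zero> else f x)"
        have fin: "finite {b. g b \<noteq> \<zero>}"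
          by (rule finite_subset[OF _ insert(1)]) (use sub in \<open>auto simp: g_def split: if_splits\<close>)
        have g: "g \<in> fin_supp R B"
          using f fin by (auto simp: g_def fin_supp_def)
        have "{b. g b \<noteq> \<zero>} \<subseteq> A"
          using sub by (auto simp: g_def split: if_splits)
        then have "P g" using insert g by blast
        moreover have "f = (\<lambda>x. single R (f a) a x \<oplus> g x)"
          using f by (auto simp: g_def single_def fin_supp_def)
        moreover have "a \<in> B" using f False by (auto simp: fin_supp_def)
        ultimately show ?thesis
          using add[of "f a" a g] g f by (simp add: fin_supp_def)
      qed
    qed
  qed
  from this[of "{b. f b \<noteq> \<zero>}"] show ?thesis
    using f by (simp add: fin_supp_def)
qed

lemma bilinear_ext_eq_finsum:
  assumes f: "f \<in> fin_supp R S" and g: "g \<in> fin_supp R T"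
    and A: "finite A" "{x. f x \<noteq> \<zero>} \<subseteq> A" and C: "finite C" "{y. g y \<noteq> \<zero>} \<subseteq> C"
  shows "bilinear_ext R opr f g z =
    (\<Oplus>p\<in>A \<times> C. if opr (fst p) (snd p) = Some z then f (fst p) \<otimes> g (snd p) else \<zero>)"
proof -
  have c: "f x \<in> carrier R" "g y \<in> carrier R" for x y
    using f g by (auto simp: fin_supp_def)
  show ?thesis
    unfolding bilinear_ext_def
    by (rule add.finprod_mono_neutral_cong_left)
      (use assms c in \<open>auto split: if_splits\<close>)
qed

lemma bilinear_ext_add_left:
  assumes f: "f \<in> fin_supp R S" "f' \<in> fin_supp R S" and g: "g \<in> fin_supp R T"
  shows "bilinear_ext R opr (\<lambda>x. f x \<oplus> f' x) g =
    (\<lambda>z. bilinear_ext R opr f g z \<oplus> bilinear_ext R opr f' g z)"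
proof
  fix z
  have c: "f x \<in> carrier R" "f' x \<in> carrier R" "g y \<in> carrier R" for x y
    using f g by (auto simp: fin_supp_def)
  let ?A = "{x. f x \<noteq> \<zero>} \<union> {x. f' x \<noteq> \<zero>}" and ?C = "{y. g y \<noteq> \<zero>}"
  have fin: "finite ?A" "finite ?C"
    using f g by (auto simp: fin_supp_def)
  have sub: "{x. f x \<oplus> f' x \<noteq> \<zero>} \<subseteq> ?A"
    by auto
  note e = bilinear_ext_eq_finsum[OF _ g fin(1) _ fin(2)]
  have "bilinear_ext R opr (\<lambda>x. f x \<oplus> f' x) g z =
    (\<Oplus>p\<in>?A \<times> ?C. (if opr (fst p) (snd p) = Some z then f (fst p) \<otimes> g (snd p) else \<zero>) \<oplus>
      (if opr (fst p) (snd p) = Some z then f' (fst p) \<otimes> g (snd p) else \<zero>))"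
    unfolding e[OF add_in_fin_supp[OF f] sub order_refl]
    by (rule finsum_cong') (auto simp: c l_distr)
  also have "\<dots> = bilinear_ext R opr f g z \<oplus> bilinear_ext R opr f' g z"
    by (subst finsum_addf) (auto simp: c e[OF f(1)] e[OF f(2)])
  finally show "bilinear_ext R opr (\<lambda>x. f x \<oplus> f' x) g z =
    bilinear_ext R opr f g z \<oplus> bilinear_ext R opr f' g z" .
qed

lemma bilinear_ext_add_right:
  assumes f: "f \<in> fin_supp R S" and g: "g \<in> fin_supp R T" "g' \<in> fin_supp R T"
  shows "bilinear_ext R opr f (\<lambda>x. g x \<oplus> g' x) =
    (\<lambda>z. bilinear_ext R opr f g z \<oplus> bilinear_ext R opr f g' z)"
proof
  fix z
  have c: "f x \<in> carrier R" "g y \<in> carrier R" "g' y \<in> carrier R" for x y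
    using f g by (auto simp: fin_supp_def)
  let ?A = "{x. f x \<noteq> \<zero>}" and ?C = "{y. g y \<noteq> \<zero>} \<union> {y. g' y \<noteq> \<zero>}"
  have fin: "finite ?A" "finite ?C"
    using f g by (auto simp: fin_supp_def)
  have sub: "{y. g y \<oplus> g' y \<noteq> \<zero>} \<subseteq> ?C"
    by auto
  note e = bilinear_ext_eq_finsum[OF f _ fin(1) order_refl fin(2)]
  have "bilinear_ext R opr f (\<lambda>x. g x \<oplus> g' x) z =
    (\<Oplus>p\<in>?A \<times> ?C. (if opr (fst p) (snd p) = Some z then f (fst p) \<otimes> g (snd p) else \<zero>) \<oplus>
      (if opr (fst p) (snd p) = Some z then f (fst p) \<otimes> g' (snd p) else \<zero>))"
    unfolding e[OF add_in_fin_supp[OF g] sub]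
    by (rule finsum_cong') (auto simp: c r_distr)
  also have "\<dots> = bilinear_ext R opr f g z \<oplus> bilinear_ext R opr f g' z"
    by (subst finsum_addf) (auto simp: c e[OF g(1)] e[OF g(2)])
  finally show "bilinear_ext R opr f (\<lambda>x. g x \<oplus> g' x) z =
    bilinear_ext R opr f g z \<oplus> bilinear_ext R opr f g' z" .
qed

lemma bilinear_ext_zero [simp]:
  "bilinear_ext R opr (\<lambda>_. \<zero>) g = (\<lambda>_. \<zero>)" "bilinear_ext R opr f (\<lambda>_. \<zero>) = (\<lambda>_. \<zero>)"
  by (auto simp: bilinear_ext_def)

lemma bilinear_ext_single:
  assumes "k \<in> carrier R" "l \<in> carrier R"
  shows "bilinear_ext R opr (single R k a) (single R l b) =
    (case opr a b of None \<Rightarrow> \<lambda>_. \<zero> | Some c \<Rightarrow> single R (k \<otimes> l) c)"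
proof
  fix z
  have s: "single R k a \<in> fin_supp R UNIV" "single R l b \<in> fin_supp R UNIV"
    using assms by (auto intro: single_in_fin_supp)
  have "bilinear_ext R opr (single R k a) (single R l b) z =
    (\<Oplus>p\<in>{a} \<times> {b}. if opr (fst p) (snd p) = Some z
      then single R k a (fst p) \<otimes> single R l b (snd p) else \<zero>)"
    by (rule bilinear_ext_eq_finsum[OF s]) (auto simp: single_def split: if_splits)
  also have "\<dots> = (if opr a b = Some z then k \<otimes> l else \<zero>)"
    using assms by (auto simp: single_def)
  also have "\<dots> = (case opr a b of None \<Rightarrow> \<lambda>_. \<zero> | Some c \<Rightarrow> single R (k \<otimes> l) c) z"
    by (auto simp: single_def split: option.splits)
  finally show "bilinear_ext R opr (single R k a) (single R l b) z = \<dots>" .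
qed

lemma bilinear_ext_in_fin_supp:
  assumes f: "f \<in> fin_supp R S" and g: "g \<in> fin_supp R T"
    and opr: "\<And>x y z. \<lbrakk>x \<in> S; y \<in> T; opr x y = Some z\<rbrakk> \<Longrightarrow> z \<in> U"
  shows "bilinear_ext R opr f g \<in> fin_supp R U"
  using f
proof (induction f rule: fin_supp_induct)
  case (add k b f)
  have s: "single R k b \<in> fin_supp R S" using add by (simp add: single_in_fin_supp)
  from g have "bilinear_ext R opr (single R k b) g \<in> fin_supp R U"
  proof (induction g rule: fin_supp_induct)
    case (add l c g)
    then show ?case
      using s \<open>k \<in> carrier R\<close> \<open>b \<in> S\<close> opr
      by (auto simp: bilinear_ext_add_right[OF s single_in_fin_supp] bilinear_ext_single
          intro!: add_in_fin_supp zero_in_fin_supp single_in_fin_supp split: option.splits)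
  qed (simp add: zero_in_fin_supp)
  then show ?case
    using add s by (simp add: bilinear_ext_add_left[OF s _ g] add_in_fin_supp)
qed (simp add: zero_in_fin_supp)

text \<open>
  One lemma serves three purposes: associativity of a monoid algebra, compatibility of the action
  of words on a module with their product, and the absorption properties of annihilators. It
  suffices to compare both sides on point masses.
\<close>

lemma bilinear_ext_assoc:
  assumes f: "f \<in> fin_supp R S" and g: "g \<in> fin_supp R T" and h: "h \<in> fin_supp R U"
    and opr: "\<And>x y z. \<lbrakk>x \<in> S; y \<in> T; z \<in> U\<rbrakk>
      \<Longrightarrow> Option.bind (op1 x y) (\<lambda>u. op2 u z) = Option.bind (op3 y z) (op4 x)"
  shows "bilinear_ext R op2 (bilinear_ext R op1 f g) h = bilinear_ext R op4 f (bilinear_ext R op3 g h)"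
  using f
proof (induction f rule: fin_supp_induct)
  case (add k a f)
  have s: "single R k a \<in> fin_supp R S" using add by (simp add: single_in_fin_supp)
  note cl = bilinear_ext_in_fin_supp[where U = UNIV, OF _ _ UNIV_I]
  from g have "bilinear_ext R op2 (bilinear_ext R op1 (single R k a) g) h =
    bilinear_ext R op4 (single R k a) (bilinear_ext R op3 g h)"
  proof (induction g rule: fin_supp_induct)
    case (add l b g)
    have t: "single R l b \<in> fin_supp R T" using add by (simp add: single_in_fin_supp)
    from h have "bilinear_ext R op2 (bilinear_ext R op1 (single R k a) (single R l b)) h =
      bilinear_ext R op4 (single R k a) (bilinear_ext R op3 (single R l b) h)"
    proof (induction h rule: fin_supp_induct)
      case (add m c h)
      have u: "single R m c \<in> fin_supp R U" using add by (simp add: single_in_fin_supp)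
      have "bilinear_ext R op2 (bilinear_ext R op1 (single R k a) (single R l b)) (single R m c) =
        bilinear_ext R op4 (single R k a) (bilinear_ext R op3 (single R l b) (single R m c))"
        using opr[of a b c] \<open>k \<in> carrier R\<close> \<open>l \<in> carrier R\<close> add \<open>a \<in> S\<close> \<open>b \<in> T\<close>
        by (cases "op1 a b"; cases "op3 b c") (auto simp: bilinear_ext_single m_assoc
            split: option.splits)
      then show ?case
        using add s t u
        by (simp add: bilinear_ext_add_right[OF cl[OF s t] u] bilinear_ext_add_right[OF t u]
            bilinear_ext_add_right[OF s cl[OF t u] cl[OF t]])
    qed simp
    then show ?case
      using add s t
      by (simp add: bilinear_ext_add_left[OF cl cl h, OF s t s] bilinear_ext_add_left[OF t _ h]
          bilinear_ext_add_right[OF s t] bilinear_ext_add_right[OF s cl cl, OF t h _ h])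
  qed simp
  then show ?case
    using add s g h
    by (simp add: bilinear_ext_add_left[OF cl cl h, OF s g _ g] bilinear_ext_add_left[OF s _ g]
        bilinear_ext_add_left[OF s _ cl[OF g h]])
qed simp

lemma bilinear_ext_comm:
  assumes f: "f \<in> fin_supp R S" and g: "g \<in> fin_supp R T"
    and opr: "\<And>x y. \<lbrakk>x \<in> S; y \<in> T\<rbrakk> \<Longrightarrow> op1 x y = op2 y x"
  shows "bilinear_ext R op1 f g = bilinear_ext R op2 g f"
  using f
proof (induction f rule: fin_supp_induct)
  case (add k a f)
  have s: "single R k a \<in> fin_supp R S" using add by (simp add: single_in_fin_supp)
  from g have "bilinear_ext R op1 (single R k a) g = bilinear_ext R op2 g (single R k a)"
  proof (induction g rule: fin_supp_induct)
    case (add l b g)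
    have t: "single R l b \<in> fin_supp R T" using add by (simp add: single_in_fin_supp)
    have kl: "k \<otimes> l = l \<otimes> k" using add \<open>k \<in> carrier R\<close> by (simp add: m_comm)
    show ?case
      using add s t \<open>k \<in> carrier R\<close> \<open>a \<in> S\<close> opr[of a b]
      by (simp add: bilinear_ext_add_left[OF t _ s] bilinear_ext_add_right[OF s t]
          bilinear_ext_single kl split: option.split)
  qed simp
  then show ?case
    using add s by (simp add: bilinear_ext_add_left[OF s _ g] bilinear_ext_add_right[OF g s])
qed simp

lemma monoid_algebra_simps [simp]:
  "carrier (monoid_algebra R G) = fin_supp R (carrier G)"
  "x \<otimes>\<^bsub>monoid_algebra R G\<^esub> y = bilinear_ext R (\<lambda>x y. Some (x \<otimes>\<^bsub>G\<^esub> y)) x y"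
  "\<one>\<^bsub>monoid_algebra R G\<^esub> = single R \<one> \<one>\<^bsub>G\<^esub>"
  "\<zero>\<^bsub>monoid_algebra R G\<^esub> = (\<lambda>_. \<zero>)"
  "x \<oplus>\<^bsub>monoid_algebra R G\<^esub> y = (\<lambda>b. x b \<oplus> y b)"
  by (simp_all add: monoid_algebra_def)

lemma single_mult_eq_self:
  assumes "f \<in> fin_supp R S" "\<And>x. x \<in> S \<Longrightarrow> opr a x = Some x"
  shows "bilinear_ext R opr (single R \<one> a) f = f"
  using assms(1)
proof (induction f rule: fin_supp_induct)
  case (add k b f)
  then show ?case
    using assms(2) single_in_fin_supp[of k b S]
    by (simp add: bilinear_ext_add_right[OF single_in_fin_supp[of _ a UNIV] single_in_fin_supp[of k b S]]
        bilinear_ext_single)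
qed simp

lemma mult_single_eq_self:
  assumes "f \<in> fin_supp R S" "\<And>x. x \<in> S \<Longrightarrow> opr x a = Some x"
  shows "bilinear_ext R opr f (single R \<one> a) = f"
  using assms(1)
proof (induction f rule: fin_supp_induct)
  case (add k b f)
  then show ?case
    using assms(2) single_in_fin_supp[of k b S]
    by (simp add: bilinear_ext_add_left[OF single_in_fin_supp[of k b S] _ single_in_fin_supp[of _ a UNIV]]
        bilinear_ext_single)
qed simp

lemma ring_monoid_algebra:
  assumes "Group.monoid G"
  shows "ring (monoid_algebra R G)"
proof -
  interpret G: Group.monoid G by fact
  show ?thesis
  proof (rule ringI)
    show "abelian_group (monoid_algebra R G)"
    proof (rule abelian_groupI)
      fix x assume x: "x \<in> carrier (monoid_algebra R G)"
      then show "\<exists>y\<in>carrier (monoid_algebra R G).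
          y \<oplus>\<^bsub>monoid_algebra R G\<^esub> x = \<zero>\<^bsub>monoid_algebra R G\<^esub>"
        by (intro bexI[of _ "\<lambda>b. \<ominus> x b"]) (auto simp: uminus_in_fin_supp fin_suppD l_neg)
    qed (auto simp: add_in_fin_supp zero_in_fin_supp fin_suppD a_ac)
    show "Group.monoid (monoid_algebra R G)"
      by (rule monoidI)
        (auto simp: single_in_fin_supp single_mult_eq_self mult_single_eq_self G.m_assoc
          intro!: bilinear_ext_in_fin_supp bilinear_ext_assoc)
  qed (auto intro!: bilinear_ext_add_left bilinear_ext_add_right)
qed

lemma cring_monoid_algebra:
  assumes "comm_monoid G"
  shows "cring (monoid_algebra R G)"
proof -
  interpret G: comm_monoid G by fact
  interpret A: ring "monoid_algebra R G" by (rule ring_monoid_algebra) unfold_locales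
  show ?thesis
    by (intro cring.intro comm_monoid.intro comm_monoid_axioms.intro A.ring_axioms A.monoid_axioms)
      (auto simp: G.m_comm intro!: bilinear_ext_comm)
qed

end

section \<open>Leavitt path algebras by generators and relations\<close>

lemma free_monoid_simps [simp]:
  "carrier (free_monoid S) = lists S" "x \<otimes>\<^bsub>free_monoid S\<^esub> y = x @ y" "\<one>\<^bsub>free_monoid S\<^esub> = []"
  by (simp_all add: free_monoid_def)

lemma monoid_free_monoid: "Group.monoid (free_monoid S)"
  by (rule monoidI) auto

text \<open>
  The class of $kg$ for a scalar $k$ and a generator $g$. These elements suffice for the whole
  argument; keeping the scalar lets additive maps that commute with them be treated as linear.
\<close>

definition scaled_gen :: "('k, 'r) ring_scheme \<Rightarrow> ('v, 'e) pre_digraph \<Rightarrow> 'k \<Rightarrow>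
    ('v, 'e) lpa_gen \<Rightarrow> (('v, 'e) lpa_gen list \<Rightarrow> 'k) set" where
  "scaled_gen K E k g = lpa_ideal K E +>\<^bsub>free_lpa K E\<^esub> single K k [g]"

definition scalar_coset :: "('k, 'r) ring_scheme \<Rightarrow> ('v, 'e) pre_digraph \<Rightarrow> 'k \<Rightarrow>
    (('v, 'e) lpa_gen list \<Rightarrow> 'k) set" where
  "scalar_coset K E k = lpa_ideal K E +>\<^bsub>free_lpa K E\<^esub> single K k []"

locale leavitt_family = ring A + wf_digraph E
  for A (structure) and E :: "('v, 'e) pre_digraph" +
  fixes h :: "('v, 'e) lpa_gen \<Rightarrow> 'a"
  assumes closed [simp]: "g \<in> lpa_gens E \<Longrightarrow> h g \<in> carrier A"
    and vtx_idem: "v \<in> verts E \<Longrightarrow> h (Vtx v) \<otimes> h (Vtx v) = h (Vtx v)"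
    and vtx_orth: "\<lbrakk>u \<in> verts E; v \<in> verts E; u \<noteq> v\<rbrakk> \<Longrightarrow> h (Vtx u) \<otimes> h (Vtx v) = \<zero>"
    and tail_edge: "e \<in> arcs E \<Longrightarrow> h (Vtx (tail E e)) \<otimes> h (Edge e) = h (Edge e)"
    and edge_head: "e \<in> arcs E \<Longrightarrow> h (Edge e) \<otimes> h (Vtx (head E e)) = h (Edge e)"
    and head_ghost: "e \<in> arcs E \<Longrightarrow> h (Vtx (head E e)) \<otimes> h (Ghost e) = h (Ghost e)"
    and ghost_tail: "e \<in> arcs E \<Longrightarrow> h (Ghost e) \<otimes> h (Vtx (tail E e)) = h (Ghost e)"
    and ghost_edge: "e \<in> arcs E \<Longrightarrow> h (Ghost e) \<otimes> h (Edge e) = h (Vtx (head E e))"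
    and ghost_edge_orth: "\<lbrakk>e \<in> arcs E; f \<in> arcs E; e \<noteq> f\<rbrakk> \<Longrightarrow> h (Ghost e) \<otimes> h (Edge f) = \<zero>"
    and vtx_sum: "v \<in> regular_verts E \<Longrightarrow>
      h (Vtx v) = (\<Oplus>e\<in>out_arcs E v. h (Edge e) \<otimes> h (Ghost e))"

locale leavitt = cring K + wf_digraph E
  for K :: "('k, 'r) ring_scheme" (structure) and E :: "('v, 'e) pre_digraph"
begin

abbreviation "F \<equiv> free_lpa K E"
abbreviation "I \<equiv> lpa_ideal K E"
abbreviation "Q \<equiv> F Quot I"
abbreviation "proj x \<equiv> I +>\<^bsub>F\<^esub> x"
abbreviation "words \<equiv> lists (lpa_gens E)"

text \<open>The augmentation ideal, of which $L_K(E)$ is the image.\<close>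
abbreviation "Aug \<equiv> fin_supp K (words - {[]})"

lemma free_lpa_simps [simp]:
  "carrier F = fin_supp K words"
  "x \<otimes>\<^bsub>F\<^esub> y = bilinear_ext K (\<lambda>x y. Some (x @ y)) x y"
  "\<one>\<^bsub>F\<^esub> = single K \<one> []"
  "\<zero>\<^bsub>F\<^esub> = (\<lambda>_. \<zero>)"
  "x \<oplus>\<^bsub>F\<^esub> y = (\<lambda>b. x b \<oplus> y b)"
  by (simp_all add: free_lpa_def)

sublocale free: ring F
  unfolding free_lpa_def by (rule ring_monoid_algebra) (rule monoid_free_monoid)

lemma gen_simps [simp]:
  "Vtx v \<in> lpa_gens E \<longleftrightarrow> v \<in> verts E" "Edge e \<in> lpa_gens E \<longleftrightarrow> e \<in> arcs E"
  "Ghost e \<in> lpa_gens E \<longleftrightarrow> e \<in> arcs E"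
  by (auto simp: lpa_gens_def)

lemma single_mult_single:
  "\<lbrakk>k \<in> carrier K; l \<in> carrier K\<rbrakk> \<Longrightarrow>
    single K k u \<otimes>\<^bsub>F\<^esub> single K l w = single K (k \<otimes> l) (u @ w)"
  by (simp add: bilinear_ext_single)

lemma single_add_F:
  "\<lbrakk>k \<in> carrier K; l \<in> carrier K\<rbrakk> \<Longrightarrow> single K (k \<oplus> l) w = single K k w \<oplus>\<^bsub>F\<^esub> single K l w"
  by (simp add: single_add)

lemma Aug_subset: "Aug \<subseteq> carrier F"
  by (auto intro: fin_supp_mono[rotated])

lemma Aug_iff: "x \<in> Aug \<longleftrightarrow> x \<in> carrier F \<and> x [] = \<zero>"
  by (auto simp: fin_supp_def)

lemma uminus_F: "x \<in> carrier F \<Longrightarrow> \<ominus>\<^bsub>F\<^esub> x = (\<lambda>b. \<ominus> x b)"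
  by (rule free.minus_equality) (auto simp: uminus_in_fin_supp fin_suppD l_neg)

lemma Aug_ideal: "ideal Aug F"
proof (rule idealI)
  show "subgroup Aug (add_monoid F)"
  proof (rule group.subgroupI[OF free.a_group])
    fix a assume a: "a \<in> Aug"
    then have "\<ominus>\<^bsub>F\<^esub> a = (\<lambda>b. \<ominus> a b)" using Aug_subset by (intro uminus_F) blast
    then show "inv\<^bsub>add_monoid F\<^esub> a \<in> Aug"
      using uminus_in_fin_supp[OF a] by (simp add: a_inv_def)
  qed (use Aug_subset zero_in_fin_supp in \<open>auto simp: add_in_fin_supp\<close>)
qed (auto simp: free.ring_axioms intro!: bilinear_ext_in_fin_supp)

lemma lpa_rels_subset: "lpa_rels K E \<subseteq> Aug"
proof -
  interpret J: ideal Aug F by (rule Aug_ideal)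
  have s: "single K \<one> w \<in> Aug" if "w \<in> words" "w \<noteq> []" for w
    using that by (intro single_in_fin_supp) auto
  have m: "x \<ominus>\<^bsub>F\<^esub> y \<in> Aug" if "x \<in> Aug" "y \<in> Aug" for x y
    using that by (simp only: a_minus_def J.a_closed J.a_inv_closed)
  have sum: "(\<Oplus>\<^bsub>F\<^esub>e \<in> S. f e) \<in> Aug" if "finite S" "\<And>e. e \<in> S \<Longrightarrow> f e \<in> Aug" for S and f :: "'e \<Rightarrow> _"
    using that
  proof (induction S)
    case (insert e S)
    then show ?case
      using Aug_subset by (subst free.finsum_insert) (auto simp del: free_lpa_simps(1,5) intro!: J.a_closed)
  qed (use J.zero_closed in \<open>simp del: free_lpa_simps\<close>)
  have "w \<in> Aug" if "w \<in> lpa_rels K E" for w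
    using that unfolding lpa_rels_def Let_def
    by (auto intro!: m s sum simp: regular_verts_def simp del: free_lpa_simps)
  then show ?thesis by blast
qed

sublocale I: ideal I F
  unfolding lpa_ideal_def by (rule free.genideal_ideal) (use lpa_rels_subset Aug_subset in blast)

lemma I_subset_Aug: "I \<subseteq> Aug"
  unfolding lpa_ideal_def by (rule free.genideal_minimal[OF Aug_ideal lpa_rels_subset])

lemma lpa_rels_in_I: "x \<in> lpa_rels K E \<Longrightarrow> x \<in> I"
  unfolding lpa_ideal_def using free.genideal_self lpa_rels_subset Aug_subset by blast

sublocale quot: ring Q
  by (rule I.quotient_is_ring)

sublocale proj: ring_hom_ring F Q "\<lambda>x. proj x"
  using I.rcos_ring_hom_ring by simp

lemma lpa_simps [simp]:
  "carrier (lpa K E) = (\<lambda>x. proj x) ` Aug"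
  "x \<otimes>\<^bsub>lpa K E\<^esub> y = x \<otimes>\<^bsub>Q\<^esub> y" "\<one>\<^bsub>lpa K E\<^esub> = \<one>\<^bsub>Q\<^esub>" "\<zero>\<^bsub>lpa K E\<^esub> = \<zero>\<^bsub>Q\<^esub>"
  "x \<oplus>\<^bsub>lpa K E\<^esub> y = x \<oplus>\<^bsub>Q\<^esub> y" "k \<odot>\<^bsub>lpa K E\<^esub> x = scalar_coset K E k \<otimes>\<^bsub>Q\<^esub> x"
  using Aug_iff by (auto simp: lpa_def Let_def scalar_coset_def)

lemma lpa_elt_eq: "lpa_elt K E g = scaled_gen K E \<one> g"
  by (simp add: lpa_elt_def scaled_gen_def)

lemma scaled_gen_in_lpa: "\<lbrakk>k \<in> carrier K; g \<in> lpa_gens E\<rbrakk> \<Longrightarrow> scaled_gen K E k g \<in> carrier (lpa K E)"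
  unfolding scaled_gen_def by (auto intro!: imageI single_in_fin_supp)

lemma lpa_subset: "carrier (lpa K E) \<subseteq> carrier Q"
  using Aug_subset proj.hom_closed by (auto simp del: free_lpa_simps)

lemma scaled_gen_closed [simp]:
  "\<lbrakk>k \<in> carrier K; g \<in> lpa_gens E\<rbrakk> \<Longrightarrow> scaled_gen K E k g \<in> carrier Q"
  using scaled_gen_in_lpa lpa_subset by blast

lemma single_closed: "\<lbrakk>k \<in> carrier K; w \<in> words\<rbrakk> \<Longrightarrow> single K k w \<in> carrier F"
  by (simp add: single_in_fin_supp)

lemma scalar_coset_closed [simp]: "k \<in> carrier K \<Longrightarrow> scalar_coset K E k \<in> carrier Q"
  unfolding scalar_coset_def by (intro proj.hom_closed single_closed) auto

lemma proj_single_mult: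
  assumes "k \<in> carrier K" "l \<in> carrier K" "u \<in> words" "w \<in> words"
  shows "proj (single K k u) \<otimes>\<^bsub>Q\<^esub> proj (single K l w) = proj (single K (k \<otimes> l) (u @ w))"
  using assms proj.hom_mult[OF single_closed single_closed] by (simp only: single_mult_single)

lemma scalar_mult_scaled_gen:
  "\<lbrakk>k \<in> carrier K; l \<in> carrier K; g \<in> lpa_gens E\<rbrakk> \<Longrightarrow>
    scalar_coset K E k \<otimes>\<^bsub>Q\<^esub> scaled_gen K E l g = scaled_gen K E (k \<otimes> l) g"
  unfolding scalar_coset_def scaled_gen_def by (subst proj_single_mult) auto

lemma scaled_gen_mult_scalar:
  "\<lbrakk>k \<in> carrier K; l \<in> carrier K; g \<in> lpa_gens E\<rbrakk> \<Longrightarrow>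
    scaled_gen K E l g \<otimes>\<^bsub>Q\<^esub> scalar_coset K E k = scaled_gen K E (k \<otimes> l) g"
  unfolding scalar_coset_def scaled_gen_def by (subst proj_single_mult) (auto simp: m_comm)

lemma scalar_coset_hom: "scalar_coset K E \<in> ring_hom K Q"
proof (rule ring_hom_memI)
  fix x y assume "x \<in> carrier K" "y \<in> carrier K"
  then show "scalar_coset K E (x \<otimes> y) = scalar_coset K E x \<otimes>\<^bsub>Q\<^esub> scalar_coset K E y"
    "scalar_coset K E (x \<oplus> y) = scalar_coset K E x \<oplus>\<^bsub>Q\<^esub> scalar_coset K E y"
    unfolding scalar_coset_def by (simp_all only: proj_single_mult lists.Nil append_Nil single_add_F
        proj.hom_add single_closed)
next
  show "scalar_coset K E \<one> = \<one>\<^bsub>Q\<^esub>"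
    using proj.hom_one by (simp add: scalar_coset_def)
qed simp

lemma proj_eqI:
  assumes "x \<ominus>\<^bsub>F\<^esub> y \<in> lpa_rels K E" "x \<in> carrier F" "y \<in> carrier F"
  shows "proj x = proj y"
  using assms lpa_rels_in_I free.quotient_eq_iff_same_a_r_cos[OF I.is_ideal] by blast

lemma proj_zeroI: "x \<in> lpa_rels K E \<Longrightarrow> proj x = \<zero>\<^bsub>Q\<^esub>"
  using lpa_rels_in_I by (simp add: FactRing_def I.a_rcos_const)

text \<open>
  The scalars on $e$ and $e^*$ cancel in every relation in which both occur. Trivial scalars give
  the generators themselves, and a single non-trivial pair gives the twist by a unit.
\<close>

lemma leavitt_family_rescaled:
  assumes s: "\<And>g. g \<in> lpa_gens E \<Longrightarrow> s g \<in> carrier K" "\<And>v. v \<in> verts E \<Longrightarrow> s (Vtx v) = \<one>"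
    and unit: "\<And>e. e \<in> arcs E \<Longrightarrow> s (Edge e) \<otimes> s (Ghost e) = \<one>"
  shows "leavitt_family Q E (\<lambda>g. scaled_gen K E (s g) g)"
proof -
  have unit': "s (Ghost e) \<otimes> s (Edge e) = \<one>" if "e \<in> arcs E" for e
    using unit[OF that] s that by (simp add: m_comm)
  have split: "scaled_gen K E k g = scalar_coset K E k \<otimes>\<^bsub>Q\<^esub> scaled_gen K E \<one> g"
    if "k \<in> carrier K" "g \<in> lpa_gens E" for k g
    using that by (simp add: scalar_mult_scaled_gen)
  have prod: "scaled_gen K E k g \<otimes>\<^bsub>Q\<^esub> scaled_gen K E l g' =
      scalar_coset K E (k \<otimes> l) \<otimes>\<^bsub>Q\<^esub> proj (single K \<one> [g, g'])"
    if "k \<in> carrier K" "l \<in> carrier K" "g \<in> lpa_gens E" "g' \<in> lpa_gens E" for k l g g'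
    using that by (simp add: scaled_gen_def scalar_coset_def proj_single_mult)
  have c1: "scalar_coset K E \<one> \<otimes>\<^bsub>Q\<^esub> x = x" if "x \<in> carrier Q" for x
    using that ring_hom_one[OF scalar_coset_hom] by simp
  have pc: "proj (single K \<one> w) \<in> carrier Q" if "w \<in> words" for w
    using that by (intro proj.hom_closed single_closed) auto
  note rel = proj_eqI[OF _ single_closed single_closed] proj_zeroI
  have r: "v \<in> verts E \<Longrightarrow> proj (single K \<one> [Vtx v, Vtx v]) = scaled_gen K E \<one> (Vtx v)"
    "\<lbrakk>u \<in> verts E; v \<in> verts E; u \<noteq> v\<rbrakk> \<Longrightarrow> proj (single K \<one> [Vtx u, Vtx v]) = \<zero>\<^bsub>Q\<^esub>"
    "e \<in> arcs E \<Longrightarrow> proj (single K \<one> [Vtx (tail E e), Edge e]) = scaled_gen K E \<one> (Edge e)"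
    "e \<in> arcs E \<Longrightarrow> proj (single K \<one> [Edge e, Vtx (head E e)]) = scaled_gen K E \<one> (Edge e)"
    "e \<in> arcs E \<Longrightarrow> proj (single K \<one> [Vtx (head E e), Ghost e]) = scaled_gen K E \<one> (Ghost e)"
    "e \<in> arcs E \<Longrightarrow> proj (single K \<one> [Ghost e, Vtx (tail E e)]) = scaled_gen K E \<one> (Ghost e)"
    "e \<in> arcs E \<Longrightarrow> proj (single K \<one> [Ghost e, Edge e]) = scaled_gen K E \<one> (Vtx (head E e))"
    "\<lbrakk>e \<in> arcs E; f \<in> arcs E; e \<noteq> f\<rbrakk> \<Longrightarrow> proj (single K \<one> [Ghost e, Edge f]) = \<zero>\<^bsub>Q\<^esub>"
    for u v e f
    unfolding scaled_gen_def
    by ((rule rel; auto simp: lpa_rels_def Let_def simp del: free_lpa_simps; blast))+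
  have sum: "proj (single K \<one> [Vtx v]) = (\<Oplus>\<^bsub>Q\<^esub>e\<in>out_arcs E v. proj (single K \<one> [Edge e, Ghost e]))"
    if v: "v \<in> regular_verts E" for v
  proof -
    have c: "(\<lambda>e. single K \<one> [Edge e, Ghost e]) \<in> out_arcs E v \<rightarrow> carrier F"
      by (auto intro!: single_in_fin_supp)
    have "proj (single K \<one> [Vtx v]) = proj (\<Oplus>\<^bsub>F\<^esub>e\<in>out_arcs E v. single K \<one> [Edge e, Ghost e])"
      using v
      by (intro proj_eqI free.finsum_closed c)
        (auto simp: lpa_rels_def Let_def regular_verts_def single_in_fin_supp simp del: free_lpa_simps(2-))
    then show ?thesis
      using proj.hom_finsum[OF c] by (simp add: comp_def)
  qed
  show ?thesis
  proof unfold_locales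
    fix v assume v: "v \<in> regular_verts E"
    then have V: "v \<in> verts E" by (simp add: regular_verts_def)
    show "scaled_gen K E (s (Vtx v)) (Vtx v) =
      (\<Oplus>\<^bsub>Q\<^esub>e\<in>out_arcs E v. scaled_gen K E (s (Edge e)) (Edge e) \<otimes>\<^bsub>Q\<^esub> scaled_gen K E (s (Ghost e)) (Ghost e))"
      unfolding s(2)[OF V] scaled_gen_def[of K E \<one> "Vtx v"] sum[OF v]
      by (rule quot.finsum_cong') (auto simp: prod s unit c1 pc)
  qed (auto simp: s prod unit unit' c1 pc r split[symmetric] scaled_gen_in_lpa)
qed

end

section \<open>Homomorphisms out of Leavitt path algebras\<close>

locale leavitt_eval = src: leavitt K E + leavitt_family A E h
  for K :: "('k, 'r) ring_scheme" and A (structure) and E :: "('v, 'e) pre_digraph" and h +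
  fixes j :: "'k \<Rightarrow> 'a"
  assumes j_hom: "j \<in> ring_hom K A"
    and j_central: "\<lbrakk>k \<in> carrier K; g \<in> lpa_gens E\<rbrakk> \<Longrightarrow> j k \<otimes> h g = h g \<otimes> j k"
begin

definition word :: "('v, 'e) lpa_gen list \<Rightarrow> 'a" where
  "word w = foldr (\<lambda>g y. h g \<otimes> y) w \<one>"

text \<open>
  The extension of \<open>h\<close> to the free algebra, with scalars acting through \<open>j\<close>.
\<close>

definition ev :: "(('v, 'e) lpa_gen list \<Rightarrow> 'k) \<Rightarrow> 'a" where
  "ev x = (\<Oplus>w\<in>{w. x w \<noteq> \<zero>\<^bsub>K\<^esub>}. j (x w) \<otimes> word w)"

lemma word_simps [simp]: "word [] = \<one>" "word (g # w) = h g \<otimes> word w"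
  by (simp_all add: word_def)

lemma j_closed [simp]: "k \<in> carrier K \<Longrightarrow> j k \<in> carrier A"
  using j_hom by (rule ring_hom_closed)

lemma j_zero [simp]: "j \<zero>\<^bsub>K\<^esub> = \<zero>"
  using ring_hom_zero[OF j_hom] src.ring_axioms ring_axioms by blast

lemma word_closed [simp]: "w \<in> src.words \<Longrightarrow> word w \<in> carrier A"
  by (induction w) auto

lemma word_append: "\<lbrakk>u \<in> src.words; w \<in> src.words\<rbrakk> \<Longrightarrow> word (u @ w) = word u \<otimes> word w"
  by (induction u) (auto simp: m_assoc)

lemma j_word_commute: "\<lbrakk>k \<in> carrier K; w \<in> src.words\<rbrakk> \<Longrightarrow> j k \<otimes> word w = word w \<otimes> j k"
proof (induction w)
  case (Cons g w)
  then have c: "j k \<in> carrier A" "h g \<in> carrier A" "word w \<in> carrier A" and IH: "j k \<otimes> word w = word w \<otimes> j k"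
    by auto
  have "j k \<otimes> word (g # w) = h g \<otimes> (j k \<otimes> word w)"
    using j_central[of k g] Cons.prems c by (simp add: m_assoc[symmetric])
  also have "\<dots> = word (g # w) \<otimes> j k"
    using c by (simp add: IH m_assoc)
  finally show ?case .
qed simp

lemma ev_eq_finsum:
  assumes x: "x \<in> fin_supp K src.words" and W: "finite W" "{w. x w \<noteq> \<zero>\<^bsub>K\<^esub>} \<subseteq> W" "W \<subseteq> src.words"
  shows "ev x = (\<Oplus>w\<in>W. j (x w) \<otimes> word w)"
proof -
  have "x w \<in> carrier K" "w \<in> W \<Longrightarrow> word w \<in> carrier A" for w
    using word_closed[OF subsetD[OF W(3)]] src.fin_suppD[OF x] by blast+
  then show ?thesis
    unfolding ev_def using W(1,2) by (intro add.finprod_mono_neutral_cong_left) auto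
qed

lemma ev_single: "\<lbrakk>k \<in> carrier K; w \<in> src.words\<rbrakk> \<Longrightarrow> ev (single K k w) = j k \<otimes> word w"
  using src.single_in_fin_supp[of k w src.words]
  by (subst ev_eq_finsum[of _ "{w}"]) (auto simp: single_def simp del: in_lists_conv_set)

lemma ev_closed [simp]: "x \<in> fin_supp K src.words \<Longrightarrow> ev x \<in> carrier A"
  unfolding ev_def
  by (rule finsum_closed) (use src.fin_suppD[of x src.words] in \<open>auto simp del: in_lists_conv_set intro!: m_closed\<close>)

lemma ev_add:
  assumes "x \<in> fin_supp K src.words" "y \<in> fin_supp K src.words"
  shows "ev (\<lambda>b. x b \<oplus>\<^bsub>K\<^esub> y b) = ev x \<oplus> ev y"
proof -
  let ?W = "{w. x w \<noteq> \<zero>\<^bsub>K\<^esub>} \<union> {w. y w \<noteq> \<zero>\<^bsub>K\<^esub>}"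
  have W: "finite ?W" "?W \<subseteq> src.words"
    using assms by (auto dest: src.fin_suppD)
  have c: "x w \<in> carrier K" "y w \<in> carrier K" for w
    using assms by (auto dest: src.fin_suppD)
  have w: "w \<in> src.words" if "w \<in> ?W" for w using W that by blast
  have sub: "{w. x w \<oplus>\<^bsub>K\<^esub> y w \<noteq> \<zero>\<^bsub>K\<^esub>} \<subseteq> ?W"
    by auto
  have "ev (\<lambda>b. x b \<oplus>\<^bsub>K\<^esub> y b) = (\<Oplus>w\<in>?W. j (x w) \<otimes> word w \<oplus> j (y w) \<otimes> word w)"
    unfolding ev_eq_finsum[OF src.add_in_fin_supp[OF assms] W(1) sub W(2)]
    by (intro finsum_cong') (simp_all add: Pi_iff c w ring_hom_add[OF j_hom] l_distr del: Un_iff mem_Collect_eq in_lists_conv_set)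
  also have "\<dots> = ev x \<oplus> ev y"
    using w by (subst finsum_addf)
      (auto simp: c ev_eq_finsum[OF assms(1) W(1) _ W(2)] ev_eq_finsum[OF assms(2) W(1) _ W(2)])
  finally show ?thesis .
qed

lemma ev_zero [simp]: "ev (\<lambda>_. \<zero>\<^bsub>K\<^esub>) = \<zero>"
  by (simp add: ev_def)

lemma ev_mult:
  assumes x: "x \<in> fin_supp K src.words" and y: "y \<in> fin_supp K src.words"
  shows "ev (x \<otimes>\<^bsub>src.F\<^esub> y) = ev x \<otimes> ev y"
  using x
proof (induction x rule: src.fin_supp_induct)
  case zero
  then show ?case using y by simp
next
  case (add k u x)
  have s: "single K k u \<in> fin_supp K src.words" using add by (simp add: src.single_in_fin_supp)
  have cl: "bilinear_ext K (\<lambda>x y. Some (x @ y)) a b \<in> fin_supp K src.words"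
    if "a \<in> fin_supp K src.words" "b \<in> fin_supp K src.words" for a b
    using that by (rule src.bilinear_ext_in_fin_supp) auto
  from y have "ev (single K k u \<otimes>\<^bsub>src.F\<^esub> y) = ev (single K k u) \<otimes> ev y"
  proof (induction y rule: src.fin_supp_induct)
    case zero
    then show ?case using s by simp
  next
    case (add l w y)
    have t: "single K l w \<in> fin_supp K src.words" using add by (simp add: src.single_in_fin_supp)
    have "ev (single K k u \<otimes>\<^bsub>src.F\<^esub> single K l w) = j (k \<otimes>\<^bsub>K\<^esub> l) \<otimes> word (u @ w)"
      using add \<open>k \<in> carrier K\<close> \<open>u \<in> src.words\<close>
      by (simp add: src.single_mult_single ev_single del: src.free_lpa_simps)
    also have "\<dots> = j k \<otimes> (j l \<otimes> word u) \<otimes> word w"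
      using add \<open>k \<in> carrier K\<close> \<open>u \<in> src.words\<close>
      by (simp add: ring_hom_mult[OF j_hom] word_append m_assoc)
    also have "j l \<otimes> word u = word u \<otimes> j l"
      using add \<open>u \<in> src.words\<close> by (intro j_word_commute)
    also have "j k \<otimes> (word u \<otimes> j l) \<otimes> word w = ev (single K k u) \<otimes> ev (single K l w)"
      using add \<open>k \<in> carrier K\<close> \<open>u \<in> src.words\<close>
      by (simp add: ev_single m_assoc)
    finally show ?case
      using add s t cl
      by (simp add: src.bilinear_ext_add_right[OF s t] ev_add r_distr)
  qed
  then show ?case
    using add s y cl
    by (simp add: src.bilinear_ext_add_left[OF s _ y] ev_add l_distr)
qed

lemma ev_ring_hom: "ev \<in> ring_hom src.F A"
proof (rule ring_hom_memI)
  show "ev \<one>\<^bsub>src.F\<^esub> = \<one>"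
    using ring_hom_one[OF j_hom] by (simp add: ev_single)
qed (use ev_mult in \<open>auto simp: ev_add\<close>)

sublocale ev: ring_hom_ring src.F A ev
  using ev_ring_hom src.free.ring_axioms ring_axioms
  by (simp add: ring_hom_ring_def ring_hom_ring_axioms_def)

lemma ev_word: "w \<in> src.words \<Longrightarrow> ev (single K \<one>\<^bsub>K\<^esub> w) = word w"
  using ring_hom_one[OF j_hom] by (simp add: ev_single)

lemma ev_diff_zero:
  assumes "x \<in> carrier src.F" "y \<in> carrier src.F" "ev x = ev y"
  shows "ev (x \<ominus>\<^bsub>src.F\<^esub> y) = \<zero>"
  using assms by (simp add: a_minus_def ev.hom_add ev.hom_a_inv r_neg del: src.free_lpa_simps)

lemma ev_rels:
  assumes "x \<in> lpa_rels K E"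
  shows "ev x = \<zero>"
proof -
  have sum: "ev (\<Oplus>\<^bsub>src.F\<^esub>e\<in>out_arcs E v. single K \<one>\<^bsub>K\<^esub> [Edge e, Ghost e]) =
      (\<Oplus>e\<in>out_arcs E v. h (Edge e) \<otimes> h (Ghost e))" for v
    by (subst ev.hom_finsum)
      (auto simp: src.single_in_fin_supp ev_word intro!: finsum_cong')
  have c: "(\<Oplus>\<^bsub>src.F\<^esub>e\<in>out_arcs E v. single K \<one>\<^bsub>K\<^esub> [Edge e, Ghost e]) \<in> carrier src.F" for v
    by (rule src.free.finsum_closed) (auto simp: src.single_in_fin_supp)
  have reg: "v \<in> verts E" "(\<Oplus>e\<in>out_arcs E v. h (Edge e) \<otimes> h (Ghost e)) = h (Vtx v)"
    if "v \<in> regular_verts E" for v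
    using that by (auto simp: vtx_sum regular_verts_def)
  show ?thesis
    using assms unfolding lpa_rels_def Let_def
    by (auto simp: ev_word src.single_closed c sum vtx_idem vtx_orth tail_edge edge_head
        head_ghost ghost_tail ghost_edge ghost_edge_orth reg(1) reg(2)
        simp del: src.free_lpa_simps intro!: ev_diff_zero)
qed

lemma ev_ideal:
  assumes "x \<in> src.I"
  shows "ev x = \<zero>"
proof -
  have ker: "a_kernel src.F A ev = {x \<in> carrier src.F. ev x = \<zero>}"
    by (rule a_kernel_def')
  have "lpa_rels K E \<subseteq> {x \<in> carrier src.F. ev x = \<zero>}"
  proof (intro subsetI CollectI conjI)
    fix r assume r: "r \<in> lpa_rels K E"
    show "r \<in> carrier src.F"
      by (rule subsetD[OF src.Aug_subset subsetD[OF src.lpa_rels_subset r]])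
    show "ev r = \<zero>"
      by (rule ev_rels[OF r])
  qed
  then have "src.I \<subseteq> {x \<in> carrier src.F. ev x = \<zero>}"
    unfolding lpa_ideal_def by (rule src.free.genideal_minimal[OF ev.kernel_is_ideal[unfolded ker]])
  then show ?thesis
    using assms by blast
qed

text \<open>
  Evaluation is a ring homomorphism that vanishes on the defining relations, hence on the ideal
  they generate. This makes it a function of cosets.
\<close>

lemma ev_coset:
  assumes "x \<in> carrier src.F" "y \<in> src.proj x"
  shows "ev y = ev x"
proof -
  from assms(2) obtain i where i: "i \<in> src.I" "y = i \<oplus>\<^bsub>src.F\<^esub> x"
    by (auto simp: a_r_coset_def')
  then show ?thesis
    using assms(1) ev_ideal[OF i(1)] src.I.Icarr[OF i(1)] ev.hom_add by simp
qed

end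

lemma finsum_subring:
  assumes "abelian_monoid B" "abelian_monoid A"
    and "carrier B \<subseteq> carrier A" "\<zero>\<^bsub>B\<^esub> = \<zero>\<^bsub>A\<^esub>" "add B = add A"
    and "finite S" "f \<in> S \<rightarrow> carrier B"
  shows "finsum B f S = finsum A f S"
  using assms(6,7)
proof (induction S)
  case empty
  then show ?case using assms by (simp add: abelian_monoid.finsum_empty)
next
  case (insert x S)
  moreover from insert have "f \<in> insert x S \<rightarrow> carrier A"
    using assms(3) by blast
  ultimately show ?case
    using assms(5)
    by (subst abelian_monoid.finsum_insert[OF assms(1)]; (subst abelian_monoid.finsum_insert[OF assms(2)])?) auto
qed

context leavitt
begin

lemma lpa_abelian_monoid: "abelian_monoid (lpa K E)"
proof (rule abelian_monoidI)
  fix x y assume "x \<in> carrier (lpa K E)" "y \<in> carrier (lpa K E)"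
  then obtain a b where ab: "a \<in> Aug" "b \<in> Aug" "x = proj a" "y = proj b"
    by auto
  then have "x \<oplus>\<^bsub>Q\<^esub> y = proj (a \<oplus>\<^bsub>F\<^esub> b)" "a \<oplus>\<^bsub>F\<^esub> b \<in> Aug"
    using Aug_subset proj.hom_add[of a b] add_in_fin_supp[of a _ b] by auto
  then show "x \<oplus>\<^bsub>lpa K E\<^esub> y \<in> carrier (lpa K E)"
    by (simp del: free_lpa_simps)
next
  show "\<zero>\<^bsub>lpa K E\<^esub> \<in> carrier (lpa K E)"
    using proj.hom_zero zero_in_fin_supp[of "words - {[]}"] by (auto simp del: proj.hom_zero intro!: image_eqI[rotated])
qed (use subsetD[OF lpa_subset] in \<open>simp_all add: quot.a_ac del: lpa_simps(1)\<close>)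

lemma lpa_mult_closed:
  assumes "x \<in> carrier Q" "y \<in> carrier (lpa K E)"
  shows "x \<otimes>\<^bsub>Q\<^esub> y \<in> carrier (lpa K E)"
proof -
  interpret J: ideal Aug F by (rule Aug_ideal)
  from assms obtain a b where ab: "a \<in> carrier F" "b \<in> Aug" "x = proj a" "y = proj b"
    by (auto simp: FactRing_def A_RCOSETS_def RCOSETS_def a_r_coset_def simp del: free_lpa_simps)
  then have "x \<otimes>\<^bsub>Q\<^esub> y = proj (a \<otimes>\<^bsub>F\<^esub> b)" "a \<otimes>\<^bsub>F\<^esub> b \<in> Aug"
    using Aug_subset proj.hom_mult[of a b] J.I_l_closed[of b a] by (auto simp del: free_lpa_simps)
  then show ?thesis
    by (simp del: free_lpa_simps)
qed

end

text \<open>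
  Evaluation is constant on cosets, so the value on a coset can be read off from the
  representative \<open>single K k [g]\<close>. The sum in the definition of \<^const>\<open>lpa_hom\<close> is taken in the
  non-unital algebra \<open>lpa K' E'\<close>. It agrees with the sum in the ambient unital quotient, because
  the relations have no constant term, so that a coset of an element without constant term
  contains only such elements.
\<close>

lemma lpa_hom_scaled_gen:
  fixes K :: "('k, 'r) ring_scheme" and E :: "('v, 'e) pre_digraph"
    and K' :: "('k2, 'r2) ring_scheme" and E' :: "('v2, 'e2) pre_digraph"
  assumes src: "leavitt K E" and tgt: "leavitt K' E'" and j: "j \<in> ring_hom K K'"
    and fam: "leavitt_family (free_lpa K' E' Quot lpa_ideal K' E') E h"
    and h: "\<And>g. g \<in> lpa_gens E \<Longrightarrow> h g \<in> carrier (lpa K' E')"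
    and central: "\<And>k g. \<lbrakk>k \<in> carrier K'; g \<in> lpa_gens E\<rbrakk> \<Longrightarrow>
      scalar_coset K' E' k \<otimes>\<^bsub>free_lpa K' E' Quot lpa_ideal K' E'\<^esub> h g =
      h g \<otimes>\<^bsub>free_lpa K' E' Quot lpa_ideal K' E'\<^esub> scalar_coset K' E' k"
    and k: "k \<in> carrier K" and g: "g \<in> lpa_gens E"
  shows "lpa_hom K (pullback (lpa K' E') j) h (scaled_gen K E k g) =
    scalar_coset K' E' (j k) \<otimes>\<^bsub>free_lpa K' E' Quot lpa_ideal K' E'\<^esub> h g"
proof -
  interpret src: leavitt K E by fact
  interpret tgt: leavitt K' E' by fact
  let ?j = "scalar_coset K' E' \<circ> j"
  let ?A = "pullback (lpa K' E') j"
  interpret leavitt_eval K tgt.Q E h ?j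
    using j central fam src ring_hom_closed[OF j] ring_hom_trans[OF j tgt.scalar_coset_hom]
    by (intro leavitt_eval.intro leavitt_eval_axioms.intro) auto
  have A: "abelian_monoid ?A"
  proof -
    interpret B: abelian_monoid "lpa K' E'" by (rule tgt.lpa_abelian_monoid)
    show ?thesis
      by (rule abelian_monoidI) (simp_all add: pullback_def B.a_ac del: tgt.lpa_simps)
  qed
  have word_lpa: "word w \<in> carrier (lpa K' E')" if "w \<in> src.words" "w \<noteq> []" for w
    using that
  proof (induction w)
    case (Cons g w)
    show ?case
    proof (cases "w = []")
      case True
      then show ?thesis using Cons h[of g] tgt.lpa_subset by (auto simp del: tgt.lpa_simps)
    next
      case False
      then show ?thesis using Cons by (auto intro!: tgt.lpa_mult_closed simp del: tgt.lpa_simps)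
    qed
  qed simp
  have val: "(\<Oplus>\<^bsub>?A\<^esub>w\<in>{w. x w \<noteq> \<zero>\<^bsub>K\<^esub>}. x w \<odot>\<^bsub>?A\<^esub> foldr (\<lambda>g y. h g \<otimes>\<^bsub>?A\<^esub> y) w \<one>\<^bsub>?A\<^esub>) = ev x"
    if x: "x \<in> src.Aug" for x
  proof -
    have "foldr (\<lambda>g y. h g \<otimes>\<^bsub>?A\<^esub> y) w \<one>\<^bsub>?A\<^esub> = word w" for w
      by (simp add: word_def pullback_def)
    then have "(\<Oplus>\<^bsub>?A\<^esub>w\<in>{w. x w \<noteq> \<zero>\<^bsub>K\<^esub>}. x w \<odot>\<^bsub>?A\<^esub> foldr (\<lambda>g y. h g \<otimes>\<^bsub>?A\<^esub> y) w \<one>\<^bsub>?A\<^esub>) =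
      (\<Oplus>\<^bsub>?A\<^esub>w\<in>{w. x w \<noteq> \<zero>\<^bsub>K\<^esub>}. ?j (x w) \<otimes>\<^bsub>tgt.Q\<^esub> word w)"
      by (simp add: pullback_def)
    also have "\<dots> = ev x"
      unfolding ev_def
    proof (rule finsum_subring[OF A tgt.quot.abelian_monoid_axioms])
      show "(\<lambda>w. ?j (x w) \<otimes>\<^bsub>tgt.Q\<^esub> word w) \<in> {w. x w \<noteq> \<zero>\<^bsub>K\<^esub>} \<rightarrow> carrier ?A"
      proof
        fix w assume "w \<in> {w. x w \<noteq> \<zero>\<^bsub>K\<^esub>}"
        then have "w \<in> src.words" "w \<noteq> []" "x w \<in> carrier K"
          using src.fin_suppD[OF x] by auto
        then show "?j (x w) \<otimes>\<^bsub>tgt.Q\<^esub> word w \<in> carrier ?A"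
          using tgt.lpa_mult_closed[OF j_closed word_lpa] by (simp add: pullback_def del: tgt.lpa_simps)
      qed
      show "finite {w. x w \<noteq> \<zero>\<^bsub>K\<^esub>}" using src.fin_suppD[OF x] by simp
    qed (use tgt.lpa_subset in \<open>auto simp: pullback_def lpa_def Let_def\<close>)
    finally show ?thesis .
  qed
  have sA: "single K k [g] \<in> src.Aug" using k g by (auto intro: src.single_in_fin_supp)
  have sub: "src.proj (single K k [g]) \<subseteq> src.Aug"
  proof
    interpret J: ideal src.Aug src.F by (rule src.Aug_ideal)
    fix y assume "y \<in> src.proj (single K k [g])"
    then show "y \<in> src.Aug"
      using sA src.I_subset_Aug J.a_closed by (auto simp: a_r_coset_def' simp del: src.free_lpa_simps)
  qed
  have "lpa_hom K ?A h (scaled_gen K E k g) = the_elem (ev ` src.proj (single K k [g]))"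
    unfolding lpa_hom_def scaled_gen_def using sub val by (intro arg_cong[of _ _ the_elem] image_cong) auto
  also have "ev ` src.proj (single K k [g]) = {ev (single K k [g])}"
  proof -
    have "single K k [g] \<in> src.proj (single K k [g])"
      using src.I.a_rcos_self sA src.Aug_subset by blast
    then show ?thesis
      using ev_coset[of "single K k [g]"] sA src.Aug_subset by (auto intro!: image_eqI simp del: src.free_lpa_simps)
  qed
  also have "the_elem {ev (single K k [g])} = ?j k \<otimes>\<^bsub>tgt.Q\<^esub> h g"
    using k g h[OF g] tgt.lpa_subset by (auto simp: ev_single simp del: tgt.lpa_simps)
  finally show ?thesis by simp
qed

section \<open>Partial injections of a basis\<close>

fun lpa_star :: "('v, 'e) lpa_gen \<Rightarrow> ('v, 'e) lpa_gen" where
  "lpa_star (Vtx v) = Vtx v" | "lpa_star (Edge e) = Ghost e" | "lpa_star (Ghost e) = Edge e"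

text \<open>
  The combinatorial content shared by all path spaces. Ghosts invert edges, each path has at most
  one first edge, and a path whose source is regular does have one. The last condition is what
  the relation $v = \sum ee^*$ demands, and it is where sinks and infinite emitters may end a
  path.
\<close>

locale path_action = wf_digraph E
  for E :: "('v, 'e) pre_digraph" +
  fixes B :: "'b set" and act :: "('v, 'e) lpa_gen \<Rightarrow> 'b \<Rightarrow> 'b option" and src :: "'b \<Rightarrow> 'v"
  assumes act_closed: "\<lbrakk>g \<in> lpa_gens E; b \<in> B; act g b = Some b'\<rbrakk> \<Longrightarrow> b' \<in> B"
    and src_vert: "b \<in> B \<Longrightarrow> src b \<in> verts E"
    and act_vtx: "\<lbrakk>v \<in> verts E; b \<in> B\<rbrakk> \<Longrightarrow> act (Vtx v) b = (if v = src b then Some b else None)"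
    and act_edge_iff: "\<lbrakk>e \<in> arcs E; b \<in> B\<rbrakk> \<Longrightarrow> act (Edge e) b \<noteq> None \<longleftrightarrow> head E e = src b"
    and act_edge_ghost: "\<lbrakk>e \<in> arcs E; b \<in> B; b' \<in> B\<rbrakk> \<Longrightarrow>
      act (Edge e) b = Some b' \<longleftrightarrow> act (Ghost e) b' = Some b"
    and ghost_src: "\<lbrakk>e \<in> arcs E; b \<in> B; act (Ghost e) b \<noteq> None\<rbrakk> \<Longrightarrow> tail E e = src b"
    and ghost_unique: "\<lbrakk>e \<in> arcs E; f \<in> arcs E; b \<in> B; act (Ghost e) b \<noteq> None; act (Ghost f) b \<noteq> None\<rbrakk>
      \<Longrightarrow> e = f"
    and ghost_regular: "\<lbrakk>b \<in> B; src b \<in> regular_verts E\<rbrakk> \<Longrightarrow> \<exists>e\<in>out_arcs E (src b). act (Ghost e) b \<noteq> None"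
begin

lemma act_star:
  "\<lbrakk>g \<in> lpa_gens E; b \<in> B; b' \<in> B\<rbrakk> \<Longrightarrow> act g b = Some b' \<longleftrightarrow> act (lpa_star g) b' = Some b"
  by (cases g) (auto simp: act_vtx act_edge_ghost lpa_gens_def split: if_splits)

lemma star_gen: "g \<in> lpa_gens E \<Longrightarrow> lpa_star g \<in> lpa_gens E"
  by (cases g) (auto simp: lpa_gens_def)

definition word_act :: "('v, 'e) lpa_gen list \<Rightarrow> 'b \<Rightarrow> 'b option" where
  "word_act w b = foldr (\<lambda>g y. Option.bind y (act g)) w (Some b)"

lemma word_act_simps [simp]:
  "word_act [] b = Some b" "word_act (g # w) b = Option.bind (word_act w b) (act g)"
  by (simp_all add: word_act_def)

lemma word_act_append: "word_act (u @ w) b = Option.bind (word_act w b) (word_act u)"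
  by (induction u) (auto simp: Option.bind_assoc)

lemma word_act_closed: "\<lbrakk>w \<in> lists (lpa_gens E); b \<in> B; word_act w b = Some b'\<rbrakk> \<Longrightarrow> b' \<in> B"
  by (induction w arbitrary: b') (auto simp: bind_eq_Some_conv intro: act_closed)

lemma act_edge_src: "\<lbrakk>e \<in> arcs E; b \<in> B; act (Edge e) b = Some b'\<rbrakk> \<Longrightarrow> src b' = tail E e"
  using act_closed[of "Edge e" b b'] act_edge_ghost[of e b b'] ghost_src[of e b'] by (auto simp: lpa_gens_def)

lemma act_ghost_src: "\<lbrakk>e \<in> arcs E; b \<in> B; act (Ghost e) b = Some b'\<rbrakk> \<Longrightarrow> src b' = head E e"
  using act_closed[of "Ghost e" b b'] act_edge_ghost[of e b' b] act_edge_iff[of e b'] by (auto simp: lpa_gens_def)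

end

locale basis_action = leavitt K E + path_action E B act src
  for K :: "('k, 'r) ring_scheme" (structure) and E :: "('v, 'e) pre_digraph"
    and B :: "'b set" and act src
begin

abbreviation "ext \<equiv> bilinear_ext K word_act"

lemma ext_closed: "\<lbrakk>x \<in> carrier F; m \<in> fin_supp K B\<rbrakk> \<Longrightarrow> ext x m \<in> fin_supp K B"
  by (rule bilinear_ext_in_fin_supp) (auto intro: word_act_closed)

lemma ext_mult: "\<lbrakk>x \<in> carrier F; y \<in> carrier F; m \<in> fin_supp K B\<rbrakk> \<Longrightarrow> ext (x \<otimes>\<^bsub>F\<^esub> y) m = ext x (ext y m)"
  unfolding free_lpa_simps(2)
  by (rule bilinear_ext_assoc[where S = words and T = words and U = B]) (auto simp: word_act_append)

lemma ext_add_left: "\<lbrakk>x \<in> carrier F; y \<in> carrier F; m \<in> fin_supp K B\<rbrakk> \<Longrightarrow>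
    ext (x \<oplus>\<^bsub>F\<^esub> y) m = (\<lambda>b. ext x m b \<oplus> ext y m b)"
  unfolding free_lpa_simps(5) by (rule bilinear_ext_add_left) auto

lemma ext_add_right: "\<lbrakk>x \<in> carrier F; m \<in> fin_supp K B; n \<in> fin_supp K B\<rbrakk> \<Longrightarrow>
    ext x (\<lambda>b. m b \<oplus> n b) = (\<lambda>b. ext x m b \<oplus> ext x n b)"
  by (rule bilinear_ext_add_right) auto

lemma ext_in_carrier: "\<lbrakk>x \<in> carrier F; m \<in> fin_supp K B\<rbrakk> \<Longrightarrow> ext x m b \<in> carrier K"
  using ext_closed[of x m] by (auto dest: fin_suppD)

lemma ext_diff_zero:
  assumes "x \<in> carrier F" "y \<in> carrier F" "m \<in> fin_supp K B" "ext x m = ext y m"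
  shows "ext (x \<ominus>\<^bsub>F\<^esub> y) m = (\<lambda>_. \<zero>)"
proof -
  have d: "x \<ominus>\<^bsub>F\<^esub> y \<in> carrier F" "x = (x \<ominus>\<^bsub>F\<^esub> y) \<oplus>\<^bsub>F\<^esub> y"
    using assms(1,2) by (simp_all add: a_minus_def free.a_assoc free.l_neg free.r_zero del: free_lpa_simps)
  then have "ext x m = (\<lambda>b. ext (x \<ominus>\<^bsub>F\<^esub> y) m b \<oplus> ext y m b)"
    using ext_add_left[OF d(1) assms(2,3)] by simp
  then have "ext y m b = ext (x \<ominus>\<^bsub>F\<^esub> y) m b \<oplus> ext y m b" for b
    using assms(4) by metis
  then have "ext (x \<ominus>\<^bsub>F\<^esub> y) m b = \<zero>" for b
    using ext_in_carrier[OF d(1) assms(3)] ext_in_carrier[OF assms(2,3)] add.r_cancel_one' by blast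
  then show ?thesis by auto
qed

lemma ext_finsum:
  assumes "finite S" "\<And>e. e \<in> S \<Longrightarrow> f e \<in> carrier F" "m \<in> fin_supp K B"
  shows "ext (\<Oplus>\<^bsub>F\<^esub>e\<in>S. f e) m b = (\<Oplus>e\<in>S. ext (f e) m b)"
  using assms(1,2)
proof (induction S)
  case empty
  then show ?case using free.finsum_empty by simp
next
  case (insert e S)
  have c: "(\<Oplus>\<^bsub>F\<^esub>e\<in>S. f e) \<in> carrier F"
    using insert by (intro free.finsum_closed) auto
  have "(\<Oplus>\<^bsub>F\<^esub>e\<in>insert e S. f e) = f e \<oplus>\<^bsub>F\<^esub> (\<Oplus>\<^bsub>F\<^esub>e\<in>S. f e)"
    using insert by (intro free.finsum_insert) auto
  moreover have "(\<Oplus>e\<in>insert e S. ext (f e) m b) = ext (f e) m b \<oplus> (\<Oplus>e\<in>S. ext (f e) m b)"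
    using insert ext_in_carrier assms(3) by (intro finsum_insert) auto
  ultimately show ?case
    using insert ext_add_left[OF _ c assms(3), of "f e"] by simp
qed

lemma ext_single: "\<lbrakk>k \<in> carrier K; l \<in> carrier K\<rbrakk> \<Longrightarrow>
    ext (single K k w) (single K l b) = (case word_act w b of None \<Rightarrow> \<lambda>_. \<zero> | Some c \<Rightarrow> single K (k \<otimes> l) c)"
  by (rule bilinear_ext_single)

text \<open>
  Each relation compares two words that act on a given path in the same way, or contains a
  single word that does not act at all. In the sum over the edges leaving a regular vertex, only
  the term of the first edge of the path survives, and it fixes the path.
\<close>

lemma ext_rels:
  assumes r: "r \<in> lpa_rels K E" and m: "m \<in> fin_supp K B"
  shows "ext r m = (\<lambda>_. \<zero>)"
  using m
proof (induction m rule: fin_supp_induct)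
  case zero
  then show ?case by simp
next
  case (add l b m)
  note l = add(1) and b = add(2)
  have rF: "r \<in> carrier F" using r lpa_rels_subset Aug_subset by blast
  have lb: "single K l b \<in> fin_supp K B" using l b by (rule single_in_fin_supp)
  have same: "ext (single K \<one> u \<ominus>\<^bsub>F\<^esub> single K \<one> w) (single K l b) = (\<lambda>_. \<zero>)"
    if "u \<in> words" "w \<in> words" "word_act u b = word_act w b" for u w
    using that l lb by (intro ext_diff_zero single_closed) (auto simp: ext_single)
  have none: "ext (single K \<one> w) (single K l b) = (\<lambda>_. \<zero>)" if "word_act w b = None" for w
    using that l by (simp add: ext_single)
  have CK2: "ext (single K \<one> [Vtx v] \<ominus>\<^bsub>F\<^esub> (\<Oplus>\<^bsub>F\<^esub>e\<in>out_arcs E v. single K \<one> [Edge e, Ghost e])) (single K l b)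
      = (\<lambda>_. \<zero>)" if v: "v \<in> regular_verts E" for v
  proof (rule ext_diff_zero)
    have fin: "finite (out_arcs E v)" and V: "v \<in> verts E" using v by (auto simp: regular_verts_def)
    have c: "single K \<one> [Edge e, Ghost e] \<in> carrier F" if "e \<in> out_arcs E v" for e
      using that by (intro single_closed) auto
    show "single K \<one> [Vtx v] \<in> carrier F" using V by (intro single_closed) auto
    show "(\<Oplus>\<^bsub>F\<^esub>e\<in>out_arcs E v. single K \<one> [Edge e, Ghost e]) \<in> carrier F"
      using c by (intro free.finsum_closed) auto
    show "ext (single K \<one> [Vtx v]) (single K l b) =
      ext (\<Oplus>\<^bsub>F\<^esub>e\<in>out_arcs E v. single K \<one> [Edge e, Ghost e]) (single K l b)"
    proof
      fix z
      have sc: "single K l b z \<in> carrier K" using l by (simp add: single_def)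
      have "ext (\<Oplus>\<^bsub>F\<^esub>e\<in>out_arcs E v. single K \<one> [Edge e, Ghost e]) (single K l b) z =
        (\<Oplus>e\<in>out_arcs E v. ext (single K \<one> [Edge e, Ghost e]) (single K l b) z)"
        by (rule ext_finsum[OF fin c lb])
      also have "\<dots> = ext (single K \<one> [Vtx v]) (single K l b) z"
      proof (cases "v = src b")
        case True
        then obtain e0 where e0: "e0 \<in> out_arcs E v" "act (Ghost e0) b \<noteq> None"
          using ghost_regular[OF b] v by blast
        \<comment> \<open>Removing the first edge and putting it back fixes \<open>b\<close>; no other edge can be removed.\<close>
        have round_trip: "word_act [Edge e0, Ghost e0] b = Some b"
          using e0 b act_closed[of "Ghost e0" b] act_edge_ghost[of e0 _ b] by (auto simp: lpa_gens_def)
        have others: "word_act [Edge e, Ghost e] b = None" if "e \<in> out_arcs E v" "e \<noteq> e0" for e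
          using that e0 b ghost_unique[of e e0 b] by (cases "act (Ghost e) b") auto
        have "(\<Oplus>e\<in>out_arcs E v. ext (single K \<one> [Edge e, Ghost e]) (single K l b) z) =
          (\<Oplus>e\<in>out_arcs E v. if e0 = e then single K l b z else \<zero>)"
          using l sc round_trip others by (intro finsum_cong') (auto simp: ext_single simp del: word_act_simps)
        also have "\<dots> = single K l b z"
          using finsum_singleton[OF e0(1) fin, of "\<lambda>_. single K l b z"] sc by simp
        finally show ?thesis
          using True V l b by (simp add: ext_single act_vtx)
      next
        case False
        then have "word_act [Edge e, Ghost e] b = None" if "e \<in> out_arcs E v" for e
          using that b src_vert[OF b] ghost_src[of e b] by (cases "act (Ghost e) b") auto
        then have "(\<Oplus>e\<in>out_arcs E v. ext (single K \<one> [Edge e, Ghost e]) (single K l b) z) =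
          (\<Oplus>e\<in>out_arcs E v. \<zero>)"
          using l by (intro finsum_cong') (auto simp: ext_single simp del: word_act_simps)
        then show ?thesis
          using False V l b by (simp add: ext_single act_vtx)
      qed
      finally show "ext (single K \<one> [Vtx v]) (single K l b) z =
        ext (\<Oplus>\<^bsub>F\<^esub>e\<in>out_arcs E v. single K \<one> [Edge e, Ghost e]) (single K l b) z" ..
    qed
  qed (rule lb)
  have 1: "word_act [Vtx (tail E e), Edge e] b = word_act [Edge e] b" if "e \<in> arcs E" for e
    using that b act_edge_src[of e b] act_closed[of "Edge e" b]
    by (cases "act (Edge e) b") (auto simp: act_vtx lpa_gens_def)
  have 2: "word_act [Edge e, Vtx (head E e)] b = word_act [Edge e] b" if "e \<in> arcs E" for e
    using that b act_edge_iff[of e b] by (auto simp: act_vtx)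
  have 3: "word_act [Vtx (head E e), Ghost e] b = word_act [Ghost e] b" if "e \<in> arcs E" for e
    using that b act_ghost_src[of e b] act_closed[of "Ghost e" b]
    by (cases "act (Ghost e) b") (auto simp: act_vtx lpa_gens_def)
  have 4: "word_act [Ghost e, Vtx (tail E e)] b = word_act [Ghost e] b" if "e \<in> arcs E" for e
    using that b src_vert[OF b] ghost_src[of e b] by (cases "act (Ghost e) b") (auto simp: act_vtx)
  have 5: "word_act [Ghost e, Edge e] b = word_act [Vtx (head E e)] b" if e: "e \<in> arcs E" for e
  proof (cases "act (Edge e) b")
    case None
    then show ?thesis using e b act_edge_iff[of e b] by (simp add: act_vtx)
  next
    case (Some b')
    then have "b' \<in> B" "head E e = src b"
      using e b act_closed[of "Edge e" b b'] act_edge_iff[of e b] by (auto simp: lpa_gens_def)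
    then show ?thesis
      using Some e b act_edge_ghost[of e b b'] src_vert[OF b] by (simp add: act_vtx)
  qed
  have 6: "word_act [Ghost e, Edge f] b = None" if "e \<in> arcs E" "f \<in> arcs E" "e \<noteq> f" for e f
  proof (cases "act (Edge f) b")
    case (Some b')
    then have "b' \<in> B" "act (Ghost f) b' = Some b"
      using that b act_closed[of "Edge f" b b'] act_edge_ghost[of f b b'] by (auto simp: lpa_gens_def)
    then show ?thesis
      using that Some ghost_unique[of e f b'] by (cases "act (Ghost e) b'") auto
  qed simp
  have 7: "word_act [Vtx v, Vtx v] b = word_act [Vtx v] b" if "v \<in> verts E" for v
    using that b src_vert[OF b] by (simp add: act_vtx)
  have 8: "word_act [Vtx u, Vtx v] b = None" if "u \<in> verts E" "v \<in> verts E" "u \<noteq> v" for u v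
    using that b src_vert[OF b] by (auto simp: act_vtx)
  have "lpa_rels K E \<subseteq> {r. ext r (single K l b) = (\<lambda>_. \<zero>)}"
    unfolding lpa_rels_def Let_def
    by (intro Un_least subsetI CollectI; elim CollectE exE conjE; hypsubst)
      (rule same[OF _ _ 7] same[OF _ _ 1] same[OF _ _ 2] same[OF _ _ 3] same[OF _ _ 4]
        same[OF _ _ 5] none[OF 6] none[OF 8] CK2; auto)+
  then have "ext r (single K l b) = (\<lambda>_. \<zero>)"
    using r by (rule subsetD[THEN CollectD])
  then show ?case
    using ext_add_right[OF rF lb add(3)] add(4) by simp
qed

text \<open>
  The elements of the free algebra that annihilate the module form a two-sided ideal, which
  contains the relations.
\<close>

lemma ext_ideal:
  assumes "x \<in> I" "m \<in> fin_supp K B"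
  shows "ext x m = (\<lambda>_. \<zero>)"
proof -
  define J where "J = {x \<in> carrier F. \<forall>m \<in> fin_supp K B. ext x m = (\<lambda>_. \<zero>)}"
  have JI: "x \<in> J" if "x \<in> carrier F" "\<And>m. m \<in> fin_supp K B \<Longrightarrow> ext x m = (\<lambda>_. \<zero>)" for x
    using that unfolding J_def by blast
  have JD: "x \<in> carrier F" "m \<in> fin_supp K B \<Longrightarrow> ext x m = (\<lambda>_. \<zero>)" if "x \<in> J" for x m
    using that unfolding J_def by blast+
  have "ideal J F"
  proof (rule idealI[OF free.ring_axioms])
    show "subgroup J (add_monoid F)"
    proof (rule group.subgroupI[OF free.a_group])
      show "J \<subseteq> carrier (add_monoid F)"
        using JD(1) by (simp add: subset_iff)
      have "\<zero>\<^bsub>F\<^esub> \<in> J"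
        by (rule JI[OF free.zero_closed]) simp
      then show "J \<noteq> {}" by blast
    next
      fix a assume a: "a \<in> J"
      note c = JD(1)[OF a]
      have "ext (\<ominus>\<^bsub>F\<^esub> a) m = (\<lambda>_. \<zero>)" if m: "m \<in> fin_supp K B" for m
      proof -
        have "ext (\<ominus>\<^bsub>F\<^esub> a \<oplus>\<^bsub>F\<^esub> a) m = (\<lambda>b. ext (\<ominus>\<^bsub>F\<^esub> a) m b \<oplus> ext a m b)"
          by (rule ext_add_left[OF free.a_inv_closed[OF c] c m])
        then have "(\<lambda>_. \<zero>) = (\<lambda>b. ext (\<ominus>\<^bsub>F\<^esub> a) m b \<oplus> \<zero>)"
          unfolding free.l_neg[OF c] JD(2)[OF a m] by simp
        then show ?thesis
          using ext_in_carrier[OF free.a_inv_closed[OF c] m] by simp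
      qed
      then have "\<ominus>\<^bsub>F\<^esub> a \<in> J"
        by (rule JI[OF free.a_inv_closed[OF c]])
      then show "inv\<^bsub>add_monoid F\<^esub> a \<in> J"
        by (simp only: a_inv_def)
    next
      fix a b assume ab: "a \<in> J" "b \<in> J"
      have "a \<oplus>\<^bsub>F\<^esub> b \<in> J"
      proof (rule JI)
        show "a \<oplus>\<^bsub>F\<^esub> b \<in> carrier F"
          using ab by (intro free.a_closed JD(1))
        show "ext (a \<oplus>\<^bsub>F\<^esub> b) m = (\<lambda>_. \<zero>)" if "m \<in> fin_supp K B" for m
          using ext_add_left[OF JD(1)[OF ab(1)] JD(1)[OF ab(2)] that] JD(2)[OF ab(1) that]
            JD(2)[OF ab(2) that] by simp
      qed
      then show "a \<otimes>\<^bsub>add_monoid F\<^esub> b \<in> J" by simp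
    qed
  next
    fix a x assume a: "a \<in> J" and x: "x \<in> carrier F"
    note c = JD(1)[OF a]
    show "x \<otimes>\<^bsub>F\<^esub> a \<in> J"
    proof (rule JI[OF free.m_closed[OF x c]])
      fix m assume m: "m \<in> fin_supp K B"
      show "ext (x \<otimes>\<^bsub>F\<^esub> a) m = (\<lambda>_. \<zero>)"
        unfolding ext_mult[OF x c m] JD(2)[OF a m] by simp
    qed
    show "a \<otimes>\<^bsub>F\<^esub> x \<in> J"
    proof (rule JI[OF free.m_closed[OF c x]])
      fix m assume m: "m \<in> fin_supp K B"
      show "ext (a \<otimes>\<^bsub>F\<^esub> x) m = (\<lambda>_. \<zero>)"
        unfolding ext_mult[OF c x m] JD(2)[OF a ext_closed[OF x m]] ..
    qed
  qed
  moreover have "lpa_rels K E \<subseteq> J"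
    using ext_rels by (intro subsetI JI subsetD[OF Aug_subset subsetD[OF lpa_rels_subset]])
  ultimately have "I \<subseteq> J"
    unfolding lpa_ideal_def by (rule free.genideal_minimal)
  then show ?thesis using JD(2) assms by blast
qed

lemma basis_module_smult_proj:
  assumes x: "x \<in> carrier F" and m: "m \<in> fin_supp K B"
  shows "proj x \<odot>\<^bsub>basis_module K B act\<^esub> m = ext x m"
proof -
  have eq: "ext y m = ext x m" if "y \<in> proj x" for y
  proof -
    from that obtain i where i: "i \<in> I" "y = i \<oplus>\<^bsub>F\<^esub> x"
      by (auto simp: a_r_coset_def')
    then show ?thesis
      using ext_add_left[OF I.Icarr[OF i(1)] x m] ext_ideal[OF i(1) m] ext_in_carrier[OF x m] by simp
  qed
  have "x \<in> proj x" using x by (rule I.a_rcos_self)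
  then have "(\<lambda>y. ext y m) ` proj x = {ext x m}"
    using eq by blast
  then show ?thesis
    by (simp add: basis_module_def word_act_def[abs_def])
qed

end

text \<open>
  The coefficient of the image at \<open>b\<close> is taken from the unique path that \<open>g\<close> sends to \<open>b\<close>, which
  is the image of \<open>b\<close> under the starred generator.
\<close>

definition gen_act :: "('k, 'r) ring_scheme \<Rightarrow> 'b set \<Rightarrow> (('v, 'e) lpa_gen \<Rightarrow> 'b \<Rightarrow> 'b option) \<Rightarrow>
    'k \<Rightarrow> ('v, 'e) lpa_gen \<Rightarrow> ('b \<Rightarrow> 'k) \<Rightarrow> 'b \<Rightarrow> 'k" where
  "gen_act K B act k g m = (\<lambda>b. if b \<in> B
     then (case act (lpa_star g) b of None \<Rightarrow> \<zero>\<^bsub>K\<^esub> | Some b' \<Rightarrow> k \<otimes>\<^bsub>K\<^esub> m b') else \<zero>\<^bsub>K\<^esub>)"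

lemma (in basis_action) basis_module_smult_scaled_gen:
  assumes k: "k \<in> carrier K" and g: "g \<in> lpa_gens E" and m: "m \<in> fin_supp K B"
  shows "scaled_gen K E k g \<odot>\<^bsub>basis_module K B act\<^esub> m = gen_act K B act k g m"
proof -
  have kg: "single K k [g] \<in> carrier F" using k g by (intro single_closed) auto
  have "scaled_gen K E k g \<odot>\<^bsub>basis_module K B act\<^esub> m = ext (single K k [g]) m"
    unfolding scaled_gen_def using basis_module_smult_proj[OF kg m] .
  also have "\<dots> = gen_act K B act k g m"
    using m
  proof (induction m rule: fin_supp_induct)
    case zero
    then show ?case using k by (auto simp: gen_act_def split: option.split)
  next
    case (add l c m)
    have lc: "single K l c \<in> fin_supp K B" using add by (simp add: single_in_fin_supp)
    have "ext (single K k [g]) (single K l c) b \<oplus> gen_act K B act k g m b =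
      gen_act K B act k g (\<lambda>x. single K l c x \<oplus> m x) b" for b
    proof -
      have "ext (single K k [g]) (single K l c) b = (if act g c = Some b then k \<otimes> l else \<zero>)"
        unfolding ext_single[OF k \<open>l \<in> carrier K\<close>] by (auto simp: single_def split: option.split)
      moreover have "act g c = Some b \<longleftrightarrow> b \<in> B \<and> act (lpa_star g) b = Some c"
        using act_star[OF g \<open>c \<in> B\<close>] act_closed[OF g \<open>c \<in> B\<close>] by blast
      moreover have "m x \<in> carrier K" for x using add by (auto dest: fin_suppD)
      ultimately show ?thesis
        using k add by (auto simp: gen_act_def single_def r_distr split: option.split)
    qed
    then show ?case
      using ext_add_right[OF kg lc add(3)] add(4) by simp
  qed
  finally show ?thesis .
qed

section \<open>Weighted modules of paths\<close>

text \<open>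
  The common shape of the Chen modules: scalars of $K$ act through \<open>j\<close>, and \<open>wt\<close> assigns to each
  generator the unit by which it is multiplied.
\<close>

locale path_module = leavitt K E + coeff: cring K' + path_action E B act src
  for K :: "('k, 'r) ring_scheme" and E :: "('v, 'e) pre_digraph"
    and K' :: "('k2, 'r2) ring_scheme" (structure) and B :: "'b set" and act src +
  fixes j :: "'k \<Rightarrow> 'k2" and wt :: "('v, 'e) lpa_gen \<Rightarrow> 'k2"
    and M :: "((('v, 'e) lpa_gen list \<Rightarrow> 'k) set, 'b \<Rightarrow> 'k2) module"
  assumes nontrivial: "\<one> \<noteq> \<zero>"
    and j_hom: "j \<in> ring_hom K K'"
    and wt_closed [simp]: "g \<in> lpa_gens E \<Longrightarrow> wt g \<in> carrier K'"
    and wt_vtx: "v \<in> verts E \<Longrightarrow> wt (Vtx v) = \<one>"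
    and wt_edge_ghost: "e \<in> arcs E \<Longrightarrow> wt (Edge e) \<otimes> wt (Ghost e) = \<one>"
    and carrier_M: "carrier M = fin_supp K' B"
    and add_M: "x \<oplus>\<^bsub>M\<^esub> y = (\<lambda>b. x b \<oplus> y b)"
    and smult_M: "\<lbrakk>k \<in> carrier K; g \<in> lpa_gens E; m \<in> fin_supp K' B\<rbrakk> \<Longrightarrow>
      scaled_gen K E k g \<odot>\<^bsub>M\<^esub> m = gen_act K' B act (j k \<otimes> wt g) g m"

lemma (in basis_action) path_module_basis_module:
  assumes "\<one> \<noteq> \<zero>"
  shows "path_module K E K B act src (\<lambda>k. k) (\<lambda>_. \<one>) (basis_module K B act)"
  by unfold_locales
    (use assms basis_module_smult_scaled_gen in \<open>auto simp: basis_module_def[of K B act] ring_hom_def\<close>)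

subsection \<open>Finite and infinite paths\<close>

lemma path_action_finite_paths:
  assumes "wf_digraph E" "w \<in> sinks E"
  shows "path_action E {(u, p). pre_digraph.awalk E u p w} (finite_path_act E) fst"
proof -
  interpret wf_digraph E by fact
  have arc: "p \<noteq> []" if "awalk u p w" "u \<in> regular_verts E" for u p
    using that assms(2) by (auto simp: regular_verts_def sinks_def awalk_def)
  show ?thesis
  proof unfold_locales
    fix b assume b: "b \<in> {(u, p). awalk u p w}" "fst b \<in> regular_verts E"
    obtain u p where up: "b = (u, p)" by fastforce
    with arc b obtain e es where "p = e # es" by (cases p) auto
    with up b show "\<exists>e\<in>out_arcs E (fst b). finite_path_act E (Ghost e) b \<noteq> None"
      by (auto simp: finite_path_act_def awalk_Cons_iff)
  qed (auto simp: finite_path_act_def lpa_gens_def awalk_Cons_iff awalk_hd_in_verts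
      split: list.splits if_splits)
qed

lemma infinite_path_SCons:
  "infinite_path E (e ## p) \<longleftrightarrow> e \<in> arcs E \<and> head E e = tail E (shd p) \<and> infinite_path E p"
proof -
  have split: "(\<forall>i. Q i) \<longleftrightarrow> Q 0 \<and> (\<forall>i. Q (Suc i))" for Q :: "nat \<Rightarrow> bool"
    by (metis old.nat.exhaust)
  have "(\<forall>i. head E ((e ## p) !! i) = tail E ((e ## p) !! Suc i)) \<longleftrightarrow>
    head E e = tail E (shd p) \<and> (\<forall>i. head E (p !! i) = tail E (p !! Suc i))"
    by (subst split) simp
  then show ?thesis
    by (auto simp: infinite_path_def)
qed

lemma tail_equivalent_SCons: "tail_equivalent p (e ## q) \<longleftrightarrow> tail_equivalent p q"
proof
  assume "tail_equivalent p (e ## q)"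
  then obtain m n where mn: "0 < m" "0 < n" "sdrop m p = sdrop n (e ## q)"
    by (auto simp: tail_equivalent_def)
  then have "sdrop (m + 1) p = sdrop n q"
    by (metis Suc_pred' add.commute plus_1_eq_Suc sdrop.simps(2) sdrop_stl stream.sel(2))
  then show "tail_equivalent p q"
    using mn unfolding tail_equivalent_def by (metis add_gr_0)
next
  assume "tail_equivalent p q"
  then obtain m n where "0 < m" "0 < n" "sdrop m p = sdrop n q"
    by (auto simp: tail_equivalent_def)
  then have "0 < m" "0 < Suc n" "sdrop m p = sdrop (Suc n) (e ## q)"
    by auto
  then show "tail_equivalent p (e ## q)"
    unfolding tail_equivalent_def by blast
qed

lemma tail_class_SCons:
  "e ## q \<in> tail_class E p \<longleftrightarrow> e \<in> arcs E \<and> head E e = tail E (shd q) \<and> q \<in> tail_class E p"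
  by (auto simp: tail_class_def infinite_path_SCons tail_equivalent_SCons)

lemma path_action_tail_class:
  assumes "wf_digraph E" "P \<in> tail_classes E"
  shows "path_action E P (infinite_path_act E) (\<lambda>p. tail E (shd p))"
proof -
  interpret wf_digraph E by fact
  obtain p where P: "P = tail_class E p"
    using assms(2) by (auto simp: tail_classes_def)
  have shd: "e \<in> arcs E" "head E e = tail E (shd q)" "q \<in> P" if "e ## q \<in> P" for e q
    using that by (auto simp: P tail_class_SCons)
  have shd': "shd q \<in> arcs E" if "q \<in> P" for q
    using shd[of "shd q" "stl q"] that by simp
  have stl: "stl q \<in> P" "head E (shd q) = tail E (shd (stl q))" if "q \<in> P" for q
    using shd[of "shd q" "stl q"] that by simp_all
  show ?thesis
  proof unfold_locales
    fix g b b' assume "g \<in> lpa_gens E" "b \<in> P" "infinite_path_act E g b = Some b'"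
    then show "b' \<in> P"
      using stl by (auto simp: lpa_gens_def infinite_path_act_def P tail_class_SCons split: if_splits)
  next
    fix e b b' assume "e \<in> arcs E" "b \<in> P" "b' \<in> P"
    then show "(infinite_path_act E (Edge e) b = Some b') = (infinite_path_act E (Ghost e) b' = Some b)"
      using stl[of b'] by (cases b') (auto simp: infinite_path_act_def)
  qed (use shd' in \<open>auto simp: infinite_path_act_def out_arcs_def split: if_splits\<close>)
qed

subsection \<open>Twisting by a unit of an extension\<close>

definition twist_weight :: "('k, 'r) ring_scheme \<Rightarrow> 'k \<Rightarrow> 'e \<Rightarrow> ('v, 'e) lpa_gen \<Rightarrow> 'k" where
  "twist_weight K t e g = (if g = Edge e then t else if g = Ghost e then inv\<^bsub>K\<^esub> t else \<one>\<^bsub>K\<^esub>)"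

lemma pullback_simps [simp]:
  "carrier (pullback M h) = carrier M" "x \<oplus>\<^bsub>pullback M h\<^esub> y = x \<oplus>\<^bsub>M\<^esub> y"
  "a \<odot>\<^bsub>pullback M h\<^esub> x = h a \<odot>\<^bsub>M\<^esub> x"
  by (simp_all add: pullback_def)

lemma pullback_id: "pullback M (\<lambda>x. x) = (M :: ('a, 'm) module)"
  by (simp add: pullback_def)

text \<open>
  Extending scalars turns $kg$ into $j(k)g$, and the twist multiplies the generators \<open>Edge e\<close> and
  \<open>Ghost e\<close> by $t$ and $t^{-1}$. Both maps are evaluated on scaled generators only.
\<close>

lemma path_module_twisted:
  fixes K :: "('k, 'r) ring_scheme" and K' :: "('k2, 'r2) ring_scheme"
    and E :: "('v, 'e) pre_digraph"
  assumes "wf_digraph E" "cring K" "cring K'" "j \<in> ring_hom K K'" "\<one>\<^bsub>K'\<^esub> \<noteq> \<zero>\<^bsub>K'\<^esub>"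
    and t: "t \<in> Units K'" and e: "e \<in> arcs E" and P: "P \<in> tail_classes E"
  shows "path_module K E K' P (infinite_path_act E) (\<lambda>p. tail E (shd p)) j (twist_weight K' t e)
    (pullback (pullback (chen_path K' E P) (twist K' E t e))
      (lpa_hom K (pullback (lpa K' E) j) (lpa_elt K' E)))"
proof -
  interpret K: leavitt K E using assms by (intro leavitt.intro)
  interpret K': leavitt K' E using assms by (intro leavitt.intro)
  interpret path_action E P "infinite_path_act E" "\<lambda>p. tail E (shd p)"
    using assms by (intro path_action_tail_class)
  interpret A: basis_action K' E P "infinite_path_act E" "\<lambda>p. tail E (shd p)"
    by unfold_locales
  let ?w = "twist_weight K' t e :: ('v, 'e) lpa_gen \<Rightarrow> 'k2" and ?h = "lpa_hom K (pullback (lpa K' E) j) (lpa_elt K' E)"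
  let ?\<sigma> = "\<lambda>g. scaled_gen K' E (?w g) g"
  have tc: "t \<in> carrier K'" "inv\<^bsub>K'\<^esub> t \<in> carrier K'"
    using t by (auto intro: K'.Units_closed K'.Units_inv_closed)
  have w: "?w g \<in> carrier K'" for g :: "('v, 'e) lpa_gen"
    using tc by (simp add: twist_weight_def)
  have wu: "?w (Edge f) \<otimes>\<^bsub>K'\<^esub> ?w (Ghost f) = \<one>\<^bsub>K'\<^esub>" for f :: 'e
    using t by (simp add: twist_weight_def K'.Units_r_inv)
  have ext: "?h (scaled_gen K E k g) = scaled_gen K' E (j k) g" if "k \<in> carrier K" "g \<in> lpa_gens E" for k g
  proof -
    have "leavitt_family K'.Q E (lpa_elt K' E)"
      using K'.leavitt_family_rescaled[of "\<lambda>_. \<one>\<^bsub>K'\<^esub>"] by (simp add: K'.lpa_elt_eq[abs_def])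
    then have "?h (scaled_gen K E k g) = scalar_coset K' E (j k) \<otimes>\<^bsub>K'.Q\<^esub> lpa_elt K' E g"
      using that assms(4) K'.scaled_gen_in_lpa
      by (intro lpa_hom_scaled_gen K.leavitt_axioms K'.leavitt_axioms)
        (simp_all add: K'.lpa_elt_eq K'.scalar_mult_scaled_gen K'.scaled_gen_mult_scalar del: K'.lpa_simps)
    then show ?thesis
      using that ring_hom_closed[OF assms(4)] by (simp add: K'.lpa_elt_eq K'.scalar_mult_scaled_gen)
  qed
  have tw: "twist K' E t e (scaled_gen K' E k g) = scaled_gen K' E (k \<otimes>\<^bsub>K'\<^esub> ?w g) g"
    if "k \<in> carrier K'" "g \<in> lpa_gens E" for k g
  proof -
    let ?H = "\<lambda>g. if g = Edge e then t \<odot>\<^bsub>lpa K' E\<^esub> lpa_elt K' E g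
     else if g = Ghost e then (inv\<^bsub>K'\<^esub> t) \<odot>\<^bsub>lpa K' E\<^esub> lpa_elt K' E g else lpa_elt K' E g"
    have H: "?H = ?\<sigma>"
      using tc e by (auto simp: fun_eq_iff twist_weight_def K'.lpa_elt_eq K'.scalar_mult_scaled_gen)
    have "twist K' E t e (scaled_gen K' E k g) =
        lpa_hom K' (pullback (lpa K' E) (\<lambda>x. x)) ?\<sigma> (scaled_gen K' E k g)"
      unfolding twist_def H pullback_id ..
    also have "\<dots> = scalar_coset K' E k \<otimes>\<^bsub>K'.Q\<^esub> ?\<sigma> g"
      using that w K'.scaled_gen_in_lpa wu
      by (intro lpa_hom_scaled_gen K'.leavitt_axioms K'.leavitt_family_rescaled)
        (simp_all add: ring_hom_def K'.scalar_mult_scaled_gen K'.scaled_gen_mult_scalar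
          twist_weight_def[of _ _ _ "Vtx _"] del: K'.lpa_simps)
    finally show ?thesis
      using that w by (simp add: K'.scalar_mult_scaled_gen)
  qed
  show ?thesis
  proof (intro path_module.intro path_module_axioms.intro K.leavitt_axioms assms(3-5) path_action_axioms)
    fix k g m assume *: "k \<in> carrier K" "g \<in> lpa_gens E" "m \<in> fin_supp K' P"
    have "j k \<in> carrier K'" using * ring_hom_closed[OF assms(4)] by blast
    then show "scaled_gen K E k g \<odot>\<^bsub>pullback (pullback (chen_path K' E P) (twist K' E t e)) ?h\<^esub> m =
        gen_act K' P (infinite_path_act E) (j k \<otimes>\<^bsub>K'\<^esub> ?w g) g m"
      using * w by (simp add: ext tw chen_path_def A.basis_module_smult_scaled_gen)
  qed (use w wu in \<open>simp_all add: twist_weight_def[of _ _ _ "Vtx _"] chen_path_def basis_module_def\<close>)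
qed

section \<open>Quotient graphs\<close>

context leavitt_family
begin

lemma leavitt_family_cong:
  assumes "\<And>g. g \<in> lpa_gens E \<Longrightarrow> h' g = h g"
  shows "leavitt_family A E h'"
proof -
  have eq: "v \<in> verts E \<Longrightarrow> h' (Vtx v) = h (Vtx v)" "e \<in> arcs E \<Longrightarrow> h' (Edge e) = h (Edge e)"
    "e \<in> arcs E \<Longrightarrow> h' (Ghost e) = h (Ghost e)" for v e
    using assms by (auto simp: lpa_gens_def)
  show ?thesis
  proof unfold_locales
    fix v assume v: "v \<in> regular_verts E"
    have "h' (Vtx v) = (\<Oplus>e\<in>out_arcs E v. h (Edge e) \<otimes> h (Ghost e))"
      using v vtx_sum[OF v] by (simp add: eq regular_verts_def)
    also have "\<dots> = (\<Oplus>e\<in>out_arcs E v. h' (Edge e) \<otimes> h' (Ghost e))"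
      by (rule finsum_cong') (auto simp: eq lpa_gens_def)
    finally show "h' (Vtx v) = (\<Oplus>e\<in>out_arcs E v. h' (Edge e) \<otimes> h' (Ghost e))" .
  qed (auto simp: assms eq vtx_idem vtx_orth tail_edge edge_head head_ghost ghost_tail ghost_edge
      ghost_edge_orth)
qed

text \<open>
  Extension by $0$ to edges and vertices outside the graph. In a quotient graph a generator of
  $E$ may lack either of its copies, and the missing ones then need no separate treatment.
\<close>

definition h0 :: "('v, 'e) lpa_gen \<Rightarrow> 'a" where
  "h0 g = (if g \<in> lpa_gens E then h g else \<zero>)"

lemma h0_closed [simp]: "h0 g \<in> carrier A"
  by (simp add: h0_def)

lemma gens [simp]:
  "Vtx v \<in> lpa_gens E \<longleftrightarrow> v \<in> verts E" "Edge e \<in> lpa_gens E \<longleftrightarrow> e \<in> arcs E"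
  "Ghost e \<in> lpa_gens E \<longleftrightarrow> e \<in> arcs E"
  by (auto simp: lpa_gens_def)

lemma h0_vtx_vtx: "h0 (Vtx x) \<otimes> h0 (Vtx y) = (if x = y then h0 (Vtx x) else \<zero>)"
  by (simp add: h0_def vtx_idem vtx_orth)

lemma h0_vtx_edge: "h0 (Vtx x) \<otimes> h0 (Edge e) = (if x = tail E e then h0 (Edge e) else \<zero>)"
proof (cases "e \<in> arcs E \<and> x \<in> verts E")
  case True
  then have "h (Vtx x) \<otimes> h (Edge e) = (h (Vtx x) \<otimes> h (Vtx (tail E e))) \<otimes> h (Edge e)"
    by (simp add: m_assoc tail_edge)
  with True show ?thesis by (auto simp: h0_def vtx_orth vtx_idem tail_edge)
qed (auto simp: h0_def)

lemma h0_edge_vtx: "h0 (Edge e) \<otimes> h0 (Vtx x) = (if x = head E e then h0 (Edge e) else \<zero>)"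
proof (cases "e \<in> arcs E \<and> x \<in> verts E")
  case True
  then have "h (Edge e) \<otimes> h (Vtx x) = h (Edge e) \<otimes> (h (Vtx (head E e)) \<otimes> h (Vtx x))"
    by (simp add: m_assoc[symmetric] edge_head)
  with True show ?thesis by (auto simp: h0_def vtx_orth edge_head)
qed (auto simp: h0_def)

lemma h0_vtx_ghost: "h0 (Vtx x) \<otimes> h0 (Ghost e) = (if x = head E e then h0 (Ghost e) else \<zero>)"
proof (cases "e \<in> arcs E \<and> x \<in> verts E")
  case True
  then have "h (Vtx x) \<otimes> h (Ghost e) = (h (Vtx x) \<otimes> h (Vtx (head E e))) \<otimes> h (Ghost e)"
    by (simp add: m_assoc head_ghost)
  with True show ?thesis by (auto simp: h0_def vtx_orth vtx_idem head_ghost)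
qed (auto simp: h0_def)

lemma h0_ghost_vtx: "h0 (Ghost e) \<otimes> h0 (Vtx x) = (if x = tail E e then h0 (Ghost e) else \<zero>)"
proof (cases "e \<in> arcs E \<and> x \<in> verts E")
  case True
  then have "h (Ghost e) \<otimes> h (Vtx x) = h (Ghost e) \<otimes> (h (Vtx (tail E e)) \<otimes> h (Vtx x))"
    by (simp add: m_assoc[symmetric] ghost_tail)
  with True show ?thesis by (auto simp: h0_def vtx_orth ghost_tail)
qed (auto simp: h0_def)

lemma h0_ghost_edge:
  "h0 (Ghost e) \<otimes> h0 (Edge f) = (if e = f \<and> e \<in> arcs E then h0 (Vtx (head E e)) else \<zero>)"
  by (auto simp: h0_def ghost_edge ghost_edge_orth)

lemma h0_edge_ghost:
  assumes "head E e \<noteq> head E f"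
  shows "h0 (Edge e) \<otimes> h0 (Ghost f) = \<zero>"
proof (cases "e \<in> arcs E \<and> f \<in> arcs E")
  case True
  then have "h (Edge e) \<otimes> h (Ghost f) = h (Edge e) \<otimes> (h0 (Vtx (head E e)) \<otimes> h0 (Ghost f))"
    by (simp add: m_assoc[symmetric] edge_head h0_def)
  with True assms show ?thesis by (simp add: h0_vtx_ghost) (simp add: h0_def)
qed (auto simp: h0_def)

end

fun untag :: "'a tagged \<Rightarrow> 'a" where
  "untag (Orig x) = x" | "untag (Prime x) = x"

abbreviation orig_gen :: "('v, 'e) lpa_gen \<Rightarrow> ('v tagged, 'e tagged) lpa_gen" where
  "orig_gen \<equiv> map_lpa_gen Orig Orig"

abbreviation prime_gen :: "('v, 'e) lpa_gen \<Rightarrow> ('v tagged, 'e tagged) lpa_gen" where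
  "prime_gen \<equiv> map_lpa_gen Prime Prime"

locale graph_quotient = leavitt K E
  for K :: "('k, 'r) ring_scheme" (structure) and E :: "('v, 'e) pre_digraph" +
  fixes H S :: "'v set"
  assumes hereditary: "\<lbrakk>e \<in> arcs E; tail E e \<in> H\<rbrakk> \<Longrightarrow> head E e \<in> H"
    and saturated: "\<lbrakk>v \<in> regular_verts E; \<And>e. e \<in> out_arcs E v \<Longrightarrow> head E e \<in> H\<rbrakk> \<Longrightarrow> v \<in> H"
begin

abbreviation "D \<equiv> breaking_verts E H - S"
abbreviation "E' \<equiv> quotient_graph E H S"

lemma quotient_simps [simp]:
  "Orig v \<in> verts E' \<longleftrightarrow> v \<in> verts E \<and> v \<notin> H" "Prime v \<in> verts E' \<longleftrightarrow> v \<in> D"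
  "Orig e \<in> arcs E' \<longleftrightarrow> e \<in> arcs E \<and> head E e \<notin> H" "Prime e \<in> arcs E' \<longleftrightarrow> e \<in> arcs E \<and> head E e \<in> D"
  "tail E' x = Orig (tail E (untag x))"
  "head E' (Orig e) = Orig (head E e)" "head E' (Prime e) = Prime (head E e)"
  by (auto simp: quotient_graph_def split: tagged.splits; cases x; auto)+

lemma D_facts: "v \<in> D \<Longrightarrow> v \<in> verts E" "v \<in> D \<Longrightarrow> v \<notin> H" "v \<in> D \<Longrightarrow> v \<notin> regular_verts E"
  by (auto simp: breaking_verts_def infinite_emitters_def regular_verts_def)

lemma wf_quotient: "wf_digraph E'"
proof unfold_locales
  fix x assume x: "x \<in> arcs E'"
  show "tail E' x \<in> verts E'"
    using x hereditary D_facts(2) by (cases x) auto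
  show "head E' x \<in> verts E'"
    using x by (cases x) auto
qed

sublocale target: leavitt K E'
  by (intro leavitt.intro wf_quotient is_cring)

text \<open>
  A mixed product of an unmarked and a marked copy vanishes because sources or ranges differ,
  unless its factors are a marked edge or ghost and the unmarked vertex at which that edge starts;
  there the vertex acts as an identity. So every relation for the sums reduces to relations in the
  quotient graph. For the sum at a regular vertex $v$ outside $H$, the copies of the edges leaving $v$ are exactly
  the edges leaving the unmarked copy of $v$, and saturation keeps that vertex regular; for $v$
  in $H$ heredity makes all terms vanish.
\<close>

lemma leavitt_family_quotient:
  assumes "leavitt_family A E' f"
  shows "leavitt_family A E
    (\<lambda>g. leavitt_family.h0 A E' f (orig_gen g) \<oplus>\<^bsub>A\<^esub> leavitt_family.h0 A E' f (prime_gen g))"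
proof -
  interpret f: leavitt_family A E' f by fact
  note rel = f.h0_vtx_vtx f.h0_vtx_edge f.h0_edge_vtx f.h0_vtx_ghost f.h0_ghost_vtx f.h0_ghost_edge
    f.h0_edge_ghost
  have dead: "x \<notin> verts E' \<Longrightarrow> f.h0 (Vtx x) = \<zero>\<^bsub>A\<^esub>" for x
    by (simp add: f.h0_def)
  show ?thesis
  proof unfold_locales
    fix v assume v: "v \<in> regular_verts E"
    let ?T = "\<lambda>x. f.h0 (Edge x) \<otimes>\<^bsub>A\<^esub> f.h0 (Ghost x)" and ?O = "out_arcs E v"
    have fin: "finite ?O" using v by (simp add: regular_verts_def)
    have "(\<Oplus>\<^bsub>A\<^esub>e\<in>?O. (f.h0 (orig_gen (Edge e)) \<oplus>\<^bsub>A\<^esub> f.h0 (prime_gen (Edge e))) \<otimes>\<^bsub>A\<^esub>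
        (f.h0 (orig_gen (Ghost e)) \<oplus>\<^bsub>A\<^esub> f.h0 (prime_gen (Ghost e)))) =
      (\<Oplus>\<^bsub>A\<^esub>e\<in>?O. ?T (Orig e) \<oplus>\<^bsub>A\<^esub> ?T (Prime e))"
      by (rule f.finsum_cong') (auto simp: f.l_distr f.r_distr rel)
    also have "\<dots> = (\<Oplus>\<^bsub>A\<^esub>e\<in>?O. ?T (Orig e)) \<oplus>\<^bsub>A\<^esub> (\<Oplus>\<^bsub>A\<^esub>e\<in>?O. ?T (Prime e))"
      by (rule f.finsum_addf) auto
    also have "\<dots> = (\<Oplus>\<^bsub>A\<^esub>x\<in>Orig ` ?O. ?T x) \<oplus>\<^bsub>A\<^esub> (\<Oplus>\<^bsub>A\<^esub>x\<in>Prime ` ?O. ?T x)"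
      by (subst (1 2) f.finsum_reindex) (auto simp: inj_on_def)
    also have "\<dots> = (\<Oplus>\<^bsub>A\<^esub>x\<in>Orig ` ?O \<union> Prime ` ?O. ?T x)"
      using fin by (subst f.finsum_Un_disjoint) auto
    also have "\<dots> = f.h0 (Vtx (Orig v))"
    proof (cases "v \<in> H")
      case True
      have "?T x = \<zero>\<^bsub>A\<^esub>" if "x \<in> Orig ` ?O \<union> Prime ` ?O" for x
      proof -
        from that obtain e where e: "e \<in> ?O" "x = Orig e \<or> x = Prime e" by blast
        then have "head E e \<in> H" using True hereditary[of e] by auto
        moreover from this have "head E e \<notin> D" using D_facts(2) by blast
        ultimately show ?thesis using e by (auto simp: f.h0_def)
      qed
      then have "(\<Oplus>\<^bsub>A\<^esub>x\<in>Orig ` ?O \<union> Prime ` ?O. ?T x) = (\<Oplus>\<^bsub>A\<^esub>x\<in>Orig ` ?O \<union> Prime ` ?O. \<zero>\<^bsub>A\<^esub>)"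
        by (intro f.finsum_cong') auto
      then show ?thesis using True by (simp add: dead)
    next
      case False
      have out: "x \<in> out_arcs E' (Orig v) \<longleftrightarrow> x \<in> arcs E' \<and> x \<in> Orig ` ?O \<union> Prime ` ?O" for x
        by (cases x) auto
      have reg: "Orig v \<in> regular_verts E'"
      proof -
        obtain e where "e \<in> ?O" "head E e \<notin> H"
          using saturated[OF v] False by blast
        then have "Orig e \<in> out_arcs E' (Orig v)" by auto
        moreover have "finite (out_arcs E' (Orig v))"
          by (rule finite_subset[of _ "Orig ` ?O \<union> Prime ` ?O"]) (use fin out in auto)
        ultimately show ?thesis
          using v False by (auto simp: regular_verts_def simp del: in_out_arcs_conv)
      qed
      have "(\<Oplus>\<^bsub>A\<^esub>x\<in>Orig ` ?O \<union> Prime ` ?O. ?T x) = (\<Oplus>\<^bsub>A\<^esub>x\<in>out_arcs E' (Orig v). ?T x)"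
        using fin out by (intro f.add.finprod_mono_neutral_cong_right) (auto simp: f.h0_def)
      also have "\<dots> = (\<Oplus>\<^bsub>A\<^esub>x\<in>out_arcs E' (Orig v). f (Edge x) \<otimes>\<^bsub>A\<^esub> f (Ghost x))"
        by (intro f.finsum_cong') (auto simp: f.h0_def)
      also have "\<dots> = f.h0 (Vtx (Orig v))"
        using f.vtx_sum[OF reg] reg by (simp add: f.h0_def regular_verts_def)
      finally show ?thesis .
    qed
    also have "\<dots> = f.h0 (orig_gen (Vtx v)) \<oplus>\<^bsub>A\<^esub> f.h0 (prime_gen (Vtx v))"
      using dead[of "Prime v"] v D_facts(3)[of v] by auto
    finally show "f.h0 (orig_gen (Vtx v)) \<oplus>\<^bsub>A\<^esub> f.h0 (prime_gen (Vtx v)) =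
      (\<Oplus>\<^bsub>A\<^esub>e\<in>?O. (f.h0 (orig_gen (Edge e)) \<oplus>\<^bsub>A\<^esub> f.h0 (prime_gen (Edge e))) \<otimes>\<^bsub>A\<^esub>
        (f.h0 (orig_gen (Ghost e)) \<oplus>\<^bsub>A\<^esub> f.h0 (prime_gen (Ghost e))))" ..
  next
    fix e assume "e \<in> arcs E"
    then show "(f.h0 (orig_gen (Ghost e)) \<oplus>\<^bsub>A\<^esub> f.h0 (prime_gen (Ghost e))) \<otimes>\<^bsub>A\<^esub>
        (f.h0 (orig_gen (Edge e)) \<oplus>\<^bsub>A\<^esub> f.h0 (prime_gen (Edge e))) =
      f.h0 (orig_gen (Vtx (head E e))) \<oplus>\<^bsub>A\<^esub> f.h0 (prime_gen (Vtx (head E e)))"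
      by (simp add: f.l_distr f.r_distr rel dead)
  qed (simp_all add: f.l_distr f.r_distr rel)
qed

definition tagged_act ::
  "('v, 'e) lpa_gen \<Rightarrow> 'v tagged \<times> 'e tagged list \<Rightarrow> ('v tagged \<times> 'e tagged list) option" where
  "tagged_act g b = (case finite_path_act E' (orig_gen g) b of
     None \<Rightarrow> finite_path_act E' (prime_gen g) b | Some b' \<Rightarrow> Some b')"

lemma tagged_act_simps:
  "tagged_act (Vtx v) b = (if v = untag (fst b) then Some b else None)"
  "tagged_act (Edge e) (Orig u, p) = (if head E e = u then Some (Orig (tail E e), Orig e # p) else None)"
  "tagged_act (Edge e) (Prime u, p) = (if head E e = u then Some (Orig (tail E e), Prime e # p) else None)"
  "tagged_act (Ghost e) (y, []) = None"
  "tagged_act (Ghost e) (y, x # p) = (if untag x = e then Some (head E' x, p) else None)"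
  by (cases "fst b"; cases x; auto simp: tagged_act_def finite_path_act_def)+

text \<open>
  The two copies of a generator differ in the source or in the first edge of the paths on which
  they act. Their sum therefore still acts by a partial map of paths.
\<close>

lemma tagged_act_cases:
  "finite_path_act E' (orig_gen g) b = None \<or> finite_path_act E' (prime_gen g) b = None"
  by (cases g; cases "fst b") (auto simp: finite_path_act_def split: list.split)

context
  fixes z assumes z: "z \<in> sinks E'"
begin

abbreviation "paths_to \<equiv> {(u, p). pre_digraph.awalk E' u p z}"

interpretation fin: path_action E' paths_to "finite_path_act E'" fst
  by (rule path_action_finite_paths[OF wf_quotient z])

interpretation fin: basis_action K E' paths_to "finite_path_act E'" fst
  by unfold_locales

text \<open>
  Erasing the marks turns paths in the quotient graph that end in the sink \<open>z\<close> into a path space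
  for $E$. The path of length $0$ obeys the condition on regular sources because a sink of the
  quotient graph never comes from a regular vertex: unmarked ones keep an edge by saturation, and
  marked ones are infinite emitters.
\<close>

lemma path_action_tagged: "path_action E paths_to tagged_act (\<lambda>b. untag (fst b))"
proof unfold_locales
  fix g b b' assume *: "g \<in> lpa_gens E" "b \<in> paths_to" "tagged_act g b = Some b'"
  obtain u p where b: "b = (u, p)" by fastforce
  have u: "u \<in> verts E'" using *(2) b by (auto simp: target.awalk_hd_in_verts)
  show "b' \<in> paths_to"
    using * u unfolding b
    by (cases g; cases u; cases p)
      (auto simp: tagged_act_simps target.awalk_Cons_iff lpa_gens_def split: if_splits)
next
  fix b assume "b \<in> paths_to"
  then have "fst b \<in> verts E'" by (auto simp: target.awalk_hd_in_verts)
  then show "untag (fst b) \<in> verts E"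
    using D_facts(1) by (cases "fst b") auto
next
  fix e and b b' :: "'v tagged \<times> 'e tagged list"
  assume e: "e \<in> arcs E" and b: "b \<in> paths_to" "b' \<in> paths_to"
  obtain u p where 1: "b = (u, p)" by fastforce
  obtain u' p' where 2: "b' = (u', p')" by fastforce
  show "(tagged_act (Edge e) b = Some b') = (tagged_act (Ghost e) b' = Some b)"
    using b unfolding 1 2
    by (cases u; cases p'; cases "hd p'") (auto simp: tagged_act_simps target.awalk_Cons_iff split: if_splits)
next
  fix e b assume "e \<in> arcs E" "b \<in> paths_to"
  then show "(tagged_act (Edge e) b \<noteq> None) = (head E e = untag (fst b))"
    by (cases b; cases "fst b") (auto simp: tagged_act_simps)
next
  fix e b assume "e \<in> arcs E" "b \<in> paths_to" "tagged_act (Ghost e) b \<noteq> None"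
  then show "tail E e = untag (fst b)"
    by (cases b; cases "snd b") (auto simp: tagged_act_simps target.awalk_Cons_iff split: if_splits)
next
  fix e f b assume "tagged_act (Ghost e) b \<noteq> None" "tagged_act (Ghost f) b \<noteq> None"
  then show "e = f"
    by (cases b; cases "snd b") (auto simp: tagged_act_simps split: if_splits)
next
  fix b assume b: "b \<in> paths_to" and reg: "untag (fst b) \<in> regular_verts E"
  obtain u p where up: "b = (u, p)" by fastforce
  have walk: "target.awalk u p z" using b up by simp
  show "\<exists>e\<in>out_arcs E (untag (fst b)). tagged_act (Ghost e) b \<noteq> None"
  proof (cases p)
    case Nil
    then have uz: "u = z" using walk by (auto simp: target.awalk_def)
    show ?thesis
    proof (cases u)
      case (Orig v)
      then have v: "v \<in> regular_verts E" "v \<notin> H"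
        using reg up uz z by (auto simp: sinks_def)
      then obtain e where "e \<in> out_arcs E v" "head E e \<notin> H"
        using saturated by blast
      then have "Orig e \<in> out_arcs E' z"
        using Orig uz by auto
      then show ?thesis using z unfolding sinks_def by blast
    next
      case (Prime v)
      then have "v \<in> D" using uz z by (auto simp: sinks_def)
      then show ?thesis using D_facts(3) reg up Prime by auto
    qed
  next
    case (Cons x xs)
    then have x: "x \<in> arcs E'" "u = Orig (tail E (untag x))"
      using walk by (auto simp: target.awalk_Cons_iff)
    then have "untag x \<in> arcs E" by (cases x) auto
    with x Cons show ?thesis
      unfolding up by (intro bexI[of _ "untag x"]) (auto simp: tagged_act_simps)
  qed
qed (auto simp: tagged_act_simps)

lemma gen_act_tagged:
  assumes k: "k \<in> carrier K" and m: "m \<in> fin_supp K paths_to"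
  shows "gen_act K paths_to tagged_act k g m b =
    gen_act K paths_to (finite_path_act E') k (orig_gen g) m b \<oplus>
    gen_act K paths_to (finite_path_act E') k (prime_gen g) m b"
proof -
  have star: "lpa_star (map_lpa_gen f f' g) = map_lpa_gen f f' (lpa_star g)" for f f'
    by (cases g) auto
  have "m x \<in> carrier K" for x using m by (rule fin_suppD)
  then show ?thesis
    using k tagged_act_cases[of "lpa_star g" b]
    by (auto simp: gen_act_def star tagged_act_def split: option.split)
qed

lemma gen_act_no_gen:
  assumes "g \<in> lpa_gens E" "g' = orig_gen g \<or> g' = prime_gen g" "g' \<notin> lpa_gens E'"
  shows "gen_act K paths_to (finite_path_act E') k g' m = (\<lambda>_. \<zero>)"
proof -
  have "finite_path_act E' (lpa_star g') b = None" if b: "b \<in> paths_to" for b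
  proof -
    obtain u p where up: "b = (u, p)" by fastforce
    have "target.awalk u p z" using b up by simp
    moreover have "u \<in> verts E'" using calculation by (rule target.awalk_hd_in_verts)
    ultimately show ?thesis
      using assms unfolding up
      by (cases g; cases p) (auto simp: finite_path_act_def target.awalk_Cons_iff)
  qed
  then show ?thesis
    by (auto simp: gen_act_def)
qed

lemma quotient_hom_smult:
  assumes k: "k \<in> carrier K" and g: "g \<in> lpa_gens E" and m: "m \<in> fin_supp K paths_to"
  shows "quotient_hom K E H S (scaled_gen K E k g) \<odot>\<^bsub>chen_sink K E' z\<^esub> m =
    gen_act K paths_to tagged_act k g m"
proof -
  let ?G = "scaled_gen K E' \<one>"
  interpret G: leavitt_family target.Q E' ?G
    using target.leavitt_family_rescaled[of "\<lambda>_. \<one>"] by simp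
  let ?L = "\<lambda>g. G.h0 (orig_gen g) \<oplus>\<^bsub>target.Q\<^esub> G.h0 (prime_gen g)"
  let ?h = "\<lambda>x. case x of
         Vtx u \<Rightarrow> if u \<in> H then \<zero>\<^bsub>lpa K E'\<^esub>
                  else if u \<in> D then lpa_elt K E' (Vtx (Orig u)) \<oplus>\<^bsub>lpa K E'\<^esub> lpa_elt K E' (Vtx (Prime u))
                  else lpa_elt K E' (Vtx (Orig u))
       | Edge e \<Rightarrow> if head E e \<in> H then \<zero>\<^bsub>lpa K E'\<^esub>
                  else if head E e \<in> D then lpa_elt K E' (Edge (Orig e)) \<oplus>\<^bsub>lpa K E'\<^esub> lpa_elt K E' (Edge (Prime e))
                  else lpa_elt K E' (Edge (Orig e))
       | Ghost e \<Rightarrow> if head E e \<in> H then \<zero>\<^bsub>lpa K E'\<^esub>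
                  else if head E e \<in> D then lpa_elt K E' (Ghost (Orig e)) \<oplus>\<^bsub>lpa K E'\<^esub> lpa_elt K E' (Ghost (Prime e))
                  else lpa_elt K E' (Ghost (Orig e))"
  have hL: "?h g = ?L g" if "g \<in> lpa_gens E" for g
    using that D_facts(2) by (cases g) (auto simp: G.h0_def target.lpa_elt_eq)
  interpret L: leavitt_family target.Q E ?L
    by (rule leavitt_family_quotient) (rule G.leavitt_family_axioms)
  interpret T: abelian_monoid "lpa K E'" by (rule target.lpa_abelian_monoid)
  \<comment> \<open>A copy that is missing from the quotient graph is represented by \<open>0\<close>.\<close>
  define x where "x g = (if g \<in> lpa_gens E' then single K k [g] else (\<lambda>_. \<zero>))" for g
  have x: "x g \<in> carrier target.F" for g
    unfolding x_def using k target.single_closed[of k "[g]"] zero_in_fin_supp[of target.words] by auto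
  have xp: "target.proj (x g) = scalar_coset K E' k \<otimes>\<^bsub>target.Q\<^esub> G.h0 g" for g
    using k target.proj.hom_zero
    by (auto simp: x_def G.h0_def target.scalar_mult_scaled_gen scaled_gen_def[symmetric])
  have G0: "G.h0 g \<in> carrier (lpa K E')" for g
    using target.scaled_gen_in_lpa[of \<one> g] T.zero_closed
    by (simp add: G.h0_def del: target.lpa_simps(1))
  have Lc: "?L g \<in> carrier (lpa K E')" for g
    using T.a_closed[OF G0 G0] by (simp del: target.lpa_simps(1))
  have comm: "scalar_coset K E' l \<otimes>\<^bsub>target.Q\<^esub> G.h0 g = G.h0 g \<otimes>\<^bsub>target.Q\<^esub> scalar_coset K E' l"
    if "l \<in> carrier K" for l g
    using that by (simp add: G.h0_def target.scalar_mult_scaled_gen target.scaled_gen_mult_scalar)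
  have "quotient_hom K E H S (scaled_gen K E k g) = lpa_hom K (pullback (lpa K E') (\<lambda>k. k)) ?h (scaled_gen K E k g)"
    unfolding quotient_hom_def Let_def pullback_id ..
  also have "\<dots> = scalar_coset K E' k \<otimes>\<^bsub>target.Q\<^esub> ?h g"
  proof (rule lpa_hom_scaled_gen[OF leavitt_axioms target.leavitt_axioms _ _ _ _ k g])
    show "(\<lambda>k. k) \<in> ring_hom K K" by (simp add: ring_hom_def)
    show "leavitt_family target.Q E ?h"
      by (rule L.leavitt_family_cong) (rule hL)
  next
    fix g assume g: "g \<in> lpa_gens E"
    show "?h g \<in> carrier (lpa K E')" unfolding hL[OF g] by (rule Lc)
    fix l assume "l \<in> carrier K"
    then show "scalar_coset K E' l \<otimes>\<^bsub>target.Q\<^esub> ?h g = ?h g \<otimes>\<^bsub>target.Q\<^esub> scalar_coset K E' l"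
      unfolding hL[OF g] by (simp add: target.quot.l_distr target.quot.r_distr comm)
  qed
  also have "\<dots> = target.proj (x (orig_gen g) \<oplus>\<^bsub>target.F\<^esub> x (prime_gen g))"
    unfolding hL[OF g] target.proj.hom_add[OF x x] xp using k by (simp add: target.quot.r_distr)
  finally have q: "quotient_hom K E H S (scaled_gen K E k g) =
    target.proj (x (orig_gen g) \<oplus>\<^bsub>target.F\<^esub> x (prime_gen g))" .
  have part: "fin.ext (x g') m = gen_act K paths_to (finite_path_act E') k g' m"
    if "g' = orig_gen g \<or> g' = prime_gen g" for g'
  proof (cases "g' \<in> lpa_gens E'")
    case True
    then have "x g' = single K k [g']" by (simp add: x_def)
    then show ?thesis
      using fin.basis_module_smult_proj[OF x m, of g'] fin.basis_module_smult_scaled_gen[OF k True m]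
      by (simp add: scaled_gen_def)
  next
    case False
    then show ?thesis using gen_act_no_gen[OF g that False] by (simp add: x_def)
  qed
  have "quotient_hom K E H S (scaled_gen K E k g) \<odot>\<^bsub>chen_sink K E' z\<^esub> m =
      fin.ext (x (orig_gen g) \<oplus>\<^bsub>target.F\<^esub> x (prime_gen g)) m"
    unfolding q chen_sink_def using fin.basis_module_smult_proj[OF target.free.a_closed[OF x x] m] .
  also have "\<dots> = gen_act K paths_to tagged_act k g m"
    unfolding fin.ext_add_left[OF x x m] by (auto simp: part gen_act_tagged[OF k m])
  finally show ?thesis .
qed

lemma path_module_quotient:
  assumes "\<one> \<noteq> \<zero>"
  shows "path_module K E K paths_to tagged_act (\<lambda>b. untag (fst b)) (\<lambda>k. k) (\<lambda>_. \<one>)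
    (pullback (chen_sink K E' z) (quotient_hom K E H S))"
  using assms quotient_hom_smult
  by (intro path_module.intro path_module_axioms.intro leavitt_axioms is_cring path_action_tagged)
    (auto simp: ring_hom_def chen_sink_def basis_module_def)

end

end

subsection \<open>The complement of the ancestors of an infinite emitter\<close>

text \<open>
  If all edges leaving a regular vertex $w$ lead to vertices that cannot reach $v$, then $w$
  cannot reach $v$ either. The path of length $0$ is the only exception, and it does not occur
  because $v$ is an infinite emitter.
\<close>

lemma (in leavitt) graph_quotient_non_ancestors:
  assumes "v \<in> infinite_emitters E"
  shows "graph_quotient K E (non_ancestors E v)"
proof unfold_locales
  fix e assume "e \<in> arcs E" "tail E e \<in> non_ancestors E v"
  then show "head E e \<in> non_ancestors E v"
    using awalk_ConsI[of "head E e" _ v e] by (auto simp: non_ancestors_def ancestors_def reachable_awalk arc_to_ends_def)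
next
  fix w assume w: "w \<in> regular_verts E" and out: "\<And>e. e \<in> out_arcs E w \<Longrightarrow> head E e \<in> non_ancestors E v"
  have "\<not> w \<rightarrow>\<^sup>*\<^bsub>E\<^esub> v"
  proof
    assume "w \<rightarrow>\<^sup>*\<^bsub>E\<^esub> v"
    then obtain p where p: "awalk w p v" by (auto simp: reachable_awalk)
    have "w \<noteq> v" using w assms by (auto simp: regular_verts_def infinite_emitters_def)
    with p obtain e es where "e \<in> out_arcs E w" "awalk (head E e) es v"
      by (cases p) (auto simp: awalk_Cons_iff awalk_def)
    then show False
      using out by (auto simp: non_ancestors_def ancestors_def reachable_awalk)
  qed
  then show "w \<in> non_ancestors E v"
    using w by (auto simp: non_ancestors_def ancestors_def regular_verts_def)
qed

section \<open>Invariants of isomorphism\<close>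

context path_module
begin

lemma smult_closed:
  assumes "k \<in> carrier K" "g \<in> lpa_gens E" "m \<in> fin_supp K' B"
  shows "scaled_gen K E k g \<odot>\<^bsub>M\<^esub> m \<in> fin_supp K' B"
  unfolding smult_M[OF assms]
proof (rule coeff.fin_suppI)
  let ?n = "gen_act K' B act (j k \<otimes> wt g) g m"
  have c: "j k \<in> carrier K'" "m b \<in> carrier K'" for b
    using assms ring_hom_closed[OF j_hom] by (auto dest: coeff.fin_suppD)
  show "?n b \<in> carrier K'" for b
    using assms c by (auto simp: gen_act_def split: option.split)
  show "?n b = \<zero>" if "b \<notin> B" for b
    using that by (simp add: gen_act_def)
  \<comment> \<open>The support of the image is the image of the support, since \<open>g\<close> acts injectively.\<close>
  have "{b. ?n b \<noteq> \<zero>} \<subseteq> (\<lambda>b'. the (act g b')) ` {b. m b \<noteq> \<zero>}"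
  proof
    fix b assume "b \<in> {b. ?n b \<noteq> \<zero>}"
    then obtain b' where b: "b \<in> B" "act (lpa_star g) b = Some b'" "(j k \<otimes> wt g) \<otimes> m b' \<noteq> \<zero>"
      by (auto simp: gen_act_def split: if_splits option.splits)
    then have "b' \<in> B" using act_closed[OF star_gen[OF assms(2)]] by blast
    then have "act g b' = Some b" using act_star[OF assms(2), of b' b] b by blast
    moreover have "m b' \<noteq> \<zero>" using b(3) assms c by auto
    ultimately show "b \<in> (\<lambda>b'. the (act g b')) ` {b. m b \<noteq> \<zero>}" by force
  qed
  then show "finite {b. ?n b \<noteq> \<zero>}"
    using finite_subset[OF _ finite_imageI[OF coeff.fin_suppD(2)[OF assms(3)]]] by blast
qed

lemma add_closed: "\<lbrakk>m \<in> fin_supp K' B; n \<in> fin_supp K' B\<rbrakk> \<Longrightarrow> m \<oplus>\<^bsub>M\<^esub> n \<in> fin_supp K' B"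
  unfolding add_M by (rule coeff.add_in_fin_supp)

text \<open>
  A description of the zero vector by addition alone, so that additive bijections respect it.
\<close>

lemma double_eq_self_iff:
  assumes "m \<in> fin_supp K' B"
  shows "m \<oplus>\<^bsub>M\<^esub> m = m \<longleftrightarrow> m = (\<lambda>_. \<zero>)"
proof -
  have "m b \<oplus> m b = m b \<longleftrightarrow> m b = \<zero>" for b
    using coeff.fin_suppD(1)[OF assms] by simp
  then show ?thesis by (simp add: add_M fun_eq_iff)
qed

lemma gen_smult:
  assumes "g \<in> lpa_gens E" "m \<in> fin_supp K' B"
  shows "scaled_gen K E \<one>\<^bsub>K\<^esub> g \<odot>\<^bsub>M\<^esub> m = gen_act K' B act (wt g) g m"
  using assms ring_hom_one[OF j_hom] by (simp add: smult_M)

lemma vtx_smult: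
  assumes "k \<in> carrier K" "v \<in> verts E" "m \<in> fin_supp K' B"
  shows "scaled_gen K E k (Vtx v) \<odot>\<^bsub>M\<^esub> m = (\<lambda>b. if b \<in> B \<and> src b = v then j k \<otimes> m b else \<zero>)"
  using assms ring_hom_closed[OF j_hom] coeff.fin_suppD[OF assms(3)]
  by (auto simp: smult_M gen_act_def act_vtx wt_vtx fun_eq_iff)

lemma wt_cancel:
  assumes "e \<in> arcs E" "y \<in> carrier K'"
  shows "wt (Edge e) \<otimes> (wt (Ghost e) \<otimes> y) = y"
  using assms wt_edge_ghost[OF assms(1)] by (simp add: coeff.m_assoc[symmetric])

end

text \<open>
  Vanishing of $n$ is written as $n + n = n$, so that nothing but addition and the action enters
  and the notion is visibly invariant under isomorphism.
\<close>

definition ghost_killed_vertex :: "('k, 'r) ring_scheme \<Rightarrow> ('v, 'e) pre_digraph \<Rightarrow>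
    ((('v, 'e) lpa_gen list \<Rightarrow> 'k) set, 'm) module \<Rightarrow> 'v \<Rightarrow> bool" where
  "ghost_killed_vertex K E M v \<longleftrightarrow> v \<in> verts E \<and> (\<exists>m \<in> carrier M. m \<oplus>\<^bsub>M\<^esub> m \<noteq> m \<and>
     scaled_gen K E \<one>\<^bsub>K\<^esub> (Vtx v) \<odot>\<^bsub>M\<^esub> m = m \<and>
     (\<forall>e \<in> out_arcs E v. let n = scaled_gen K E \<one>\<^bsub>K\<^esub> (Ghost e) \<odot>\<^bsub>M\<^esub> m in n \<oplus>\<^bsub>M\<^esub> n = n))"

text \<open>
  If $m$ is killed by the ghosts, pick a basis path $b$ in its support. A ghost that could
  shorten $b$ would carry the coefficient at $b$, times a unit, to the shortened path, and no other
  path contributes there.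
\<close>

lemma (in path_module) ghost_killed_vertex_iff:
  "ghost_killed_vertex K E M v \<longleftrightarrow>
    (\<exists>b \<in> B. src b = v \<and> (\<forall>e \<in> out_arcs E v. act (Ghost e) b = None))"
proof
  assume "ghost_killed_vertex K E M v"
  then obtain m where v: "v \<in> verts E" and m: "m \<in> fin_supp K' B" "m \<oplus>\<^bsub>M\<^esub> m \<noteq> m"
    and mv: "scaled_gen K E \<one>\<^bsub>K\<^esub> (Vtx v) \<odot>\<^bsub>M\<^esub> m = m"
    and me: "\<And>e. e \<in> out_arcs E v \<Longrightarrow> scaled_gen K E \<one>\<^bsub>K\<^esub> (Ghost e) \<odot>\<^bsub>M\<^esub> m \<oplus>\<^bsub>M\<^esub>
      scaled_gen K E \<one>\<^bsub>K\<^esub> (Ghost e) \<odot>\<^bsub>M\<^esub> m = scaled_gen K E \<one>\<^bsub>K\<^esub> (Ghost e) \<odot>\<^bsub>M\<^esub> m"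
    by (auto simp: ghost_killed_vertex_def carrier_M Let_def)
  from m obtain b where b: "m b \<noteq> \<zero>"
    by (auto simp: double_eq_self_iff)
  have bB: "b \<in> B" using m(1) b by (rule coeff.fin_suppD)
  have "src b = v"
  proof (rule ccontr)
    assume "src b \<noteq> v"
    then have "(scaled_gen K E \<one>\<^bsub>K\<^esub> (Vtx v) \<odot>\<^bsub>M\<^esub> m) b = \<zero>"
      using v m by (simp add: vtx_smult)
    then show False using mv b by simp
  qed
  moreover have "act (Ghost e) b = None" if e: "e \<in> out_arcs E v" for e
  proof (rule ccontr)
    have ea: "e \<in> arcs E" using e by simp
    assume "act (Ghost e) b \<noteq> None"
    then obtain b' where b': "act (Ghost e) b = Some b'" by blast
    then have "b' \<in> B" using act_closed[of "Ghost e" b b'] bB ea by simp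
    then have eb': "act (Edge e) b' = Some b" using act_edge_ghost[OF ea, of b' b] bB b' by blast
    have "scaled_gen K E \<one>\<^bsub>K\<^esub> (Ghost e) \<odot>\<^bsub>M\<^esub> m = (\<lambda>_. \<zero>)"
      using me[OF e] double_eq_self_iff[OF smult_closed[OF _ _ m(1), of "\<one>\<^bsub>K\<^esub>" "Ghost e"]] ea by simp
    then have "gen_act K' B act (wt (Ghost e)) (Ghost e) m b' = \<zero>"
      using gen_smult[of "Ghost e" m] ea m(1) by simp
    then have "wt (Ghost e) \<otimes> m b = \<zero>"
      using \<open>b' \<in> B\<close> eb' by (simp add: gen_act_def)
    then have "m b = \<zero>"
      using wt_cancel[OF ea coeff.fin_suppD(1)[OF m(1)], of b] ea by simp
    with b show False by simp
  qed
  ultimately show "\<exists>b \<in> B. src b = v \<and> (\<forall>e \<in> out_arcs E v. act (Ghost e) b = None)"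
    using bB by blast
next
  assume "\<exists>b \<in> B. src b = v \<and> (\<forall>e \<in> out_arcs E v. act (Ghost e) b = None)"
  then obtain b where b: "b \<in> B" "src b = v" and dead: "\<And>e. e \<in> out_arcs E v \<Longrightarrow> act (Ghost e) b = None"
    by blast
  have v: "v \<in> verts E" using src_vert b by blast
  let ?m = "single K' \<one> b"
  have m: "?m \<in> fin_supp K' B" using b by (simp add: coeff.single_in_fin_supp)
  have "?m \<oplus>\<^bsub>M\<^esub> ?m \<noteq> ?m"
    unfolding double_eq_self_iff[OF m] using nontrivial by (auto simp: single_def fun_eq_iff)
  moreover have "scaled_gen K E \<one>\<^bsub>K\<^esub> (Vtx v) \<odot>\<^bsub>M\<^esub> ?m = ?m"
    unfolding vtx_smult[OF one_closed v m] using b ring_hom_one[OF j_hom]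
    by (auto simp: single_def fun_eq_iff)
  moreover have "scaled_gen K E \<one>\<^bsub>K\<^esub> (Ghost e) \<odot>\<^bsub>M\<^esub> ?m = (\<lambda>_. \<zero>)" if e: "e \<in> out_arcs E v" for e
  proof -
    have ea: "e \<in> arcs E" using e by simp
    have "act (Edge e) b' \<noteq> Some b" if "b' \<in> B" for b'
      using act_edge_ghost[OF ea that b(1)] dead[OF e] by simp
    then show ?thesis
      using m ea by (auto simp: gen_smult gen_act_def single_def fun_eq_iff split: option.split)
  qed
  ultimately show "ghost_killed_vertex K E M v"
    unfolding ghost_killed_vertex_def Let_def using v m
    by (auto simp: carrier_M add_M simp del: in_out_arcs_conv intro!: bexI[of _ ?m])
qed

text \<open>
  The operator $e_1\cdots e_n e_n^*\cdots e_1^*$ for the first $n$ edges of \<open>p\<close>.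
\<close>

primrec path_proj :: "('k, 'r) ring_scheme \<Rightarrow> ('v, 'e) pre_digraph \<Rightarrow>
    ((('v, 'e) lpa_gen list \<Rightarrow> 'k) set, 'm) module \<Rightarrow> nat \<Rightarrow> 'e stream \<Rightarrow> 'm \<Rightarrow> 'm" where
  "path_proj K E M 0 p m = m"
| "path_proj K E M (Suc n) p m = scaled_gen K E \<one>\<^bsub>K\<^esub> (Edge (shd p)) \<odot>\<^bsub>M\<^esub>
     path_proj K E M n (stl p) (scaled_gen K E \<one>\<^bsub>K\<^esub> (Ghost (shd p)) \<odot>\<^bsub>M\<^esub> m)"

definition walk_act :: "('k, 'r) ring_scheme \<Rightarrow> ('v, 'e) pre_digraph \<Rightarrow>
    ((('v, 'e) lpa_gen list \<Rightarrow> 'k) set, 'm) module \<Rightarrow> 'e list \<Rightarrow> 'm \<Rightarrow> 'm" where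
  "walk_act K E M = foldr (\<lambda>e m. scaled_gen K E \<one>\<^bsub>K\<^esub> (Edge e) \<odot>\<^bsub>M\<^esub> m)"

text \<open>
  Horner's scheme for the action of a polynomial in the closed path \<open>c\<close>, with \<open>v\<close> as the unit.
  The coefficients are listed from the constant term upwards.
\<close>

primrec poly_act :: "('k, 'r) ring_scheme \<Rightarrow> ('v, 'e) pre_digraph \<Rightarrow>
    ((('v, 'e) lpa_gen list \<Rightarrow> 'k) set, 'm) module \<Rightarrow> 'v \<Rightarrow> 'e list \<Rightarrow> 'k list \<Rightarrow> 'm \<Rightarrow> 'm" where
  "poly_act K E M v c [] m = scaled_gen K E \<zero>\<^bsub>K\<^esub> (Vtx v) \<odot>\<^bsub>M\<^esub> m"
| "poly_act K E M v c (a # as) m =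
     scaled_gen K E a (Vtx v) \<odot>\<^bsub>M\<^esub> m \<oplus>\<^bsub>M\<^esub> walk_act K E M c (poly_act K E M v c as m)"

context path_module
begin

lemma path_proj_closed:
  "\<lbrakk>sset p \<subseteq> arcs E; m \<in> fin_supp K' B\<rbrakk> \<Longrightarrow> path_proj K E M n p m \<in> fin_supp K' B"
proof (induction n arbitrary: p m)
  case (Suc n)
  have "shd p \<in> arcs E" "sset (stl p) \<subseteq> arcs E"
    using Suc.prems(1) by (cases p; auto)+
  then show ?case
    using smult_closed[OF _ _ Suc.IH[OF _ smult_closed[OF _ _ Suc.prems(2)]]] by simp
qed simp

lemma walk_act_closed:
  "\<lbrakk>set c \<subseteq> arcs E; m \<in> fin_supp K' B\<rbrakk> \<Longrightarrow> walk_act K E M c m \<in> fin_supp K' B"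
  by (induction c) (auto simp: walk_act_def intro!: smult_closed)

lemma poly_act_closed:
  "\<lbrakk>set c \<subseteq> arcs E; v \<in> verts E; set as \<subseteq> carrier K; m \<in> fin_supp K' B\<rbrakk> \<Longrightarrow>
    poly_act K E M v c as m \<in> fin_supp K' B"
  by (induction as) (auto intro!: smult_closed add_closed walk_act_closed)

end

locale path_module_iso =
  M: path_module K E K1 B1 act1 src1 j1 wt1 M + N: path_module K E K2 B2 act2 src2 j2 wt2 N
  for K :: "('k, 'r) ring_scheme" and E :: "('v, 'e) pre_digraph"
    and K1 B1 act1 src1 j1 wt1 M K2 B2 act2 src2 j2 wt2 N +
  fixes \<phi>
  assumes bij: "bij_betw \<phi> (carrier M) (carrier N)"
    and hom_add: "\<lbrakk>x \<in> carrier M; y \<in> carrier M\<rbrakk> \<Longrightarrow> \<phi> (x \<oplus>\<^bsub>M\<^esub> y) = \<phi> x \<oplus>\<^bsub>N\<^esub> \<phi> y"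
    and hom_smult: "\<lbrakk>a \<in> carrier (lpa K E); x \<in> carrier M\<rbrakk> \<Longrightarrow> \<phi> (a \<odot>\<^bsub>M\<^esub> x) = a \<odot>\<^bsub>N\<^esub> \<phi> x"
begin

lemma hom_closed [simp]: "m \<in> fin_supp K1 B1 \<Longrightarrow> \<phi> m \<in> fin_supp K2 B2"
  using bij by (auto simp: M.carrier_M N.carrier_M bij_betw_def)

lemma inj: "\<lbrakk>m \<in> fin_supp K1 B1; n \<in> fin_supp K1 B1; \<phi> m = \<phi> n\<rbrakk> \<Longrightarrow> m = n"
  using bij by (auto simp: M.carrier_M bij_betw_def inj_on_def)

lemma surj:
  assumes "n \<in> fin_supp K2 B2"
  obtains m where "m \<in> fin_supp K1 B1" "\<phi> m = n"
  using bij assms by (force simp: M.carrier_M N.carrier_M bij_betw_def)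

lemma hom_double:
  "m \<in> fin_supp K1 B1 \<Longrightarrow> \<phi> m \<oplus>\<^bsub>N\<^esub> \<phi> m = \<phi> m \<longleftrightarrow> m \<oplus>\<^bsub>M\<^esub> m = m"
  using hom_add[of m m] inj[of "m \<oplus>\<^bsub>M\<^esub> m" m] M.add_closed[of m m] by (auto simp: M.carrier_M)

lemma hom_zero_iff: "m \<in> fin_supp K1 B1 \<Longrightarrow> \<phi> m = (\<lambda>_. \<zero>\<^bsub>K2\<^esub>) \<longleftrightarrow> m = (\<lambda>_. \<zero>\<^bsub>K1\<^esub>)"
  using hom_double N.double_eq_self_iff M.double_eq_self_iff by simp

lemma hom_gen:
  "\<lbrakk>k \<in> carrier K; g \<in> lpa_gens E; m \<in> fin_supp K1 B1\<rbrakk> \<Longrightarrow>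
    \<phi> (scaled_gen K E k g \<odot>\<^bsub>M\<^esub> m) = scaled_gen K E k g \<odot>\<^bsub>N\<^esub> \<phi> m"
  by (rule hom_smult) (auto simp: M.carrier_M simp del: M.lpa_simps intro: M.scaled_gen_in_lpa)

lemma ghost_killed_vertex_transport:
  assumes "ghost_killed_vertex K E M v"
  shows "ghost_killed_vertex K E N v"
proof -
  from assms obtain m where v: "v \<in> verts E" and m: "m \<in> fin_supp K1 B1" "m \<oplus>\<^bsub>M\<^esub> m \<noteq> m"
    "scaled_gen K E \<one>\<^bsub>K\<^esub> (Vtx v) \<odot>\<^bsub>M\<^esub> m = m"
    and me: "\<And>e. e \<in> out_arcs E v \<Longrightarrow> scaled_gen K E \<one>\<^bsub>K\<^esub> (Ghost e) \<odot>\<^bsub>M\<^esub> m \<oplus>\<^bsub>M\<^esub>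
      scaled_gen K E \<one>\<^bsub>K\<^esub> (Ghost e) \<odot>\<^bsub>M\<^esub> m = scaled_gen K E \<one>\<^bsub>K\<^esub> (Ghost e) \<odot>\<^bsub>M\<^esub> m"
    by (auto simp: ghost_killed_vertex_def M.carrier_M Let_def)
  have "scaled_gen K E \<one>\<^bsub>K\<^esub> (Ghost e) \<odot>\<^bsub>N\<^esub> \<phi> m \<oplus>\<^bsub>N\<^esub> scaled_gen K E \<one>\<^bsub>K\<^esub> (Ghost e) \<odot>\<^bsub>N\<^esub> \<phi> m =
      scaled_gen K E \<one>\<^bsub>K\<^esub> (Ghost e) \<odot>\<^bsub>N\<^esub> \<phi> m" if e: "e \<in> out_arcs E v" for e
  proof -
    have g: "Ghost e \<in> lpa_gens E" using e by simp
    show ?thesis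
      using me[OF e] hom_double[OF M.smult_closed[OF _ g m(1)], of "\<one>\<^bsub>K\<^esub>"] hom_gen[OF _ g m(1), of "\<one>\<^bsub>K\<^esub>"]
      by simp
  qed
  moreover have "scaled_gen K E \<one>\<^bsub>K\<^esub> (Vtx v) \<odot>\<^bsub>N\<^esub> \<phi> m = \<phi> m"
    using hom_gen[of "\<one>\<^bsub>K\<^esub>" "Vtx v" m] v m by simp
  ultimately show ?thesis
    unfolding ghost_killed_vertex_def Let_def using v m hom_double[OF m(1)]
    by (auto simp: N.carrier_M simp del: in_out_arcs_conv intro!: bexI[of _ "\<phi> m"])
qed

lemma hom_path_proj:
  "\<lbrakk>sset p \<subseteq> arcs E; m \<in> fin_supp K1 B1\<rbrakk> \<Longrightarrow> \<phi> (path_proj K E M n p m) = path_proj K E N n p (\<phi> m)"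
proof (induction n arbitrary: p m)
  case (Suc n)
  have p: "shd p \<in> arcs E" "sset (stl p) \<subseteq> arcs E"
    using Suc.prems(1) by (cases p; auto)+
  then show ?case
    using Suc by (simp add: hom_gen M.smult_closed M.path_proj_closed)
qed simp

lemma hom_walk_act:
  "\<lbrakk>set c \<subseteq> arcs E; m \<in> fin_supp K1 B1\<rbrakk> \<Longrightarrow> \<phi> (walk_act K E M c m) = walk_act K E N c (\<phi> m)"
proof (induction c)
  case (Cons e c)
  then show ?case
    using M.walk_act_closed[of c m] by (simp add: walk_act_def hom_gen)
qed (simp add: walk_act_def)

lemma hom_poly_act:
  "\<lbrakk>set c \<subseteq> arcs E; v \<in> verts E; set as \<subseteq> carrier K; m \<in> fin_supp K1 B1\<rbrakk> \<Longrightarrow>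
    \<phi> (poly_act K E M v c as m) = poly_act K E N v c as (\<phi> m)"
proof (induction as)
  case (Cons a as)
  then show ?case
    using M.poly_act_closed[of c v as m]
    by (simp add: hom_add M.carrier_M hom_gen M.smult_closed M.walk_act_closed hom_walk_act)
qed (simp add: hom_gen)

end

lemma not_isoI:
  assumes "path_module K E K1 B1 act1 src1 j1 wt1 M" "path_module K E K2 B2 act2 src2 j2 wt2 N"
    and "\<And>\<phi>. path_module_iso K E K1 B1 act1 src1 j1 wt1 M K2 B2 act2 src2 j2 wt2 N \<phi> \<Longrightarrow> False"
  shows "\<not> left_module_iso (lpa K E) M N"
  using assms unfolding left_module_iso_def path_module_iso_def path_module_iso_axioms_def by blast

subsection \<open>Modules on infinite paths\<close>

lemma tail_equivalent_sym: "tail_equivalent p q \<Longrightarrow> tail_equivalent q p"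
  unfolding tail_equivalent_def by metis

lemma tail_equivalent_trans:
  assumes "tail_equivalent p q" "tail_equivalent q r"
  shows "tail_equivalent p r"
proof -
  from assms obtain m n m' n' where *: "0 < m" "0 < n'" "sdrop m p = sdrop n q" "sdrop m' q = sdrop n' r"
    by (auto simp: tail_equivalent_def)
  have "sdrop (m + m') p = sdrop (n + n') r"
    using * by (metis add.commute sdrop_add)
  then show ?thesis
    using * unfolding tail_equivalent_def by (metis add_gr_0)
qed

lemma tail_class_eq:
  assumes "P \<in> tail_classes E" "p \<in> P"
  shows "P = tail_class E p"
  using assms tail_equivalent_sym tail_equivalent_trans
  unfolding tail_classes_def tail_class_def by blast

lemma stake_eq_imp_eq:
  assumes "\<And>n. stake n p = stake n q"
  shows "p = q"
proof -
  have "p !! i = q !! i" for i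
    using assms[of "Suc i"] by (metis lessI stake_nth)
  then show ?thesis
    by (metis ext stream_smap_nats)
qed

locale infinite_path_module =
  path_module K E K' P "infinite_path_act E" "\<lambda>p. tail E (shd p)" j wt M
  for K :: "('k, 'r) ring_scheme" and E :: "('v, 'e) pre_digraph"
    and K' :: "('k2, 'r2) ring_scheme" (structure) and P j wt M +
  assumes P: "P \<in> tail_classes E"
begin

lemma P_path: "p \<in> P \<Longrightarrow> infinite_path E p"
  using P by (auto simp: tail_classes_def tail_class_def)

lemma P_SCons: "e ## q \<in> P \<longleftrightarrow> e \<in> arcs E \<and> head E e = tail E (shd q) \<and> q \<in> P"
  using P by (auto simp: tail_classes_def tail_class_SCons)

lemma path_proj_eq:
  "\<lbrakk>infinite_path E p; m \<in> fin_supp K' P\<rbrakk> \<Longrightarrow>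
    path_proj K E M n p m = (\<lambda>b. if stake n b = stake n p then m b else \<zero>)"
proof (induction n arbitrary: p m)
  case (Suc n)
  obtain e p' where p: "p = e ## p'" by (cases p)
  then have e: "e \<in> arcs E" and p': "infinite_path E p'"
    using Suc.prems(1) by (auto simp: infinite_path_SCons)
  then have sub: "sset p' \<subseteq> arcs E" by (simp add: infinite_path_def)
  let ?m = "scaled_gen K E \<one>\<^bsub>K\<^esub> (Ghost e) \<odot>\<^bsub>M\<^esub> m"
  have m1: "?m \<in> fin_supp K' P" using e Suc.prems by (intro smult_closed) auto
  let ?n = "gen_act K' P (infinite_path_act E) (wt (Edge e)) (Edge e)
      (\<lambda>b. if stake n b = stake n p' then ?m b else \<zero>)"
  have step: "path_proj K E M (Suc n) p m = ?n"
    using gen_smult[of "Edge e", OF _ path_proj_closed[OF sub m1, of n]] e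
    by (simp add: p Suc.IH[OF p' m1])
  have "?n b = (if stake (Suc n) b = stake (Suc n) p then m b else \<zero>)" for b
  proof (cases "b \<in> P \<and> shd b = e")
    case True
    obtain b' where b: "b = e ## b'" using True by (cases b) auto
    have b': "b' \<in> P" "head E e = tail E (shd b')" using True by (auto simp: b P_SCons)
    then have "?m b' = wt (Ghost e) \<otimes> m b"
      using e Suc.prems by (simp add: gen_smult gen_act_def infinite_path_act_def b)
    then show ?thesis
      using True e wt_cancel[OF e coeff.fin_suppD(1)[OF Suc.prems(2)]]
      by (simp add: gen_act_def infinite_path_act_def b p)
  next
    case False
    then show ?thesis
      using coeff.fin_suppD(3)[OF Suc.prems(2), of b]
      by (cases "m b = \<zero>") (auto simp: gen_act_def infinite_path_act_def p)
  qed
  then show ?case unfolding step by (rule ext)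
qed simp

text \<open>
  A path in the support of a vector fixed for every $n$ shares all finite initial parts with
  \<open>p\<close>, so it equals \<open>p\<close>.
\<close>

lemma path_proj_fixed_iff:
  assumes p: "infinite_path E p" and m: "m \<in> fin_supp K' P"
  shows "(\<forall>n. path_proj K E M n p m = m) \<longleftrightarrow> m = single K' (m p) p"
proof
  assume fixed: "\<forall>n. path_proj K E M n p m = m"
  have "b = p" if "m b \<noteq> \<zero>" for b
  proof (rule stake_eq_imp_eq)
    fix n
    have "m b = (if stake n b = stake n p then m b else \<zero>)"
      using fixed path_proj_eq[OF p m, of n] by (metis (no_types))
    then show "stake n b = stake n p"
      using that by (auto split: if_splits)
  qed
  then show "m = single K' (m p) p"
    by (auto simp: single_def fun_eq_iff)
next
  assume "m = single K' (m p) p"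
  then have "m b = \<zero>" if "b \<noteq> p" for b
    using that by (metis single_def)
  then have "(if stake n b = stake n p then m b else \<zero>) = m b" for n b
    by (cases "b = p") auto
  then show "\<forall>n. path_proj K E M n p m = m"
    by (simp add: path_proj_eq[OF p m])
qed

definition walk_wt :: "'e list \<Rightarrow> 'k2" where
  "walk_wt es = foldr (\<lambda>e y. wt (Edge e) \<otimes> y) es \<one>"

lemma walk_wt_closed [simp]: "set es \<subseteq> arcs E \<Longrightarrow> walk_wt es \<in> carrier K'"
  by (induction es) (auto simp: walk_wt_def)

lemma walk_act_single:
  "\<lbrakk>es @- q \<in> P; y \<in> carrier K'\<rbrakk> \<Longrightarrow>
    walk_act K E M es (single K' y q) = single K' (walk_wt es \<otimes> y) (es @- q) \<and> set es \<subseteq> arcs E \<and> q \<in> P"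
proof (induction es)
  case (Cons e es)
  then have e: "e \<in> arcs E" and tl: "es @- q \<in> P" by (auto simp: P_SCons)
  note IH = Cons.IH[OF tl Cons.prems(2)]
  have c: "walk_wt es \<otimes> y \<in> carrier K'" using IH Cons.prems by simp
  let ?n = "gen_act K' P (infinite_path_act E) (wt (Edge e)) (Edge e) (single K' (walk_wt es \<otimes> y) (es @- q))"
  have step: "walk_act K E M (e # es) (single K' y q) = ?n"
    using IH e gen_smult[OF _ coeff.single_in_fin_supp[OF c tl], of "Edge e"] by (simp add: walk_act_def)
  have "?n b = single K' (walk_wt (e # es) \<otimes> y) ((e # es) @- q) b" for b
    using IH e Cons.prems
    by (cases b) (auto simp: gen_act_def infinite_path_act_def single_def walk_wt_def[of "e # es"]
        walk_wt_def[of es, symmetric] coeff.m_assoc)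
  then have "?n = single K' (walk_wt (e # es) \<otimes> y) ((e # es) @- q)" by (rule ext)
  then show ?case using IH e step by simp
qed (simp add: walk_act_def walk_wt_def)

definition horner :: "'e list \<Rightarrow> 'k list \<Rightarrow> 'k2" where
  "horner c as = foldr (\<lambda>a y. j a \<oplus> walk_wt c \<otimes> y) as \<zero>"

lemma horner_closed [simp]: "\<lbrakk>set c \<subseteq> arcs E; set as \<subseteq> carrier K\<rbrakk> \<Longrightarrow> horner c as \<in> carrier K'"
  using ring_hom_closed[OF j_hom] by (induction as) (auto simp: horner_def)

lemma poly_act_single:
  assumes q: "q \<in> P" "c @- q = q" and y: "y \<in> carrier K'"
  shows "set as \<subseteq> carrier K \<Longrightarrow>
    poly_act K E M (tail E (shd q)) c as (single K' y q) = single K' (horner c as \<otimes> y) q"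
proof (induction as)
  case Nil
  have "tail E (shd q) \<in> verts E" using src_vert q by blast
  then show ?case
    using q y ring_hom_zero[OF j_hom ring_axioms coeff.ring_axioms] coeff.single_in_fin_supp[OF y q(1)]
    by (auto simp: vtx_smult horner_def single_def fun_eq_iff)
next
  case (Cons a as)
  have v: "tail E (shd q) \<in> verts E" using src_vert q by blast
  have c: "set c \<subseteq> arcs E" using walk_act_single[of c q \<zero>] q by simp
  have ja: "j a \<in> carrier K'" using Cons.prems ring_hom_closed[OF j_hom] by simp
  have h: "horner c as \<in> carrier K'" using Cons.prems c by simp
  have "walk_act K E M c (single K' (horner c as \<otimes> y) q) = single K' (walk_wt c \<otimes> (horner c as \<otimes> y)) q"
    using walk_act_single[of c q "horner c as \<otimes> y"] q y h by simp
  moreover have "scaled_gen K E a (Vtx (tail E (shd q))) \<odot>\<^bsub>M\<^esub> single K' y q = single K' (j a \<otimes> y) q"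
    using Cons.prems v q y ja coeff.single_in_fin_supp[OF y q(1)]
    by (auto simp: vtx_smult single_def fun_eq_iff)
  ultimately have "poly_act K E M (tail E (shd q)) c (a # as) (single K' y q) =
      (\<lambda>b. single K' (j a \<otimes> y) q b \<oplus> single K' (walk_wt c \<otimes> (horner c as \<otimes> y)) q b)"
    using Cons by (simp add: add_M)
  also have "\<dots> = single K' (horner c (a # as) \<otimes> y) q"
    using y ja h c
    by (auto simp: single_def fun_eq_iff horner_def[of c "a # as"] horner_def[of c as, symmetric]
        coeff.l_distr coeff.m_assoc)
  finally show ?case .
qed

end

locale infinite_path_module_iso =
  M: infinite_path_module K E K1 P1 j1 wt1 M + N: infinite_path_module K E K2 P2 j2 wt2 N +
  path_module_iso K E K1 P1 "infinite_path_act E" "\<lambda>p. tail E (shd p)" j1 wt1 M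
    K2 P2 "infinite_path_act E" "\<lambda>p. tail E (shd p)" j2 wt2 N \<phi>
  for K :: "('k, 'r) ring_scheme" and E :: "('v, 'e) pre_digraph"
    and K1 P1 j1 wt1 M K2 P2 j2 wt2 N \<phi>
begin

lemma hom_single:
  assumes "p \<in> P1" "y \<in> carrier K1"
  shows "\<phi> (single K1 y p) = single K2 (\<phi> (single K1 y p) p) p"
proof -
  have s: "single K1 y p \<in> fin_supp K1 P1" using assms by (simp add: M.coeff.single_in_fin_supp)
  have p: "infinite_path E p" "sset p \<subseteq> arcs E"
    using M.P_path[OF assms(1)] by (auto simp: infinite_path_def)
  have "\<forall>n. path_proj K E M n p (single K1 y p) = single K1 y p"
    unfolding M.path_proj_fixed_iff[OF p(1) s] by (simp add: single_def)
  then have "\<forall>n. path_proj K E N n p (\<phi> (single K1 y p)) = \<phi> (single K1 y p)"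
    using hom_path_proj[OF p(2) s] by metis
  then show ?thesis
    using N.path_proj_fixed_iff[OF p(1) hom_closed[OF s]] by blast
qed

lemma preimage_single:
  assumes "p \<in> P2" "y \<in> carrier K2" "m \<in> fin_supp K1 P1" "\<phi> m = single K2 y p"
  shows "m = single K1 (m p) p"
proof -
  have s: "single K2 y p \<in> fin_supp K2 P2" using assms by (simp add: N.coeff.single_in_fin_supp)
  have p: "infinite_path E p" "sset p \<subseteq> arcs E"
    using N.P_path[OF assms(1)] by (auto simp: infinite_path_def)
  have "path_proj K E N n p (\<phi> m) = \<phi> m" for n
  proof -
    have "\<forall>n. path_proj K E N n p (single K2 y p) = single K2 y p"
      unfolding N.path_proj_fixed_iff[OF p(1) s] by (simp add: single_def)
    then show ?thesis using assms(4) by simp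
  qed
  then have "path_proj K E M n p m = m" for n
    using hom_path_proj[OF p(2) assms(3), of n] inj[OF M.path_proj_closed[OF p(2) assms(3)] assms(3)]
    by simp
  then show ?thesis
    using M.path_proj_fixed_iff[OF p(1) assms(3)] by blast
qed

text \<open>
  The image of the basis vector \<open>p\<close> is a nonzero multiple of \<open>p\<close>, so \<open>p\<close> occurs in both modules.
\<close>

lemma same_class: "P1 = P2"
proof -
  obtain p where p: "p \<in> P1"
    using M.P unfolding tail_classes_def tail_class_def tail_equivalent_def by blast
  have s: "single K1 \<one>\<^bsub>K1\<^esub> p \<in> fin_supp K1 P1" using p by (simp add: M.coeff.single_in_fin_supp)
  have "single K1 \<one>\<^bsub>K1\<^esub> p \<noteq> (\<lambda>_. \<zero>\<^bsub>K1\<^esub>)"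
    using M.nontrivial by (auto simp: single_def fun_eq_iff)
  then have "\<phi> (single K1 \<one>\<^bsub>K1\<^esub> p) \<noteq> (\<lambda>_. \<zero>\<^bsub>K2\<^esub>)"
    using hom_zero_iff[OF s] by simp
  then have "\<phi> (single K1 \<one>\<^bsub>K1\<^esub> p) p \<noteq> \<zero>\<^bsub>K2\<^esub>"
    using hom_single[OF p] N.coeff.single_zero by (metis M.coeff.one_closed)
  then have "p \<in> P2"
    using N.coeff.fin_suppD(3)[OF hom_closed[OF s]] by blast
  then show ?thesis
    using tail_class_eq[OF M.P p] tail_class_eq[OF N.P] by blast
qed

text \<open>
  A polynomial in $c$ acts on every multiple of $q$ as multiplication by its value at the product
  of the weights. For one direction, the preimage of $q$ is a multiple of $q$ and is annihilated
  together with $q$; for the other, so is the image of $q$.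
\<close>

lemma same_annihilator:
  assumes q: "q \<in> P1" "c @- q = q" and as: "set as \<subseteq> carrier K"
  shows "M.horner c as = \<zero>\<^bsub>K1\<^esub> \<longleftrightarrow> N.horner c as = \<zero>\<^bsub>K2\<^esub>"
proof
  let ?v = "tail E (shd q)"
  have q2: "q \<in> P2" using same_class q by simp
  have v: "?v \<in> verts E" using M.src_vert q by blast
  have c: "set c \<subseteq> arcs E" using M.walk_act_single[of c q "\<zero>\<^bsub>K1\<^esub>"] q by simp
  note h = M.horner_closed[OF c as] N.horner_closed[OF c as]
  {
    assume z: "M.horner c as = \<zero>\<^bsub>K1\<^esub>"
    have s: "single K2 \<one>\<^bsub>K2\<^esub> q \<in> fin_supp K2 P2" using q2 by (simp add: N.coeff.single_in_fin_supp)
    then obtain m where m: "m \<in> fin_supp K1 P1" "\<phi> m = single K2 \<one>\<^bsub>K2\<^esub> q" by (rule surj)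
    have mq: "m = single K1 (m q) q" "m q \<in> carrier K1"
      using preimage_single[OF q2 _ m] M.coeff.fin_suppD(1)[OF m(1)] by simp_all
    have "poly_act K E M ?v c as m = (\<lambda>_. \<zero>\<^bsub>K1\<^esub>)"
      using M.poly_act_single[OF q mq(2) as] mq z M.coeff.single_zero by simp
    then have "poly_act K E N ?v c as (\<phi> m) = (\<lambda>_. \<zero>\<^bsub>K2\<^esub>)"
      using hom_poly_act[OF c v as m(1)] hom_zero_iff[OF M.coeff.zero_in_fin_supp] by simp
    then have "single K2 (N.horner c as) q = (\<lambda>_. \<zero>\<^bsub>K2\<^esub>)"
      using N.poly_act_single[OF q2 q(2) _ as, of "\<one>\<^bsub>K2\<^esub>"] m(2) h by simp
    then show "N.horner c as = \<zero>\<^bsub>K2\<^esub>"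
      by (metis single_def)
  next
    assume z: "N.horner c as = \<zero>\<^bsub>K2\<^esub>"
    let ?m = "single K1 \<one>\<^bsub>K1\<^esub> q"
    have s: "?m \<in> fin_supp K1 P1" using q by (simp add: M.coeff.single_in_fin_supp)
    have y: "\<phi> ?m q \<in> carrier K2" using N.coeff.fin_suppD(1)[OF hom_closed[OF s]] .
    have "poly_act K E N ?v c as (\<phi> ?m) = (\<lambda>_. \<zero>\<^bsub>K2\<^esub>)"
      using N.poly_act_single[OF q2 q(2) y as] hom_single[OF q(1) M.coeff.one_closed] z y
        N.coeff.single_zero by simp
    then have "poly_act K E M ?v c as ?m = (\<lambda>_. \<zero>\<^bsub>K1\<^esub>)"
      using hom_poly_act[OF c v as s] hom_zero_iff[OF M.poly_act_closed[OF c v as s]] by simp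
    then have "single K1 (M.horner c as) q = (\<lambda>_. \<zero>\<^bsub>K1\<^esub>)"
      using M.poly_act_single[OF q _ as, of "\<one>\<^bsub>K1\<^esub>"] h by simp
    then show "M.horner c as = \<zero>\<^bsub>K1\<^esub>"
      by (metis single_def)
  }
qed

end

section \<open>Laurent polynomials modulo a polynomial with constant term one\<close>

lemma (in cring) bilinear_ext_unique_term:
  assumes "f a \<in> carrier R" "g b \<in> carrier R" "opr a b = Some z"
    and "\<And>x y. \<lbrakk>f x \<noteq> \<zero>; g y \<noteq> \<zero>; opr x y = Some z\<rbrakk> \<Longrightarrow> x = a \<and> y = b"
  shows "bilinear_ext R opr f g z = f a \<otimes> g b"
proof (cases "f a = \<zero> \<or> g b = \<zero>")
  case True
  then have none: "{(x, y). f x \<noteq> \<zero> \<and> g y \<noteq> \<zero> \<and> opr x y = Some z} = {}"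
    using assms(4) by blast
  have "bilinear_ext R opr f g z = \<zero>"
    unfolding bilinear_ext_def none by (rule finsum_empty)
  also have "\<dots> = f a \<otimes> g b" using True assms(1,2) by auto
  finally show ?thesis .
next
  case False
  then have "{(x, y). f x \<noteq> \<zero> \<and> g y \<noteq> \<zero> \<and> opr x y = Some z} = {(a, b)}"
    using assms(3,4) by blast
  then show ?thesis
    using assms unfolding bilinear_ext_def by simp
qed

locale laurent = field K for K :: "('k, 'r) ring_scheme" (structure)
begin

abbreviation "L \<equiv> laurent_ring K"

sublocale L: cring L
  unfolding laurent_ring_def
  by (rule cring_monoid_algebra) (use abelian_integer_group in \<open>simp add: comm_group_def\<close>)

lemma laurent_simps [simp]:
  "carrier L = fin_supp K UNIV"
  "x \<otimes>\<^bsub>L\<^esub> y = bilinear_ext K (\<lambda>x y. Some (x + y)) x y"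
  "\<one>\<^bsub>L\<^esub> = single K \<one> 0" "\<zero>\<^bsub>L\<^esub> = (\<lambda>_. \<zero>)" "x \<oplus>\<^bsub>L\<^esub> y = (\<lambda>b. x b \<oplus> y b)"
  by (simp_all add: laurent_ring_def)

text \<open>
  Write $h = gf$. The lowest term of $g$ survives in the product because $f$ has constant term
  $1$, so $g$ has no negative exponents. The highest term of $g$ survives because the product of
  leading coefficients is nonzero, so $g$ has no positive ones. Hence $g$ is constant, and the
  constant terms show that $g = 1$.
\<close>

lemma multiple_eq:
  assumes f: "f \<in> carrier L" "f 0 = \<one>" "\<And>i. f i \<noteq> \<zero> \<Longrightarrow> 0 \<le> i \<and> i \<le> n" "f n \<noteq> \<zero>"
    and h: "h 0 = \<one>" "\<And>i. h i \<noteq> \<zero> \<Longrightarrow> 0 \<le> i \<and> i \<le> n"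
    and mem: "h \<in> PIdl\<^bsub>L\<^esub> f"
  shows "h = f"
proof -
  from mem obtain g where g: "g \<in> carrier L" and hg: "h = g \<otimes>\<^bsub>L\<^esub> f"
    unfolding cgenideal_def by blast
  have c: "g i \<in> carrier K" "f i \<in> carrier K" for i
    using fin_suppD(1)[of g UNIV] fin_suppD(1)[of f UNIV] g f(1) by simp_all
  have fin: "finite {i. g i \<noteq> \<zero>}"
    using fin_suppD(2)[of g UNIV] g by simp
  have ne: "{i. g i \<noteq> \<zero>} \<noteq> {}"
  proof
    assume "{i. g i \<noteq> \<zero>} = {}"
    then have "g = (\<lambda>_. \<zero>)" by auto
    then have "h 0 = \<zero>" using hg by simp
    then show False using h(1) by simp
  qed
  \<comment> \<open>The lowest and the highest exponent of \<open>g\<close>.\<close>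
  define a where "a = Min {i. g i \<noteq> \<zero>}"
  define b where "b = Max {i. g i \<noteq> \<zero>}"
  have ab: "g a \<noteq> \<zero>" "g b \<noteq> \<zero>"
    using Min_in[OF fin ne] Max_in[OF fin ne] by (simp_all add: a_def b_def)
  have bounds: "a \<le> i" "i \<le> b" if "g i \<noteq> \<zero>" for i
    using Min_le[OF fin, of i] Max_ge[OF fin, of i] that by (simp_all add: a_def b_def)
  have lowest: "x = a \<and> y = 0" if "g x \<noteq> \<zero>" "f y \<noteq> \<zero>" "x + y = a" for x y
    using bounds(1)[OF that(1)] f(3)[OF that(2)] that(3) by linarith
  have highest: "x = b \<and> y = n" if "g x \<noteq> \<zero>" "f y \<noteq> \<zero>" "x + y = b + n" for x y
    using bounds(2)[OF that(1)] f(3)[OF that(2)] that(3) by linarith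
  have "h a = g a \<otimes> f 0"
    unfolding hg laurent_simps
    by (rule bilinear_ext_unique_term) (use lowest in \<open>simp_all add: c\<close>)
  then have "0 \<le> a"
    using ab(1) f(2) c h(2)[of a] by simp
  moreover have "h (b + n) = g b \<otimes> f n"
    unfolding hg laurent_simps
    by (rule bilinear_ext_unique_term) (use highest in \<open>simp_all add: c\<close>)
  then have "b + n \<le> n"
    using ab(2) f(4) c integral_iff[of "g b" "f n"] h(2)[of "b + n"] by simp
  ultimately have zero: "i = 0" if "g i \<noteq> \<zero>" for i
    using bounds[OF that] by linarith
  have "x = 0 \<and> y = 0" if "g x \<noteq> \<zero>" "f y \<noteq> \<zero>" "x + y = 0" for x y
    using zero[OF that(1)] that(3) by linarith
  then have "h 0 = g 0 \<otimes> f 0"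
    unfolding hg laurent_simps
    by (intro bilinear_ext_unique_term) (simp_all add: c)
  then have "g 0 = \<one>" using f(2) h(1) c by simp
  then have "g = \<one>\<^bsub>L\<^esub>"
    using zero by (fastforce simp: single_def)
  then show ?thesis using hg L.l_one[OF f(1)] by simp
qed

lemma chen_poly_degree:
  assumes "f \<in> chen_polys K"
  obtains n where "n \<ge> 1" "f n \<noteq> \<zero>" "\<And>i. f i \<noteq> \<zero> \<Longrightarrow> 0 \<le> i \<and> i \<le> n"
proof -
  obtain d :: int where d: "\<forall>i. i < 0 \<or> i > d \<longrightarrow> f i = \<zero>"
    using assms unfolding chen_polys_def by blast
  have f: "f \<in> carrier L" "f 0 = \<one>" "f \<notin> Units L"
    using assms unfolding chen_polys_def ring_irreducible_def irreducible_def by blast+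
  have pos: "0 \<le> i" if "f i \<noteq> \<zero>" for i
    using d that by (meson not_le)
  let ?S = "{i. f i \<noteq> \<zero>}"
  have fin: "finite ?S" using f(1) by (auto dest: fin_suppD)
  have "0 \<in> ?S" using f(2) by simp
  then have mm: "Max ?S \<in> ?S" "0 \<le> Max ?S" using fin Max_in[OF fin] Max_ge[OF fin, of 0] by blast+
  have "Max ?S \<noteq> 0"
  proof
    assume 0: "Max ?S = 0"
    have "f i = \<zero>" if "i \<noteq> 0" for i
      using pos[of i] Max_ge[OF fin, of i] 0 that by force
    then have "f = \<one>\<^bsub>L\<^esub>" using f(2) by (auto simp: single_def fun_eq_iff)
    then show False using f(3) L.Units_one_closed by simp
  qed
  then show ?thesis
    using that[of "Max ?S"] mm pos Max_ge[OF fin] by auto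
qed

text \<open>
  The polynomial of smaller degree is a multiple of the other one.
\<close>

lemma chen_polys_eqI:
  assumes f: "f \<in> chen_polys K" and f': "f' \<in> chen_polys K"
    and "f \<in> PIdl\<^bsub>L\<^esub> f'" "f' \<in> PIdl\<^bsub>L\<^esub> f"
  shows "f = f'"
proof -
  obtain n where n: "n \<ge> 1" "f n \<noteq> \<zero>" "\<And>i. f i \<noteq> \<zero> \<Longrightarrow> 0 \<le> i \<and> i \<le> n"
    by (rule chen_poly_degree[OF f]) (rule that; blast)
  obtain n' where n': "n' \<ge> 1" "f' n' \<noteq> \<zero>" "\<And>i. f' i \<noteq> \<zero> \<Longrightarrow> 0 \<le> i \<and> i \<le> n'"
    by (rule chen_poly_degree[OF f']) (rule that; blast)
  have c: "f \<in> carrier L" "f 0 = \<one>" "f' \<in> carrier L" "f' 0 = \<one>"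
    using f f' unfolding chen_polys_def by blast+
  show ?thesis
  proof (cases "n \<le> n'")
    case True
    have bound: "0 \<le> i \<and> i \<le> n'" if "f i \<noteq> \<zero>" for i
      using n(3)[OF that] True by linarith
    show ?thesis
      by (rule multiple_eq[OF c(3,4) n'(3,2) c(2) bound assms(3)])
  next
    case False
    have bound: "0 \<le> i \<and> i \<le> n" if "f' i \<noteq> \<zero>" for i
      using n'(3)[OF that] False by linarith
    have "f' = f"
      by (rule multiple_eq[OF c(1,2) n(3,2) c(4) bound assms(4)])
    then show ?thesis ..
  qed
qed

definition of_coeffs :: "'k list \<Rightarrow> int \<Rightarrow> 'k" where
  "of_coeffs as = (\<lambda>i. if 0 \<le> i \<and> i < int (length as) then as ! nat i else \<zero>)"

lemma of_coeffs_closed: "set as \<subseteq> carrier K \<Longrightarrow> of_coeffs as \<in> carrier L"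
  unfolding laurent_simps
  by (rule fin_suppI)
    (auto simp: of_coeffs_def subset_iff intro: finite_subset[of _ "{0..<int (length as)}"])

lemma single_closed: "k \<in> carrier K \<Longrightarrow> single K k i \<in> carrier L"
  by (simp add: single_in_fin_supp)

lemma of_coeffs_Cons:
  assumes a: "a \<in> carrier K" and as: "set as \<subseteq> carrier K"
  shows "of_coeffs (a # as) = single K a 0 \<oplus>\<^bsub>L\<^esub> single K \<one> 1 \<otimes>\<^bsub>L\<^esub> of_coeffs as"
proof
  fix i
  have c: "of_coeffs as j \<in> carrier K" for j
    using of_coeffs_closed[OF as] fin_suppD(1)[of "of_coeffs as" UNIV] by simp
  have "bilinear_ext K (\<lambda>x y. Some (x + y)) (single K \<one> 1) (of_coeffs as) i = single K \<one> 1 (1 :: int) \<otimes> of_coeffs as (i - 1)"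
    by (rule bilinear_ext_unique_term) (use c in \<open>auto simp: single_def split: if_splits\<close>)
  then have shift: "bilinear_ext K (\<lambda>x y. Some (x + y)) (single K \<one> 1) (of_coeffs as) i = of_coeffs as (i - 1)"
    using c by (simp add: single_def)
  have "of_coeffs (a # as) i = (if i = 0 then a else of_coeffs as (i - 1))"
    by (auto simp: of_coeffs_def nth_Cons' nat_diff_distrib)
  moreover have "of_coeffs as (- 1) = \<zero>"
    by (simp add: of_coeffs_def)
  ultimately show "of_coeffs (a # as) i = (single K a 0 \<oplus>\<^bsub>L\<^esub> single K \<one> 1 \<otimes>\<^bsub>L\<^esub> of_coeffs as) i"
    unfolding laurent_simps shift using a c by (cases "i = 0") (simp_all add: single_def)
qed

lemma chen_poly_coeffs:
  assumes "f \<in> chen_polys K"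
  obtains as where "set as \<subseteq> carrier K" "of_coeffs as = f"
proof -
  obtain n where n: "n \<ge> 1" "\<And>i. f i \<noteq> \<zero> \<Longrightarrow> 0 \<le> i \<and> i \<le> n"
    by (rule chen_poly_degree[OF assms]) (rule that; blast)
  have "f \<in> carrier L" using assms unfolding chen_polys_def by blast
  then have f: "f i \<in> carrier K" for i
    using fin_suppD(1)[of f UNIV] by simp
  show ?thesis
  proof (rule that)
    show "set (map (\<lambda>i. f (int i)) [0..<Suc (nat n)]) \<subseteq> carrier K"
      using f by auto
    show "of_coeffs (map (\<lambda>i. f (int i)) [0..<Suc (nat n)]) = f"
    proof
      fix i
      show "of_coeffs (map (\<lambda>i. f (int i)) [0..<Suc (nat n)]) i = f i"
      proof (cases "0 \<le> i \<and> i \<le> n")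
        case True
        then have "nat i < Suc (nat n)" by auto
        then show ?thesis using True n(1) by (auto simp: of_coeffs_def simp del: upt_Suc)
      next
        case False
        then have "f i = \<zero>" using n(2) by blast
        then show ?thesis using False n(1) by (auto simp: of_coeffs_def)
      qed
    qed
  qed
qed

end

locale chen_extension = laurent K for K :: "('k, 'r) ring_scheme" (structure) +
  fixes f assumes f: "f \<in> chen_polys K"
begin

abbreviation "J \<equiv> PIdl\<^bsub>L\<^esub> f"
abbreviation "K' \<equiv> ext_field K f"
abbreviation "cls x \<equiv> J +>\<^bsub>L\<^esub> x"

lemma f_closed: "f \<in> carrier L"
  using f by (simp add: chen_polys_def)

sublocale J: ideal J L
  by (rule L.cgenideal_ideal[OF f_closed])

sublocale K': cring K'
  unfolding ext_field_def by (rule J.quotient_is_cring[OF L.cring_axioms])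

sublocale cls: ring_hom_ring L K' "\<lambda>x. cls x"
  unfolding ext_field_def using J.rcos_ring_hom_ring by simp

lemma cls_zero_iff: "x \<in> carrier L \<Longrightarrow> cls x = \<zero>\<^bsub>K'\<^esub> \<longleftrightarrow> x \<in> J"
  using J.a_rcos_const J.rcos_const_imp_mem[of x] by (auto simp: ext_field_def FactRing_def)

text \<open>
  Otherwise $1$ would be a multiple of $f$ of no larger degree, hence equal to $f$.
\<close>

lemma one_not_zero: "\<one>\<^bsub>K'\<^esub> \<noteq> \<zero>\<^bsub>K'\<^esub>"
proof
  assume "\<one>\<^bsub>K'\<^esub> = \<zero>\<^bsub>K'\<^esub>"
  then have one: "\<one>\<^bsub>L\<^esub> \<in> J"
    using cls_zero_iff[OF L.one_closed] cls.hom_one by simp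
  obtain n where n: "n \<ge> 1" "f n \<noteq> \<zero>" "\<And>i. f i \<noteq> \<zero> \<Longrightarrow> 0 \<le> i \<and> i \<le> n"
    by (rule chen_poly_degree[OF f]) (rule that; blast)
  have "\<one>\<^bsub>L\<^esub> = f"
    by (rule multiple_eq[OF f_closed _ n(3,2) _ _ one])
      (use f n in \<open>auto simp: chen_polys_def single_def split: if_splits\<close>)
  then have "f n = \<one>\<^bsub>L\<^esub> n" by simp
  then show False using n by (simp add: single_def)
qed

lemma one_minus_x_notin: "of_coeffs [\<one>, \<ominus> \<one>] \<notin> J"
proof
  assume mem: "of_coeffs [\<one>, \<ominus> \<one>] \<in> J"
  obtain n where n: "n \<ge> 1" "f n \<noteq> \<zero>" "\<And>i. f i \<noteq> \<zero> \<Longrightarrow> 0 \<le> i \<and> i \<le> n"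
    by (rule chen_poly_degree[OF f]) (rule that; blast)
  have "of_coeffs [\<one>, \<ominus> \<one>] = f"
    by (rule multiple_eq[OF f_closed _ n(3,2) _ _ mem])
      (use f n in \<open>auto simp: chen_polys_def of_coeffs_def split: if_splits\<close>)
  moreover have "of_coeffs [\<one>, \<ominus> \<one>] = \<one>\<^bsub>L\<^esub> \<ominus>\<^bsub>L\<^esub> single K \<one> 1"
  proof -
    have "single K (\<ominus> \<one>) 1 \<oplus>\<^bsub>L\<^esub> single K \<one> 1 = \<zero>\<^bsub>L\<^esub>"
      by (auto simp: single_def l_neg fun_eq_iff)
    then have "\<ominus>\<^bsub>L\<^esub> single K \<one> 1 = single K (\<ominus> \<one>) 1"
      by (rule L.minus_equality) (auto intro: single_in_fin_supp)
    then show ?thesis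
      by (auto simp: a_minus_def of_coeffs_def single_def fun_eq_iff nth_Cons')
  qed
  ultimately show False using f by (simp add: chen_polys_def)
qed

lemma ext_const_hom: "ext_const K f \<in> ring_hom K K'"
proof (rule ring_hom_memI)
  fix x y assume xy: "x \<in> carrier K" "y \<in> carrier K"
  show "ext_const K f x \<in> carrier K'"
    unfolding ext_const_def using xy by (intro cls.hom_closed single_closed)
  have "single K (x \<otimes> y) 0 = single K x 0 \<otimes>\<^bsub>L\<^esub> single K y (0::int)"
    "single K (x \<oplus> y) 0 = single K x 0 \<oplus>\<^bsub>L\<^esub> single K y (0::int)"
    using xy by (simp_all add: bilinear_ext_single single_add)
  then show "ext_const K f (x \<otimes> y) = ext_const K f x \<otimes>\<^bsub>K'\<^esub> ext_const K f y"
    "ext_const K f (x \<oplus> y) = ext_const K f x \<oplus>\<^bsub>K'\<^esub> ext_const K f y"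
    unfolding ext_const_def using xy by (simp_all only: cls.hom_mult cls.hom_add single_closed)
next
  show "ext_const K f \<one> = \<one>\<^bsub>K'\<^esub>"
    using cls.hom_one by (simp add: ext_const_def)
qed

lemma ext_x_unit: "ext_x K f \<in> Units K'"
proof -
  have "single K \<one> 1 \<otimes>\<^bsub>L\<^esub> single K \<one> (- 1) = \<one>\<^bsub>L\<^esub>" "single K \<one> (- 1) \<otimes>\<^bsub>L\<^esub> single K \<one> 1 = \<one>\<^bsub>L\<^esub>"
    by (simp_all add: bilinear_ext_single)
  then have "ext_x K f \<otimes>\<^bsub>K'\<^esub> cls (single K \<one> (- 1)) = \<one>\<^bsub>K'\<^esub>" "cls (single K \<one> (- 1)) \<otimes>\<^bsub>K'\<^esub> ext_x K f = \<one>\<^bsub>K'\<^esub>"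
    unfolding ext_x_def using cls.hom_mult[OF single_closed single_closed] cls.hom_one
    by (metis one_closed)+
  then show ?thesis
    unfolding Units_def ext_x_def using cls.hom_closed single_closed one_closed by blast
qed

lemma horner_eq_cls:
  assumes "set as \<subseteq> carrier K"
  shows "foldr (\<lambda>a y. ext_const K f a \<oplus>\<^bsub>K'\<^esub> ext_x K f \<otimes>\<^bsub>K'\<^esub> y) as \<zero>\<^bsub>K'\<^esub> = cls (of_coeffs as)"
  using assms
proof (induction as)
  case Nil
  have "of_coeffs [] = \<zero>\<^bsub>L\<^esub>" by (auto simp: of_coeffs_def fun_eq_iff)
  then show ?case using cls.hom_zero by simp
next
  case (Cons a as)
  then have a: "a \<in> carrier K" and as: "set as \<subseteq> carrier K" by auto
  note c = single_closed[OF a] single_closed[OF one_closed] of_coeffs_closed[OF as]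
  show ?case
    using Cons.IH[OF as]
    unfolding of_coeffs_Cons[OF a as] ext_const_def ext_x_def
    by (simp only: foldr.simps o_apply cls.hom_add cls.hom_mult c L.m_closed)
qed

end

section \<open>Cycles\<close>

context wf_digraph
begin

lemma closed_walk_rotate:
  assumes "awalk u p u"
  shows "\<exists>v. awalk v (rotate k p) v"
proof (induction k)
  case (Suc k)
  then obtain v where v: "awalk v (rotate k p) v" by blast
  show ?case
  proof (cases "rotate k p")
    case (Cons e es)
    then have "awalk (head G e) es v" "v = tail G e" "e \<in> arcs G"
      using v by (auto simp: awalk_Cons_iff)
    then have "awalk (head G e) (es @ [e]) (head G e)"
      using arc_implies_awalk[of e] by (auto intro: awalk_appendI)
    then show ?thesis using Cons by auto
  qed (use v in auto)
qed (use assms in auto)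

lemma snth_cycle_rotate: "c \<noteq> [] \<Longrightarrow> Stream.cycle c !! i = hd (rotate i c)"
  using sdrop_simps(1)[of i "Stream.cycle c"] by (simp add: sdrop_cycle rotate_conv_mod[symmetric])

lemma infinite_path_cycle:
  assumes "awalk u c u" "c \<noteq> []"
  shows "infinite_path G (Stream.cycle c)"
  unfolding infinite_path_def
proof (intro conjI allI)
  show "sset (Stream.cycle c) \<subseteq> arcs G"
    using assms by (auto simp: awalk_def)
  fix i
  obtain v where v: "awalk v (rotate i c) v"
    using closed_walk_rotate[OF assms(1)] by blast
  obtain e es where e: "rotate i c = e # es"
    using assms(2) by (cases "rotate i c") auto
  have "awalk (head G e) es v" "v = tail G e"
    using v by (auto simp: e awalk_Cons_iff)
  then have "tail G (hd (es @ [e])) = head G e"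
    by (cases es) (auto simp: awalk_Cons_iff awalk_def)
  then show "head G (Stream.cycle c !! i) = tail G (Stream.cycle c !! Suc i)"
    using snth_cycle_rotate[OF assms(2), of i] snth_cycle_rotate[OF assms(2), of "Suc i"] e by simp
qed

end

text \<open>
  The length of a list without repetitions is the first positive index at which the first
  entry of its periodic continuation recurs.
\<close>

lemma cycle_eq_imp_eq:
  assumes "Stream.cycle c = Stream.cycle d" "distinct c" "distinct d" "c \<noteq> []" "d \<noteq> []"
  shows "c = d"
proof -
  have len: "\<not> length c < length d"
    if "Stream.cycle c = Stream.cycle d" "distinct d" "c \<noteq> []" for c d :: "'a list"
  proof
    assume l: "length c < length d"
    then have d: "d \<noteq> []" by auto
    have "Stream.cycle c !! length c = Stream.cycle c !! 0"
      using that(3) by (metis cycle_decomp diff_self_eq_0 order_refl shift_snth_ge)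
    moreover have nth: "Stream.cycle d !! i = d ! i" if "i < length d" for i
      using that d by (metis cycle_decomp shift_snth_less)
    ultimately have "d ! length c = d ! 0"
      using nth[OF l] nth[of 0] l that(1) by (metis gr_zeroI not_less_zero)
    then have "length c = 0" using that(2) l d by (metis length_greater_0_conv nth_eq_iff_index_eq)
    then show False using that(3) by simp
  qed
  have "length c = length d"
    using len[OF assms(1,3,4)] len[OF assms(1)[symmetric] assms(2,5)] by simp
  then show ?thesis
    using stake_cycle_eq assms by metis
qed

lemma rotations_rotate: "rotations (rotate k c) = rotations c"
proof (cases "c = []")
  case False
  show ?thesis
  proof
    show "rotations (rotate k c) \<subseteq> rotations c"
      by (auto simp: rotations_def rotate_rotate)
    have "(length c - k mod length c + k) mod length c = 0"
      using False by (metis add.commute le_add_diff_inverse2 length_greater_0_conv less_imp_le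
          mod_add_left_eq mod_less_divisor mod_self)
    then have undo: "rotate (length c - k mod length c) (rotate k c) = c"
      by (simp add: rotate_rotate rotate_id)
    show "rotations c \<subseteq> rotations (rotate k c)"
    proof
      fix d assume "d \<in> rotations c"
      then obtain j where "d = rotate j c" by (auto simp: rotations_def)
      then have "d = rotate (j + (length c - k mod length c)) (rotate k c)"
        using undo by (metis rotate_rotate)
      then show "d \<in> rotations (rotate k c)" by (auto simp: rotations_def)
    qed
  qed
qed (simp add: rotations_def)

lemma rotation_of_exclusive_cycle:
  assumes "wf_digraph E" "C \<in> exclusive_cycles E" "c \<in> C"
  shows "c \<noteq> []" "distinct c" "infinite_path E (Stream.cycle c)" "rotations c = C"
proof -
  interpret wf_digraph E by fact
  obtain d where d: "cycle d" "C = rotations d"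
    using assms(2) by (auto simp: exclusive_cycles_def exclusive_cycle_def)
  then obtain k where k: "c = rotate k d" using assms(3) by (auto simp: rotations_def)
  obtain u where u: "awalk u d u" "distinct (tl (awalk_verts u d))" "d \<noteq> []"
    using d(1) by (auto simp: cycle_def)
  then show "c \<noteq> []" "distinct c"
    using distinct_tl_verts_imp_distinct[OF u(1,2)] by (simp_all add: k)
  then show "infinite_path E (Stream.cycle c)"
    using closed_walk_rotate[OF u(1), of k] infinite_path_cycle unfolding k by blast
  show "rotations c = C"
    by (simp add: k d(2) rotations_rotate)
qed

text \<open>
  A common tail of $c^\infty$ and $d^\infty$ is the periodic continuation of a rotation of $c$ and
  of a rotation of $d$.
\<close>

lemma exclusive_cycles_eqI:
  assumes "wf_digraph E" "C \<in> exclusive_cycles E" "c \<in> C" "D \<in> exclusive_cycles E" "d \<in> D"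
    and "tail_class E (Stream.cycle c) = tail_class E (Stream.cycle d)"
  shows "C = D"
proof -
  note c = rotation_of_exclusive_cycle[OF assms(1-3)] and d = rotation_of_exclusive_cycle[OF assms(1,4,5)]
  have "Stream.cycle d \<in> tail_class E (Stream.cycle d)"
    using d(3) by (auto simp: tail_class_def tail_equivalent_def)
  then have "tail_equivalent (Stream.cycle c) (Stream.cycle d)"
    unfolding assms(6)[symmetric] by (simp add: tail_class_def)
  then obtain m n where "sdrop m (Stream.cycle c) = sdrop n (Stream.cycle d)"
    by (auto simp: tail_equivalent_def)
  then have "Stream.cycle (rotate m c) = Stream.cycle (rotate n d)"
    using c(1) d(1) by (simp add: sdrop_cycle rotate_conv_mod[symmetric])
  then have "rotate m c = rotate n d"
    using c d by (intro cycle_eq_imp_eq) auto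
  then show ?thesis
    using c(4) d(4) rotations_rotate by metis
qed

section \<open>The Chen modules\<close>

lemma iso_imp_path_module_iso:
  assumes "path_module K E K1 B1 act1 src1 j1 wt1 M" "path_module K E K2 B2 act2 src2 j2 wt2 N"
    and "left_module_iso (lpa K E) M N"
  obtains \<phi> where "path_module_iso K E K1 B1 act1 src1 j1 wt1 M K2 B2 act2 src2 j2 wt2 N \<phi>"
  using not_isoI[OF assms(1,2)] assms(3) by blast

lemma not_iso_ghost_killed:
  assumes "path_module K E K1 B1 act1 src1 j1 wt1 M" "path_module K E K2 B2 act2 src2 j2 wt2 N"
    and "ghost_killed_vertex K E M v" "\<not> ghost_killed_vertex K E N v"
  shows "\<not> left_module_iso (lpa K E) M N"
proof (rule not_isoI[OF assms(1,2)])
  fix \<phi> assume "path_module_iso K E K1 B1 act1 src1 j1 wt1 M K2 B2 act2 src2 j2 wt2 N \<phi>"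
  from path_module_iso.ghost_killed_vertex_transport[OF this assms(3)] assms(4) show False by blast
qed

lemma tail_class_in_tail_classes: "infinite_path E p \<Longrightarrow> tail_class E p \<in> tail_classes E"
  by (auto simp: tail_classes_def)

locale graph_and_field = wf_digraph E + laurent K
  for E :: "('v, 'e) pre_digraph" and K :: "('k, 'r) ring_scheme"
begin

sublocale leavitt K E
  by unfold_locales

lemma nontrivial: "\<one>\<^bsub>K\<^esub> \<noteq> \<zero>\<^bsub>K\<^esub>"
  by simp

lemma chen_sink_path_module:
  assumes "w \<in> sinks E"
  shows "path_module K E K {(u, p). awalk u p w} (finite_path_act E) fst (\<lambda>k. k) (\<lambda>_. \<one>\<^bsub>K\<^esub>) (chen_sink K E w)"
proof -
  interpret path_action E "{(u, p). awalk u p w}" "finite_path_act E" fst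
    by (rule path_action_finite_paths[OF wf_digraph_axioms assms])
  interpret basis_action K E "{(u, p). awalk u p w}" "finite_path_act E" fst
    by unfold_locales
  show ?thesis
    unfolding chen_sink_def by (rule path_module_basis_module[OF nontrivial])
qed

lemma chen_sink_ghost_killed_vertex:
  assumes "w \<in> sinks E"
  shows "ghost_killed_vertex K E (chen_sink K E w) v \<longleftrightarrow> v = w"
proof -
  interpret path_module K E K "{(u, p). awalk u p w}" "finite_path_act E" fst "\<lambda>k. k" "\<lambda>_. \<one>\<^bsub>K\<^esub>" "chen_sink K E w"
    by (rule chen_sink_path_module[OF assms])
  have "u = w" if w: "awalk u p w" and k: "\<forall>e\<in>out_arcs E u. finite_path_act E (Ghost e) (u, p) = None" for u p
  proof (cases p)
    case Nil
    then show ?thesis using w by (auto simp: awalk_def)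
  next
    case (Cons e es)
    then have "e \<in> out_arcs E u" using w by (auto simp: awalk_Cons_iff)
    then have "finite_path_act E (Ghost e) (u, p) = None" using k by blast
    then show ?thesis using Cons by (simp add: finite_path_act_def)
  qed
  moreover have "awalk w [] w" using assms by (simp add: sinks_def awalk_Nil_iff)
  ultimately show ?thesis
    unfolding ghost_killed_vertex_iff
    by (auto simp: finite_path_act_def intro!: bexI[of _ "(w, [])"])
qed

end

lemma (in graph_quotient) quotient_ghost_killed:
  assumes nt: "\<one> \<noteq> \<zero>" and z: "z \<in> sinks E'"
  shows "ghost_killed_vertex K E (pullback (chen_sink K E' z) (quotient_hom K E H S)) v \<longleftrightarrow> v = untag z"
proof -
  interpret path_module K E K "paths_to z" tagged_act "\<lambda>b. untag (fst b)" "\<lambda>k. k" "\<lambda>_. \<one>"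
    "pullback (chen_sink K E' z) (quotient_hom K E H S)"
    by (rule path_module_quotient[OF z nt])
  have "u = z" if w: "target.awalk u p z" and
    k: "\<forall>e\<in>out_arcs E (untag u). tagged_act (Ghost e) (u, p) = None" for u p
  proof (cases p)
    case Nil
    then show ?thesis using w by (auto simp: target.awalk_def)
  next
    case (Cons x xs)
    then have x: "x \<in> arcs E'" "u = Orig (tail E (untag x))"
      using w by (auto simp: target.awalk_Cons_iff)
    then have "untag x \<in> arcs E" by (cases x) auto
    then have "untag x \<in> out_arcs E (untag u)" using x by simp
    then have "tagged_act (Ghost (untag x)) (u, p) = None" using k by blast
    then show ?thesis using Cons by (simp add: tagged_act_simps)
  qed
  then have "v = untag z" if "b \<in> paths_to z" "untag (fst b) = v"
      "\<forall>e\<in>out_arcs E v. tagged_act (Ghost e) b = None" for b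
    using that by (cases b) auto
  moreover have "(z, []) \<in> paths_to z" using z by (simp add: sinks_def target.awalk_Nil_iff)
  moreover have "\<forall>e\<in>out_arcs E (untag z). tagged_act (Ghost e) (z, []) = None"
    by (simp add: tagged_act_simps)
  ultimately show ?thesis
    unfolding ghost_killed_vertex_iff by (metis fst_conv)
qed

context graph_and_field
begin

definition ghost_killed_exactly ::
  "((('v, 'e) lpa_gen list \<Rightarrow> 'k) set, 'b \<Rightarrow> 'k) module \<Rightarrow> 'v \<Rightarrow> bool" where
  "ghost_killed_exactly M v \<longleftrightarrow> (\<exists>B act src j wt. path_module K E K B act src j wt M) \<and>
     (\<forall>u. ghost_killed_vertex K E M u \<longleftrightarrow> u = v)"

lemma not_iso_exactly:
  assumes "ghost_killed_exactly M u" "ghost_killed_exactly N v" "u \<noteq> v"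
  shows "\<not> left_module_iso (lpa K E) M N"
  using assms not_iso_ghost_killed unfolding ghost_killed_exactly_def by metis

lemma infinite_path_module_ghost_killed:
  assumes "infinite_path_module K E K' P j wt M"
  shows "\<not> ghost_killed_vertex K E M v"
proof -
  interpret infinite_path_module K E K' P j wt M by fact
  have "infinite_path_act E (Ghost (shd p)) p \<noteq> None" "shd p \<in> out_arcs E (tail E (shd p))" if "p \<in> P" for p
    using that P_SCons[of "shd p" "stl p"] by (auto simp: infinite_path_act_def)
  then show ?thesis
    unfolding ghost_killed_vertex_iff by blast
qed

lemma not_iso_exactly_infinite:
  assumes "ghost_killed_exactly M u" "infinite_path_module K E K' P j wt N"
  shows "\<not> left_module_iso (lpa K E) M N"
  using assms not_iso_ghost_killed[OF _ infinite_path_module.axioms(1)[OF assms(2)]]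
    infinite_path_module_ghost_killed[OF assms(2)] unfolding ghost_killed_exactly_def by metis

lemma chen_sink_ghost_killed: "w \<in> sinks E \<Longrightarrow> ghost_killed_exactly (chen_sink K E w) w"
  using chen_sink_path_module chen_sink_ghost_killed_vertex unfolding ghost_killed_exactly_def by blast

text \<open>
  Edges of the quotient graph start at unmarked vertices, so the marked copy of $v$ is a sink.
\<close>

lemma chen_breaking_ghost_killed:
  assumes v: "v \<in> breaking_emitters E"
  shows "ghost_killed_exactly (chen_breaking K E v) v"
proof -
  let ?H = "non_ancestors E v" and ?S = "breaking_verts E (non_ancestors E v) - {v}"
  have inf: "v \<in> infinite_emitters E" and br: "v \<in> breaking_verts E ?H"
    using v by (auto simp: breaking_emitters_def)
  interpret graph_quotient K E ?H ?S by (rule graph_quotient_non_ancestors[OF inf])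
  have z: "Prime v \<in> sinks E'"
    using br by (auto simp: sinks_def)
  show ?thesis
    using path_module_quotient[OF z nontrivial] quotient_ghost_killed[OF nontrivial z]
    unfolding ghost_killed_exactly_def chen_breaking_def Let_def untag.simps by blast
qed

text \<open>
  Edges leaving $v$ lead into $H(v)$ and disappear. No marked edges are present, because all
  breaking vertices belong to $S$. So $v$ is a sink of the quotient graph.
\<close>

lemma chen_emitter_ghost_killed:
  assumes v: "v \<in> terminal_emitters E"
  shows "ghost_killed_exactly (chen_emitter K E v) v"
proof -
  let ?H = "non_ancestors E v" and ?S = "breaking_verts E (non_ancestors E v)"
  have inf: "v \<in> infinite_emitters E" and te: "head E ` out_arcs E v \<subseteq> ?H"
    using v by (auto simp: terminal_emitters_def)
  interpret graph_quotient K E ?H ?S by (rule graph_quotient_non_ancestors[OF inf])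
  have "v \<in> verts E" "v \<notin> ?H"
    using inf by (auto simp: infinite_emitters_def non_ancestors_def ancestors_def)
  moreover have "head E e \<in> ?H" if "e \<in> arcs E" "tail E e = v" for e
    using te that by auto
  then have "x \<notin> out_arcs E' (Orig v)" for x
    by (cases x) auto
  then have "out_arcs E' (Orig v) = {}" by blast
  ultimately have z: "Orig v \<in> sinks E'"
    by (simp add: sinks_def)
  show ?thesis
    using path_module_quotient[OF z nontrivial] quotient_ghost_killed[OF nontrivial z]
    unfolding ghost_killed_exactly_def chen_emitter_def Let_def untag.simps by blast
qed

lemma chen_path_module:
  assumes P: "P \<in> tail_classes E"
  shows "infinite_path_module K E K P (\<lambda>k. k) (\<lambda>_. \<one>\<^bsub>K\<^esub>) (chen_path K E P)"
proof -
  interpret path_action E P "infinite_path_act E" "\<lambda>p. tail E (shd p)"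
    by (rule path_action_tail_class[OF wf_digraph_axioms P])
  interpret basis_action K E P "infinite_path_act E" "\<lambda>p. tail E (shd p)"
    by unfold_locales
  show ?thesis
    unfolding chen_path_def
    by (intro infinite_path_module.intro infinite_path_module_axioms.intro P path_module_basis_module nontrivial)
qed

lemma chen_twisted_module:
  assumes "C \<in> exclusive_cycles E" "c \<in> C" and f: "f \<in> chen_polys K"
  shows "infinite_path_module K E (ext_field K f) (tail_class E (Stream.cycle c)) (ext_const K f)
    (twist_weight (ext_field K f) (ext_x K f) (hd c)) (chen_twisted K E c f)"
proof -
  interpret chen_extension K f by unfold_locales (rule f)
  note c = rotation_of_exclusive_cycle[OF wf_digraph_axioms assms(1,2)]
  have P: "tail_class E (Stream.cycle c) \<in> tail_classes E"
    using c(3) by (rule tail_class_in_tail_classes)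
  have "hd c \<in> arcs E"
    using c(1,3) by (auto simp: infinite_path_def)
  then show ?thesis
    unfolding chen_twisted_def Let_def ext_lpa_def
    by (intro infinite_path_module.intro infinite_path_module_axioms.intro P path_module_twisted
        wf_digraph_axioms is_cring K'.is_cring ext_const_hom one_not_zero ext_x_unit)
qed

text \<open>
  Since the product of the weights of \<open>c\<close> is $1$, the polynomial $1 - x$ annihilates.
\<close>

lemma chen_path_horner:
  assumes "infinite_path_module K E K P (\<lambda>k. k) (\<lambda>_. \<one>\<^bsub>K\<^esub>) M"
  shows "infinite_path_module.horner K (\<lambda>k. k) (\<lambda>_ :: ('v, 'e) lpa_gen. \<one>\<^bsub>K\<^esub>) c [\<one>\<^bsub>K\<^esub>, \<ominus>\<^bsub>K\<^esub> \<one>\<^bsub>K\<^esub>] = \<zero>\<^bsub>K\<^esub>"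
proof -
  interpret M: infinite_path_module K E K P "\<lambda>k. k" "\<lambda>_. \<one>\<^bsub>K\<^esub>" M by fact
  have "M.walk_wt c = \<one>\<^bsub>K\<^esub>"
    by (induction c) (simp_all add: M.walk_wt_def)
  then show ?thesis
    by (simp add: M.horner_def r_neg)
qed

text \<open>
  The cycle runs through its first edge only once, so the product of its weights is the class
  of $x$.
\<close>

lemma chen_twisted_horner_zero_iff:
  assumes "infinite_path_module K E (ext_field K f) P (ext_const K f)
      (twist_weight (ext_field K f) (ext_x K f) (hd c)) M"
    and f: "f \<in> chen_polys K" and c: "c \<noteq> []" "distinct c" and as: "set as \<subseteq> carrier K"
  shows "infinite_path_module.horner (ext_field K f) (ext_const K f)
      (twist_weight (ext_field K f) (ext_x K f) (hd c) :: ('v, 'e) lpa_gen \<Rightarrow> _) c as = \<zero>\<^bsub>ext_field K f\<^esub> \<longleftrightarrow>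
    of_coeffs as \<in> PIdl\<^bsub>laurent_ring K\<^esub> f"
proof -
  interpret chen_extension K f by unfold_locales (rule f)
  interpret M: infinite_path_module K E K' P "ext_const K f" "twist_weight K' (ext_x K f) (hd c)" M by fact
  obtain e es where ces: "c = e # es" using c(1) by (cases c) auto
  let ?w = "twist_weight K' (ext_x K f) e :: ('v, 'e) lpa_gen \<Rightarrow> _"
  have rest: "foldr (\<lambda>e' y. ?w (Edge e') \<otimes>\<^bsub>K'\<^esub> y) es \<one>\<^bsub>K'\<^esub> = \<one>\<^bsub>K'\<^esub>" if "e \<notin> set es" for es
    using that by (induction es) (auto simp: twist_weight_def)
  have "M.walk_wt c = foldr (\<lambda>e' y. ?w (Edge e') \<otimes>\<^bsub>K'\<^esub> y) c \<one>\<^bsub>K'\<^esub>"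
    unfolding M.walk_wt_def by (simp add: ces)
  also have "\<dots> = ?w (Edge e) \<otimes>\<^bsub>K'\<^esub> \<one>\<^bsub>K'\<^esub>"
    using c(2) by (simp add: ces rest)
  also have "\<dots> = ext_x K f"
    using K'.Units_closed[OF ext_x_unit] by (simp add: twist_weight_def)
  finally have "M.walk_wt c = ext_x K f" .
  then show ?thesis
    using horner_eq_cls[OF as] cls_zero_iff[OF of_coeffs_closed[OF as]] by (simp add: M.horner_def)
qed

lemma infinite_iso:
  assumes "infinite_path_module K E K1 P1 j1 wt1 M" "infinite_path_module K E K2 P2 j2 wt2 N"
    and "left_module_iso (lpa K E) M N"
  shows "P1 = P2"
    and "\<lbrakk>c \<noteq> []; Stream.cycle c \<in> P1; set as \<subseteq> carrier K\<rbrakk> \<Longrightarrow>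
      infinite_path_module.horner K1 j1 wt1 c as = \<zero>\<^bsub>K1\<^esub> \<longleftrightarrow>
      infinite_path_module.horner K2 j2 wt2 c as = \<zero>\<^bsub>K2\<^esub>"
proof -
  interpret M: infinite_path_module K E K1 P1 j1 wt1 M by fact
  interpret N: infinite_path_module K E K2 P2 j2 wt2 N by fact
  obtain \<phi> where "path_module_iso K E K1 P1 (infinite_path_act E) (\<lambda>p. tail E (shd p)) j1 wt1 M
      K2 P2 (infinite_path_act E) (\<lambda>p. tail E (shd p)) j2 wt2 N \<phi>"
    using iso_imp_path_module_iso[OF M.path_module_axioms N.path_module_axioms assms(3)] by blast
  then interpret infinite_path_module_iso K E K1 P1 j1 wt1 M K2 P2 j2 wt2 N \<phi>
    using assms(1,2) by (intro infinite_path_module_iso.intro)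
  show "P1 = P2" by (rule same_class)
  show "M.horner c as = \<zero>\<^bsub>K1\<^esub> \<longleftrightarrow> N.horner c as = \<zero>\<^bsub>K2\<^esub>"
    if "c \<noteq> []" "Stream.cycle c \<in> P1" "set as \<subseteq> carrier K"
    using that by (intro same_annihilator) (auto simp: cycle_decomp[symmetric])
qed

lemma chen_path_not_iso_chen_twisted:
  assumes P: "P \<in> tail_classes E" and c: "C \<in> exclusive_cycles E" "c \<in> C" and f: "f \<in> chen_polys K"
  shows "\<not> left_module_iso (lpa K E) (chen_path K E P) (chen_twisted K E c f)"
proof
  assume iso: "left_module_iso (lpa K E) (chen_path K E P) (chen_twisted K E c f)"
  interpret chen_extension K f by unfold_locales (rule f)
  note M = chen_path_module[OF P] and N = chen_twisted_module[OF c f]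
  note cyc = rotation_of_exclusive_cycle[OF wf_digraph_axioms c]
  have q: "Stream.cycle c \<in> P"
    using infinite_iso(1)[OF M N iso] cyc(3) by (auto simp: tail_class_def tail_equivalent_def)
  have as: "set [\<one>\<^bsub>K\<^esub>, \<ominus>\<^bsub>K\<^esub> \<one>\<^bsub>K\<^esub>] \<subseteq> carrier K" by simp
  have "of_coeffs [\<one>\<^bsub>K\<^esub>, \<ominus>\<^bsub>K\<^esub> \<one>\<^bsub>K\<^esub>] \<in> J"
    using infinite_iso(2)[OF M N iso cyc(1) q as] chen_path_horner[OF M]
      chen_twisted_horner_zero_iff[OF N f cyc(1,2) as] by simp
  then show False using one_minus_x_notin by simp
qed

lemma chen_twisted_iso_imp_eq:
  assumes C: "C \<in> exclusive_cycles E" "C' \<in> exclusive_cycles E"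
    and r: "r C \<in> C" "r C' \<in> C'" and f: "f \<in> chen_polys K" "f' \<in> chen_polys K"
    and iso: "left_module_iso (lpa K E) (chen_twisted K E (r C) f) (chen_twisted K E (r C') f')"
  shows "(C, f) = (C', f')"
proof -
  note M = chen_twisted_module[OF C(1) r(1) f(1)] and N = chen_twisted_module[OF C(2) r(2) f(2)]
  note cyc = rotation_of_exclusive_cycle[OF wf_digraph_axioms C(1) r(1)]
  have CC: "C = C'"
    using exclusive_cycles_eqI[OF wf_digraph_axioms C(1) r(1) C(2) r(2) infinite_iso(1)[OF M N iso]] .
  note N = N[folded CC]
  have q: "Stream.cycle (r C) \<in> tail_class E (Stream.cycle (r C))"
    using cyc(3) by (auto simp: tail_class_def tail_equivalent_def)
  have iff: "of_coeffs as \<in> PIdl\<^bsub>L\<^esub> f \<longleftrightarrow> of_coeffs as \<in> PIdl\<^bsub>L\<^esub> f'" if as: "set as \<subseteq> carrier K" for as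
    using infinite_iso(2)[OF M N iso[folded CC] cyc(1) q as]
      chen_twisted_horner_zero_iff[OF M f(1) cyc(1,2) as] chen_twisted_horner_zero_iff[OF N f(2) cyc(1,2) as]
    by simp
  obtain as where as: "set as \<subseteq> carrier K" "of_coeffs as = f" using chen_poly_coeffs[OF f(1)] .
  obtain as' where as': "set as' \<subseteq> carrier K" "of_coeffs as' = f'" using chen_poly_coeffs[OF f(2)] .
  have "f \<in> carrier L" "f' \<in> carrier L" using f by (simp_all add: chen_polys_def)
  then have "f \<in> PIdl\<^bsub>L\<^esub> f'" "f' \<in> PIdl\<^bsub>L\<^esub> f"
    using iff[OF as(1)] iff[OF as'(1)] L.cgenideal_self by (auto simp: as as')
  then show ?thesis
    using chen_polys_eqI[OF f] CC by simp
qed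

end

theorem proposition3p8:
  fixes E :: "('v, 'e) pre_digraph" and K :: "('k, 'r) ring_scheme"
    and rep :: "'e list set \<Rightarrow> 'e list"
  assumes "wf_digraph E" and "field K"
    and rep: "\<forall>C \<in> exclusive_cycles E. rep C \<in> C"
  shows
    "(\<forall>w \<in> sinks E. \<forall>w' \<in> sinks E. w \<noteq> w' \<longrightarrow>
        \<not> left_module_iso (lpa K E) (chen_sink K E w) (chen_sink K E w')) \<and>
     (\<forall>v \<in> breaking_emitters E. \<forall>v' \<in> breaking_emitters E. v \<noteq> v' \<longrightarrow>
        \<not> left_module_iso (lpa K E) (chen_breaking K E v) (chen_breaking K E v')) \<and>
     (\<forall>v \<in> terminal_emitters E. \<forall>v' \<in> terminal_emitters E. v \<noteq> v' \<longrightarrow>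
        \<not> left_module_iso (lpa K E) (chen_emitter K E v) (chen_emitter K E v')) \<and>
     (\<forall>P \<in> tail_classes E. \<forall>P' \<in> tail_classes E. P \<noteq> P' \<longrightarrow>
        \<not> left_module_iso (lpa K E) (chen_path K E P) (chen_path K E P')) \<and>
     (\<forall>C \<in> exclusive_cycles E. \<forall>f \<in> chen_polys K.
      \<forall>C' \<in> exclusive_cycles E. \<forall>f' \<in> chen_polys K. (C, f) \<noteq> (C', f') \<longrightarrow>
        \<not> left_module_iso (lpa K E) (chen_twisted K E (rep C) f) (chen_twisted K E (rep C') f')) \<and>
     (\<forall>w \<in> sinks E. \<forall>v \<in> breaking_emitters E.
        \<not> left_module_iso (lpa K E) (chen_sink K E w) (chen_breaking K E v)) \<and>
     (\<forall>w \<in> sinks E. \<forall>v \<in> terminal_emitters E.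
        \<not> left_module_iso (lpa K E) (chen_sink K E w) (chen_emitter K E v)) \<and>
     (\<forall>w \<in> sinks E. \<forall>P \<in> tail_classes E.
        \<not> left_module_iso (lpa K E) (chen_sink K E w) (chen_path K E P)) \<and>
     (\<forall>w \<in> sinks E. \<forall>C \<in> exclusive_cycles E. \<forall>f \<in> chen_polys K.
        \<not> left_module_iso (lpa K E) (chen_sink K E w) (chen_twisted K E (rep C) f)) \<and>
     (\<forall>v \<in> breaking_emitters E. \<forall>u \<in> terminal_emitters E.
        \<not> left_module_iso (lpa K E) (chen_breaking K E v) (chen_emitter K E u)) \<and>
     (\<forall>v \<in> breaking_emitters E. \<forall>P \<in> tail_classes E.
        \<not> left_module_iso (lpa K E) (chen_breaking K E v) (chen_path K E P)) \<and>
     (\<forall>v \<in> breaking_emitters E. \<forall>C \<in> exclusive_cycles E. \<forall>f \<in> chen_polys K.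
        \<not> left_module_iso (lpa K E) (chen_breaking K E v) (chen_twisted K E (rep C) f)) \<and>
     (\<forall>u \<in> terminal_emitters E. \<forall>P \<in> tail_classes E.
        \<not> left_module_iso (lpa K E) (chen_emitter K E u) (chen_path K E P)) \<and>
     (\<forall>u \<in> terminal_emitters E. \<forall>C \<in> exclusive_cycles E. \<forall>f \<in> chen_polys K.
        \<not> left_module_iso (lpa K E) (chen_emitter K E u) (chen_twisted K E (rep C) f)) \<and>
     (\<forall>P \<in> tail_classes E. \<forall>C \<in> exclusive_cycles E. \<forall>f \<in> chen_polys K.
        \<not> left_module_iso (lpa K E) (chen_path K E P) (chen_twisted K E (rep C) f))"
proof -
  interpret graph_and_field E K
    using assms(1,2) by (intro graph_and_field.intro laurent.intro)
  have emitter: "v \<notin> sinks E" if "v \<in> breaking_emitters E \<or> v \<in> terminal_emitters E" for v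
    using that by (auto simp: sinks_def breaking_emitters_def terminal_emitters_def infinite_emitters_def)
  have disjoint: "v \<notin> terminal_emitters E" if "v \<in> breaking_emitters E" for v
    using that by (fastforce simp: breaking_emitters_def terminal_emitters_def breaking_verts_def Let_def)
  have r: "rep C \<in> C" if "C \<in> exclusive_cycles E" for C
    using rep that by blast
  note killed = chen_sink_ghost_killed chen_breaking_ghost_killed chen_emitter_ghost_killed
  have sink_sink: "\<not> left_module_iso (lpa K E) (chen_sink K E w) (chen_sink K E w')"
    if "w \<in> sinks E" "w' \<in> sinks E" "w \<noteq> w'" for w w'
    by (rule not_iso_exactly[OF killed(1)[OF that(1)] killed(1)[OF that(2)] that(3)])
  have breaking_breaking: "\<not> left_module_iso (lpa K E) (chen_breaking K E v) (chen_breaking K E v')"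
    if "v \<in> breaking_emitters E" "v' \<in> breaking_emitters E" "v \<noteq> v'" for v v'
    by (rule not_iso_exactly[OF killed(2)[OF that(1)] killed(2)[OF that(2)] that(3)])
  have emitter_emitter: "\<not> left_module_iso (lpa K E) (chen_emitter K E v) (chen_emitter K E v')"
    if "v \<in> terminal_emitters E" "v' \<in> terminal_emitters E" "v \<noteq> v'" for v v'
    by (rule not_iso_exactly[OF killed(3)[OF that(1)] killed(3)[OF that(2)] that(3)])
  have sink_breaking: "\<not> left_module_iso (lpa K E) (chen_sink K E w) (chen_breaking K E v)"
    if "w \<in> sinks E" "v \<in> breaking_emitters E" for w v
    by (rule not_iso_exactly[OF killed(1)[OF that(1)] killed(2)[OF that(2)]]) (use that emitter in blast)
  have sink_emitter: "\<not> left_module_iso (lpa K E) (chen_sink K E w) (chen_emitter K E v)"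
    if "w \<in> sinks E" "v \<in> terminal_emitters E" for w v
    by (rule not_iso_exactly[OF killed(1)[OF that(1)] killed(3)[OF that(2)]]) (use that emitter in blast)
  have breaking_emitter: "\<not> left_module_iso (lpa K E) (chen_breaking K E v) (chen_emitter K E u)"
    if "v \<in> breaking_emitters E" "u \<in> terminal_emitters E" for v u
    by (rule not_iso_exactly[OF killed(2)[OF that(1)] killed(3)[OF that(2)]]) (use that disjoint in blast)
  have path_path: "\<not> left_module_iso (lpa K E) (chen_path K E P) (chen_path K E P')"
    if "P \<in> tail_classes E" "P' \<in> tail_classes E" "P \<noteq> P'" for P P'
    using infinite_iso(1)[OF chen_path_module[OF that(1)] chen_path_module[OF that(2)]] that(3) by blast
  have twisted_twisted: "\<not> left_module_iso (lpa K E) (chen_twisted K E (rep C) f) (chen_twisted K E (rep C') f')"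
    if "C \<in> exclusive_cycles E" "f \<in> chen_polys K" "C' \<in> exclusive_cycles E" "f' \<in> chen_polys K"
      "(C, f) \<noteq> (C', f')" for C f C' f'
    using chen_twisted_iso_imp_eq[of C C' rep f f', OF that(1,3) r r that(2,4)] that by blast
  have sink_path: "\<not> left_module_iso (lpa K E) (chen_sink K E v) (chen_path K E P)"
    if "v \<in> sinks E" "P \<in> tail_classes E" for v P
    by (rule not_iso_exactly_infinite[OF killed(1)[OF that(1)] chen_path_module[OF that(2)]])
  have sink_twisted: "\<not> left_module_iso (lpa K E) (chen_sink K E v) (chen_twisted K E (rep C) f)"
    if "v \<in> sinks E" "C \<in> exclusive_cycles E" "f \<in> chen_polys K" for v C f
    by (rule not_iso_exactly_infinite[OF killed(1)[OF that(1)]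
          chen_twisted_module[OF that(2) r[OF that(2)] that(3)]])
  have breaking_path: "\<not> left_module_iso (lpa K E) (chen_breaking K E v) (chen_path K E P)"
    if "v \<in> breaking_emitters E" "P \<in> tail_classes E" for v P
    by (rule not_iso_exactly_infinite[OF killed(2)[OF that(1)] chen_path_module[OF that(2)]])
  have breaking_twisted: "\<not> left_module_iso (lpa K E) (chen_breaking K E v) (chen_twisted K E (rep C) f)"
    if "v \<in> breaking_emitters E" "C \<in> exclusive_cycles E" "f \<in> chen_polys K" for v C f
    by (rule not_iso_exactly_infinite[OF killed(2)[OF that(1)]
          chen_twisted_module[OF that(2) r[OF that(2)] that(3)]])
  have emitter_path: "\<not> left_module_iso (lpa K E) (chen_emitter K E v) (chen_path K E P)"
    if "v \<in> terminal_emitters E" "P \<in> tail_classes E" for v P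
    by (rule not_iso_exactly_infinite[OF killed(3)[OF that(1)] chen_path_module[OF that(2)]])
  have emitter_twisted: "\<not> left_module_iso (lpa K E) (chen_emitter K E v) (chen_twisted K E (rep C) f)"
    if "v \<in> terminal_emitters E" "C \<in> exclusive_cycles E" "f \<in> chen_polys K" for v C f
    by (rule not_iso_exactly_infinite[OF killed(3)[OF that(1)]
          chen_twisted_module[OF that(2) r[OF that(2)] that(3)]])
  have path_twisted: "\<not> left_module_iso (lpa K E) (chen_path K E P) (chen_twisted K E (rep C) f)"
    if "P \<in> tail_classes E" "C \<in> exclusive_cycles E" "f \<in> chen_polys K" for P C f
    by (rule chen_path_not_iso_chen_twisted[OF that(1,2) r[OF that(2)] that(3)])
  show ?thesis
    by (intro conjI ballI impI;
      rule sink_sink breaking_breaking emitter_emitter path_path twisted_twisted sink_breaking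
        sink_emitter sink_path sink_twisted breaking_emitter breaking_path breaking_twisted
        emitter_path emitter_twisted path_twisted; assumption)
qed

end
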